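(* Fix integers $K\ge 2$, $k\ge 2$ and a constant $C>1$. For sequences $\theta=\theta_n$, $\rho=\rho_n$ with $0<\rho_n<\theta_n\le 1$, let $\mathcal Y$ be the adjacency matrix of a random graph drawn from $\mathrm{SBM}(n,K,\theta_n,\rho_n)$, and say that a one-step algorithm achieves consistent exact recovery if there are thresholds $\lambda=\lambda_n$ such that its output $W$ satisfies $\mathbb P(\forall\, i,j:\ W_{ij}=W^*_{ij})\to 1$ as $n\to\infty$. Put $$C_1=\theta^{\frac{3k+1}{2k+1}}n^{\frac{k-1}{2k+1}}+\theta^{\frac{4k+1}{4k+2}}n^{-\frac1{4k+2}}(\log n)^{\frac1{4k+2}},\qquad C_2^\circ=\theta^{\frac{k}{2k+1}}n^{-\frac{k}{2k+1}},$$ $$C_2=\theta^{\frac{2k-1}{4k+2}}n^{-\frac12}(\log n)^{\frac1{4k+2}},\qquad C_2^+=\theta^{\frac12}n^{-\frac{k}{2k+1}}(\log n)^{\frac1{4k+2}}.$$ There is a constant $c>0$ (depending only on $K,k,C$) such that the following hold. (1) Suppose $\theta_n/\rho_n=C$ for all $n$, and $\theta_n< c\,n^{-\frac{k-1}{k}}$ for all $n$. (a) If $c\,\theta_n>n^{-\frac{k}{k+1}}$ for all $n$, then $\mathrm{AWCD}_k^\circ$ achieves consistent exact recovery. (b) If $c\,\theta_n>n^{-\frac{2k+1}{2k+3}}(\log n)^{\frac1{2k+3}}$ for all $n$, then $\mathrm{AWCD}_k$ achieves consistent exact recovery. (c) If $c\,\theta_n>n^{-\frac{2k}{2k+1}}(\log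 n)^{\frac1{2k+1}}$ for all $n$, then $\mathrm{AWCD}_k^+$ achieves consistent exact recovery. (2) Suppose $\theta_n/\rho_n\le C$ for all $n$. (a) If $c\,(\theta_n-\rho_n)>\max\{C_1,C_2^\circ\}$ for all $n$, then $\mathrm{AWCD}_k^\circ$ achieves consistent exact recovery. (b) If $c\,(\theta_n-\rho_n)>\max\{C_1,C_2\}$ for all $n$, then $\mathrm{AWCD}_k$ achieves consistent exact recovery. (c) If $c\,(\theta_n-\rho_n)>\max\{C_1,C_2^+\}$ for all $n$, then $\mathrm{AWCD}_k^+$ achieves consistent exact recovery.
   Context: Model. $\mathrm{SBM}(n,K,\theta,\rho)$ is the random simple undirected graph on $nK$ vertices partitioned into $K$ communities $\mathcal C_1^*,\dots,\mathcal C_K^*$ of size $n$ each, whose edges are independent Bernoulli variables with mean $\theta$ for pairs of distinct vertices in the same community and mean $\rho$ for pairs in different communities. $\mathcal Y$ is its symmetric $0/1$ adjacency matrix (zero diagonal). $W^*_{ij}=1$ if $i,j$ belong to the same community and $W^*_{ij}=0$ otherwise. Algorithms (one step, input $\mathcal Y$ and a threshold $\lambda\in\mathbb R$). For a vertex $i$ and integer $k\ge1$, $\mathcal C_i^k$ denotes the set of vertices whose graph distance (minimal path length) from $i$ is exactly $k$. For all vertices $i,j$ define: - $\mathrm{AWCD}_k^\circ$: $S_{ij}=\sum_{v_1\in\mathcal C_i^k,\,v_2\in\mathcal C_j^k}\mathcal Y_{v_1v_2}$ and $N_{ij}=|\mathcal C_i^k|\,(|\mathcal C_j^k|-\mathbb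 1(i=j))$. - $\mathrm{AWCD}_k$: $S_{ij}=\sum_{v_1\in\mathcal C_i^k,\,v_2\in\mathcal C_j^k}\mathcal Y_{v_1v_2}-\mathbb 1(\mathcal Y_{ij}=1)\,(|\mathcal C_i^k|+|\mathcal C_j^k|)$ and $N_{ij}=|\mathcal C_i^k|\,(|\mathcal C_j^k|-\mathbb 1(i=j))$. - $\mathrm{AWCD}_k^+$: $S_{ij}=\sum_{v_1\in\mathcal C_i^k\setminus\mathcal C_j^{k-1},\,v_2\in\mathcal C_j^k\setminus\mathcal C_i^{k-1}}\mathcal Y_{v_1v_2}$ and $N_{ij}$ is the number of pairs $(v_1,v_2)$ with $v_1\in\mathcal C_i^k\setminus\mathcal C_j^{k-1}$, $v_2\in\mathcal C_j^k\setminus\mathcal C_i^{k-1}$, $v_1\ne v_2$. In each case set $\widetilde\theta_{ij}=S_{ij}/N_{ij}$, $$\widetilde\theta_{i\lor j}=\frac{S_{ii}+2S_{ij}+S_{jj}}{N_{ii}+2N_{ij}+N_{jj}},$$ $$T_{ij}=N_{ii}\,\mathcal K(\widetilde\theta_{ii},\widetilde\theta_{i\lor j})+N_{jj}\,\mathcal K(\widetilde\theta_{jj},\widetilde\theta_{i\lor j})+N_{ij}\,\mathcal K(\widetilde\theta_{ij},\widetilde\theta_{i\lor j}),$$ where $\mathcal K(p,q)=p\log\frac pq+(1-p)\log\frac{1-p}{1-q}$ is the Kullback–Leibler divergence between Bernoulli distributions with means $p$ and $q$ ($0\log0=0$). Output: $W_{ij}=\mathbb 1(T_{ij}\le\lambda)$.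 Convention: if $T_{ij}$ is undefined (a denominator vanishes or an estimator lies outside $[0,1]$), put $T_{ij}=0$. The threshold $\lambda_n$ may depend on $n$ and on the model parameters. *)

theory Defs
  imports "HOL-Probability.Probability"
begin

type_synonym matrix = "nat \<Rightarrow> nat \<Rightarrow> real"

abbreviation vertices :: "nat \<Rightarrow> nat \<Rightarrow> nat set" where
  "vertices n K \<equiv> {..<n * K}"

text \<open>A partition into \<open>K\<close> communities is given by a labelling \<open>z\<close> of the vertices; the
  community with label \<open>a\<close> is the fibre of \<open>z\<close> over \<open>a\<close>.\<close>

definition community_labelling :: "nat \<Rightarrow> nat \<Rightarrow> (nat \<Rightarrow> nat) \<Rightarrow> bool" where
  "community_labelling n K z \<longleftrightarrow>
     (\<forall>i\<in>vertices n K. z i < K) \<and> (\<forall>a<K. card {i \<in> vertices n K. z i = a} = n)"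

definition true_W :: "(nat \<Rightarrow> nat) \<Rightarrow> matrix" where
  "true_W z i j = of_bool (z i = z j)"

text \<open>The law of the adjacency matrix. The independent coin flips are indexed by the
  two-element sets of vertices, so the matrix is symmetric; on singletons the product takes its
  default value \<open>False\<close>, so the diagonal is zero.\<close>

definition SBM :: "nat \<Rightarrow> nat \<Rightarrow> real \<Rightarrow> real \<Rightarrow> (nat \<Rightarrow> nat) \<Rightarrow> matrix pmf" where
  "SBM n K \<theta> \<rho> z =
     map_pmf (\<lambda>G i j. of_bool (G {i, j}))
       (Pi_pmf {e. e \<subseteq> vertices n K \<and> card e = 2} False
         (\<lambda>e. bernoulli_pmf (if \<forall>i\<in>e. \<forall>j\<in>e. z i = z j then \<theta> else \<rho>)))"

definition graph_paths :: "nat set \<Rightarrow> matrix \<Rightarrow> nat \<Rightarrow> nat \<Rightarrow> nat list set" where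
  "graph_paths V Y i j =
     {p. p \<noteq> [] \<and> hd p = i \<and> last p = j \<and> set p \<subseteq> V \<and> distinct p \<and>
         successively (\<lambda>u v. Y u v = 1) p}"

definition graph_dist :: "nat set \<Rightarrow> matrix \<Rightarrow> nat \<Rightarrow> nat \<Rightarrow> enat" where
  "graph_dist V Y i j = (INF p\<in>graph_paths V Y i j. enat (length p - 1))"

definition sphere_at :: "nat set \<Rightarrow> matrix \<Rightarrow> nat \<Rightarrow> nat \<Rightarrow> nat set" where
  "sphere_at V Y k i = {v \<in> V. graph_dist V Y i v = enat k}"

text \<open>Since \<open>0 * x = 0\<close>, the convention \<open>0 log 0 = 0\<close> is built in. The divergence is
  only used where \<open>q = 0\<close> forces \<open>p = 0\<close> and \<open>q = 1\<close> forces \<open>p = 1\<close>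
  (see \<open>test_stat\<close> below), where this formula gives the correct value 0.\<close>

definition KL_bernoulli :: "real \<Rightarrow> real \<Rightarrow> real" where
  "KL_bernoulli p q = p * ln (p / q) + (1 - p) * ln ((1 - p) / (1 - q))"

definition pooled_est :: "matrix \<Rightarrow> matrix \<Rightarrow> nat \<Rightarrow> nat \<Rightarrow> real" where
  "pooled_est S N i j = (S i i + 2 * S i j + S j j) / (N i i + 2 * N i j + N j j)"

definition test_defined :: "matrix \<Rightarrow> matrix \<Rightarrow> nat \<Rightarrow> nat \<Rightarrow> bool" where
  "test_defined S N i j \<longleftrightarrow>
     N i i \<noteq> 0 \<and> N j j \<noteq> 0 \<and> N i j \<noteq> 0 \<and> N i i + 2 * N i j + N j j \<noteq> 0 \<and>
     S i i / N i i \<in> {0..1} \<and> S j j / N j j \<in> {0..1} \<and> S i j / N i j \<in> {0..1} \<and>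
     pooled_est S N i j \<in> {0..1}"

text \<open>When the statistic is defined, the pooled estimator is a convex combination, with positive
  weights, of the other three estimators; hence it is 0 (or 1) only if all of them are.\<close>

definition test_stat :: "matrix \<Rightarrow> matrix \<Rightarrow> nat \<Rightarrow> nat \<Rightarrow> real" where
  "test_stat S N i j =
     (if test_defined S N i j then
        N i i * KL_bernoulli (S i i / N i i) (pooled_est S N i j) +
        N j j * KL_bernoulli (S j j / N j j) (pooled_est S N i j) +
        N i j * KL_bernoulli (S i j / N i j) (pooled_est S N i j)
      else 0)"

definition test_output :: "matrix \<Rightarrow> matrix \<Rightarrow> real \<Rightarrow> matrix" where
  "test_output S N t i j = of_bool (test_stat S N i j \<le> t)"

definition edge_count :: "matrix \<Rightarrow> nat set \<Rightarrow> nat set \<Rightarrow> real" where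
  "edge_count Y A B = (\<Sum>v1\<in>A. \<Sum>v2\<in>B. Y v1 v2)"

type_synonym algorithm = "nat set \<Rightarrow> matrix \<Rightarrow> real \<Rightarrow> matrix"

definition S_circ :: "nat \<Rightarrow> nat set \<Rightarrow> matrix \<Rightarrow> matrix" where
  "S_circ k V Y i j = edge_count Y (sphere_at V Y k i) (sphere_at V Y k j)"

definition N_circ :: "nat \<Rightarrow> nat set \<Rightarrow> matrix \<Rightarrow> matrix" where
  "N_circ k V Y i j =
     real (card (sphere_at V Y k i)) * (real (card (sphere_at V Y k j)) - of_bool (i = j))"

definition AWCD_circ :: "nat \<Rightarrow> algorithm" where
  "AWCD_circ k V Y = test_output (S_circ k V Y) (N_circ k V Y)"

definition S_corr :: "nat \<Rightarrow> nat set \<Rightarrow> matrix \<Rightarrow> matrix" where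
  "S_corr k V Y i j =
     edge_count Y (sphere_at V Y k i) (sphere_at V Y k j)
     - of_bool (Y i j = 1) * (real (card (sphere_at V Y k i)) + real (card (sphere_at V Y k j)))"

definition AWCD :: "nat \<Rightarrow> algorithm" where
  "AWCD k V Y = test_output (S_corr k V Y) (N_circ k V Y)"

definition sphere_minus :: "nat \<Rightarrow> nat set \<Rightarrow> matrix \<Rightarrow> nat \<Rightarrow> nat \<Rightarrow> nat set" where
  "sphere_minus k V Y i j = sphere_at V Y k i - sphere_at V Y (k - 1) j"

definition S_plus :: "nat \<Rightarrow> nat set \<Rightarrow> matrix \<Rightarrow> matrix" where
  "S_plus k V Y i j = edge_count Y (sphere_minus k V Y i j) (sphere_minus k V Y j i)"

definition N_plus :: "nat \<Rightarrow> nat set \<Rightarrow> matrix \<Rightarrow> matrix" where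
  "N_plus k V Y i j =
     real (card {(v1, v2). v1 \<in> sphere_minus k V Y i j \<and> v2 \<in> sphere_minus k V Y j i \<and> v1 \<noteq> v2})"

definition AWCD_plus :: "nat \<Rightarrow> algorithm" where
  "AWCD_plus k V Y = test_output (S_plus k V Y) (N_plus k V Y)"

text \<open>The thresholds may depend on \<open>n\<close>, \<open>K\<close>, \<open>\<theta>\<close> and \<open>\<rho>\<close>, but not on the unknown
  partition, which is arbitrary for each \<open>n\<close>.\<close>

definition consistent_exact_recovery ::
    "algorithm \<Rightarrow> nat \<Rightarrow> (nat \<Rightarrow> real) \<Rightarrow> (nat \<Rightarrow> real) \<Rightarrow> bool" where
  "consistent_exact_recovery alg K \<theta> \<rho> \<longleftrightarrow>
     (\<exists>t :: nat \<Rightarrow> real. \<forall>z. (\<forall>n. community_labelling n K (z n)) \<longrightarrow>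
        (\<lambda>n. measure_pmf.prob (SBM n K (\<theta> n) (\<rho> n) (z n))
               {Y. \<forall>i\<in>vertices n K. \<forall>j\<in>vertices n K.
                     alg (vertices n K) Y (t n) i j = true_W (z n) i j})
        \<longlonglongrightarrow> 1)"

definition rate1 :: "nat \<Rightarrow> real \<Rightarrow> nat \<Rightarrow> real" where
  "rate1 k \<theta> n =
     \<theta> powr ((3 * real k + 1) / (2 * real k + 1)) * real n powr ((real k - 1) / (2 * real k + 1))
     + \<theta> powr ((4 * real k + 1) / (4 * real k + 2)) * real n powr (- (1 / (4 * real k + 2)))
       * ln (real n) powr (1 / (4 * real k + 2))"

definition rate2_circ :: "nat \<Rightarrow> real \<Rightarrow> nat \<Rightarrow> real" where
  "rate2_circ k \<theta> n =
     \<theta> powr (real k / (2 * real k + 1)) * real n powr (- (real k / (2 * real k + 1)))"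

definition rate2 :: "nat \<Rightarrow> real \<Rightarrow> nat \<Rightarrow> real" where
  "rate2 k \<theta> n =
     \<theta> powr ((2 * real k - 1) / (4 * real k + 2)) * real n powr (- (1 / 2))
     * ln (real n) powr (1 / (4 * real k + 2))"

definition rate2_plus :: "nat \<Rightarrow> real \<Rightarrow> nat \<Rightarrow> real" where
  "rate2_plus k \<theta> n =
     \<theta> powr (1 / 2) * real n powr (- (real k / (2 * real k + 1)))
     * ln (real n) powr (1 / (4 * real k + 2))"

end

theory Submission imports Defs begin

text \<open>
  Explore the graph from \<open>i\<close> and \<open>j\<close> by breadth-first search. The edges between the spheres that the
  exploration has not revealed are still independent, so their number concentrates around
  \<open>\<rho> |A| |B| + (\<theta> - \<rho>) \<Sum>\<^sub>a |A\<^sub>a| |B\<^sub>a|\<close>, where \<open>A\<^sub>a\<close> is the part of the sphere \<open>A\<close> in community \<open>a\<close>.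
  Layer by layer, the composition of a sphere follows a linear recursion whose matrix has the
  eigenvalues \<open>n (\<theta> + (K - 1) \<rho>)\<close> and \<open>n (\<theta> - \<rho>)\<close>, up to a relative error \<open>\<delta>\<close> made of the depletion
  \<open>(n \<theta>)\<^sup>k / n\<close> and of the degree fluctuation \<open>sqrt (ln n / (n \<theta>))\<close>. Hence the means for equal and
  for different communities differ by \<open>(\<theta> - \<rho>) ((\<theta> - \<rho>) / (\<theta> + (K - 1) \<rho>))\<^sup>2\<^sup>k\<close>, and the rates say
  that this gap exceeds the depletion, the fluctuations, and the bias of the revealed edges: of
  order \<open>(n \<theta>)\<^sup>k\<close> without correction and smaller by a factor \<open>\<delta>\<close> with it. Since the divergence is
  comparable to a squared difference, the statistic is of the order of the squared gap for different
  communities and of the much smaller squared error for equal ones.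
\<close>

section \<open>Functions of independent coin flips\<close>

text \<open>The obstacle is that the spheres are functions of the very edges to be counted. A search
  stopped at level m has read only edges that meet \<open>nearer\<close>, and the bounds for fixed
  revealed sets are uniform, so they survive insertion of the random sets. A union bound then leaves
  a failure probability of order 1/n, and the remaining analysis is deterministic. Origin of the
  exponents: put D = n \<theta>, T = D^(2k) and \<Lambda> = ((\<theta> - \<rho>)/\<theta>)^(2k+1),
  one factor from the edge probabilities and 2k from the two layers of depth k. The signal is at
  least a constant times \<Lambda> \<theta> T. Asking for the relative errors D^k/n and sqrt(ln n /
  D) to be below \<Lambda> gives the two summands of \<open>rate1\<close>. Asking for D^k, D^k
  sqrt(ln n / D) or sqrt(\<theta> ln n) D^k to be below \<Lambda> \<theta> T gives
  \<open>rate2_circ\<close>, \<open>rate2\<close> and \<open>rate2_plus\<close>: the raw bias, the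
  bias left by the correction, and the noise of the fresh edges. A constant ratio makes \<theta> -
  \<rho> a fixed multiple of \<theta>, so that claim follows from the bounded-ratio one.\<close>

definition depends_on :: "'e set \<Rightarrow> (('e \<Rightarrow> bool) \<Rightarrow> 'b) \<Rightarrow> bool" where
  "depends_on D f \<longleftrightarrow> (\<forall>G H. (\<forall>e\<in>D. G e = H e) \<longrightarrow> f G = f H)"

lemma depends_onI:
  assumes "\<And>G H. (\<And>e. e \<in> D \<Longrightarrow> G e = H e) \<Longrightarrow> f G = f H"
  shows "depends_on D f"
  unfolding depends_on_def by (intro allI impI assms) blast

lemma depends_onD:
  assumes "depends_on D f" "\<And>e. e \<in> D \<Longrightarrow> G e = H e"
  shows "f G = f H"
  using assms(1) unfolding depends_on_def by (elim allE impE) (use assms(2) in auto)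

lemma depends_on_mono:
  assumes "depends_on D f" "D \<subseteq> D'"
  shows "depends_on D' f"
  by (rule depends_onI, rule depends_onD[OF assms(1)]) (use assms(2) in auto)

lemma depends_on_comp:
  assumes "depends_on D f"
  shows "depends_on D (\<lambda>G. h (f G))"
  by (rule depends_onI, rule arg_cong[where f = h], rule depends_onD[OF assms])

lemma depends_on_prod:
  assumes "\<And>b. b \<in> I \<Longrightarrow> depends_on D (f b)"
  shows "depends_on D (\<lambda>G. \<Prod>b\<in>I. f b G)"
proof (rule depends_onI)
  fix G H :: "'b \<Rightarrow> bool"
  assume eq: "\<And>e. e \<in> D \<Longrightarrow> G e = H e"
  have "f b G = f b H" if "b \<in> I" for b by (rule depends_onD[OF assms[OF that] eq])
  then show "(\<Prod>b\<in>I. f b G) = (\<Prod>b\<in>I. f b H)" by (intro prod.cong refl)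
qed

locale coin_flips =
  fixes E :: "'e set" and p :: "'e \<Rightarrow> bool pmf"
  assumes finite_E: "finite E"
begin

abbreviation P where "P \<equiv> Pi_pmf E False p"

abbreviation prob :: "('e \<Rightarrow> bool) set \<Rightarrow> real" where
  "prob \<equiv> measure_pmf.prob P"

abbreviation expec :: "(('e \<Rightarrow> bool) \<Rightarrow> real) \<Rightarrow> real" where
  "expec f \<equiv> measure_pmf.expectation P f"

lemma finite_set_Pi_bool: "finite A \<Longrightarrow> finite (set_pmf (Pi_pmf A False (p :: 'e \<Rightarrow> bool pmf)))"
  by (simp add: set_Pi_pmf finite_PiE_dflt)

lemma integrable_P [simp]: "integrable (measure_pmf P) (f :: _ \<Rightarrow> real)"
  by (rule integrable_measure_pmf_finite) (rule finite_set_Pi_bool[OF finite_E])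

lemma expec_sum: "expec (\<lambda>G. \<Sum>b\<in>I. f b G) = (\<Sum>b\<in>I. expec (f b))"
  by (rule Bochner_Integration.integral_sum) simp

lemma expec_mono: "(\<And>G. f G \<le> g G) \<Longrightarrow> expec f \<le> expec g"
  by (rule integral_mono) auto

lemma expec_of_bool: "expec (\<lambda>G. of_bool (Q G)) = prob {G. Q G}"
proof -
  have "(\<lambda>G. of_bool (Q G)) = (indicator {G. Q G} :: _ \<Rightarrow> real)"
    by (auto simp: fun_eq_iff indicator_def)
  then show ?thesis by simp
qed

lemma expec_mult_indep:
  assumes f: "depends_on D f" and g: "depends_on (- D) g"
  shows "expec (\<lambda>G. f G * g G) = expec f * expec g"
proof -
  define A where "A = E \<inter> D"
  define B where "B = E - D"
  define PA where "PA = Pi_pmf A False p"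
  define PB where "PB = Pi_pmf B False p"
  have fin: "finite A" "finite B" "A \<inter> B = {}" "E = A \<union> B"
    using finite_E by (auto simp: A_def B_def)
  have P: "P = map_pmf (\<lambda>(x, y) e. if e \<in> A then x e else y e) (pair_pmf PA PB)"
    unfolding PA_def PB_def fin(4) by (rule Pi_pmf_union[OF fin(1-3)])
  have fs: "finite (set_pmf PA)" "finite (set_pmf PB)"
    using finite_set_Pi_bool fin by (auto simp: PA_def PB_def)
  \<comment> \<open>\<open>D\<close> may contain coordinates outside \<open>E\<close>; there both
    assignments carry the default \<open>False\<close>, so \<open>f\<close> cannot tell the glued
    one from \<open>x\<close>.\<close>
  have off: "x e = False" if "x \<in> set_pmf PA" "e \<notin> A" for x e
    using that set_Pi_pmf_subset[of A False p] fin by (auto simp: PA_def)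
  have off': "y e = False" if "y \<in> set_pmf PB" "e \<notin> B" for y e
    using that set_Pi_pmf_subset[of B False p] fin by (auto simp: PB_def)
  have eqf: "f (\<lambda>e. if e \<in> A then x e else y e) = f x"
    if "x \<in> set_pmf PA" "y \<in> set_pmf PB" for x y
    by (rule depends_onD[OF f]) (use off[OF that(1)] off'[OF that(2)] in \<open>auto simp: A_def B_def\<close>)
  have eqg: "g (\<lambda>e. if e \<in> A then x e else y e) = g y" for x y
    by (rule depends_onD[OF g]) (auto simp: A_def B_def)
  have pr: "measure_pmf.expectation (pair_pmf PA PB) h
      = (\<Sum>x\<in>set_pmf PA. \<Sum>y\<in>set_pmf PB. h (x, y) * (pmf PA x * pmf PB y))" for h :: "_ \<Rightarrow> real"
    by (subst integral_measure_pmf_real[where A = "set_pmf PA \<times> set_pmf PB"])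
       (use fs in \<open>auto simp: sum.cartesian_product pmf_pair intro!: sum.cong\<close>)
  have one: "(\<Sum>x\<in>set_pmf PA. pmf PA x) = 1" "(\<Sum>x\<in>set_pmf PB. pmf PB x) = 1"
    using fs by (auto intro!: sum_pmf_eq_1)
  have F: "expec f = (\<Sum>x\<in>set_pmf PA. f x * pmf PA x)"
    unfolding P integral_map_pmf pr by (simp add: eqf one flip: sum_distrib_left mult.assoc)
  have G: "expec g = (\<Sum>y\<in>set_pmf PB. g y * pmf PB y)"
  proof -
    have "expec g = (\<Sum>x\<in>set_pmf PA. \<Sum>y\<in>set_pmf PB. pmf PA x * (g y * pmf PB y))"
      unfolding P integral_map_pmf pr by (intro sum.cong) (auto simp: eqg)
    also have "\<dots> = (\<Sum>y\<in>set_pmf PB. g y * pmf PB y)"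
      by (simp add: one flip: sum_distrib_left sum_distrib_right)
    finally show ?thesis .
  qed
  have "expec (\<lambda>G. f G * g G) = (\<Sum>x\<in>set_pmf PA. \<Sum>y\<in>set_pmf PB. (f x * pmf PA x) * (g y * pmf PB y))"
    unfolding P integral_map_pmf pr by (intro sum.cong) (auto simp: eqf eqg)
  also have "\<dots> = expec f * expec g"
    unfolding F G by (simp add: sum_product)
  finally show ?thesis .
qed

lemma prob_Int_indep:
  assumes f: "depends_on D A" and g: "depends_on (- D) B"
  shows "prob {G. A G \<and> B G} = prob {G. A G} * prob {G. B G}"
proof -
  have "expec (\<lambda>G. of_bool (A G) * of_bool (B G)) = expec (\<lambda>G. of_bool (A G)) * expec (\<lambda>G. of_bool (B G))"
    by (rule expec_mult_indep[OF depends_on_comp[OF f] depends_on_comp[OF g]])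
  moreover have "(\<lambda>G. of_bool (A G) * of_bool (B G)) = (\<lambda>G. of_bool (A G \<and> B G) :: real)" by auto
  ultimately show ?thesis using expec_of_bool[of A] expec_of_bool[of B]
      expec_of_bool[of "\<lambda>G. A G \<and> B G"] by simp
qed

lemma expec_prod_indep:
  assumes "finite I" "disjoint_family_on D I" "\<And>b. b \<in> I \<Longrightarrow> depends_on (D b) (f b)"
  shows "expec (\<lambda>G. \<Prod>b\<in>I. f b G) = (\<Prod>b\<in>I. expec (f b))"
proof -
  have "J \<subseteq> I \<Longrightarrow> expec (\<lambda>G. \<Prod>b\<in>J. f b G) = (\<Prod>b\<in>J. expec (f b))" if "finite J" for J
    using that
  proof (induction rule: finite_induct)
    case empty
    show ?case by simp
  next
    case (insert b J)
    have "depends_on (- D b) (f c)" if "c \<in> J" for c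
    proof (rule depends_on_mono)
      have c: "c \<in> I" "b \<in> I" "c \<noteq> b" using that insert.prems insert.hyps(2) by auto
      then show "depends_on (D c) (f c)" by (intro assms(3))
      show "D c \<subseteq> - D b"
        using disjoint_family_onD[OF assms(2) c] by auto
    qed
    then have "depends_on (- D b) (\<lambda>G. \<Prod>c\<in>J. f c G)" by (rule depends_on_prod)
    then have "expec (\<lambda>G. f b G * (\<Prod>c\<in>J. f c G)) = expec (f b) * expec (\<lambda>G. \<Prod>c\<in>J. f c G)"
      using assms(3)[of b] insert.prems by (intro expec_mult_indep) simp_all
    also have "expec (\<lambda>G. \<Prod>c\<in>J. f c G) = (\<Prod>c\<in>J. expec (f c))"
      using insert.prems by (intro insert.IH) simp
    finally show ?case by (simp only: prod.insert[OF insert.hyps])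
  qed
  from this[OF assms(1) order_refl] show ?thesis .
qed

text \<open>If the data \<open>F G\<close> is revealed by the coordinates in \<open>D (F G)\<close> alone, then the other
  coordinates are still fresh, so a bound that holds for each fixed value of the data carries over
  to the random value.\<close>

lemma prob_exploration_le:
  assumes stop: "\<And>G H. (\<And>e. e \<in> D (F G) \<Longrightarrow> G e = H e) \<Longrightarrow> F H = F G"
    and fresh: "\<And>x. depends_on (- D x) (Bad x)"
    and bound: "\<And>x. prob {G. Bad x G} \<le> \<epsilon>"
  shows "prob {G. Bad (F G) G} \<le> \<epsilon>"
proof -
  define X where "X = F ` set_pmf P"
  have fin: "finite X" unfolding X_def using finite_set_Pi_bool[OF finite_E] by simp
  \<comment> \<open>The stopping condition is applied from both sides: if either assignment has data
    \<open>x\<close>, agreement on \<open>D x\<close> forces it on the other.\<close>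
  have dep: "depends_on (D x) (\<lambda>G. F G = x)" for x
  proof (rule depends_onI)
    fix G H :: "'e \<Rightarrow> bool"
    assume eq: "\<And>e. e \<in> D x \<Longrightarrow> G e = H e"
    have "F G = x \<Longrightarrow> F H = x" using stop[of G H] eq by blast
    moreover have "F H = x \<Longrightarrow> F G = x" using stop[of H G] eq by metis
    ultimately show "(F G = x) = (F H = x)" by blast
  qed
  have part: "prob {G. Q G} = (\<Sum>x\<in>X. prob {G. F G = x \<and> Q G})" for Q
  proof -
    have "prob {G. Q G} = prob (\<Union>x\<in>X. {G. F G = x \<and> Q G})"
      by (intro measure_pmf.finite_measure_eq_AE) (auto simp: AE_measure_pmf_iff X_def)
    also have "\<dots> = (\<Sum>x\<in>X. prob {G. F G = x \<and> Q G})"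
      using fin by (intro measure_pmf.finite_measure_finite_Union) (auto simp: disjoint_family_on_def)
    finally show ?thesis .
  qed
  have "{G. F G = x \<and> Bad (F G) G} = {G. F G = x \<and> Bad x G}" for x by auto
  then have "prob {G. Bad (F G) G} = (\<Sum>x\<in>X. prob {G. F G = x \<and> Bad x G})"
    using part[of "\<lambda>G. Bad (F G) G"] by simp
  also have "\<dots> = (\<Sum>x\<in>X. prob {G. F G = x} * prob {G. Bad x G})"
    using prob_Int_indep[OF dep fresh] by simp
  also have "\<dots> \<le> (\<Sum>x\<in>X. prob {G. F G = x} * \<epsilon>)"
    by (intro sum_mono mult_left_mono bound) auto
  also have "\<dots> = \<epsilon>"
    using part[of "\<lambda>_. True"] by (simp flip: sum_distrib_right)
  finally show ?thesis .
qed

end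

text \<open>After multiplication by \<open>exp x\<close>, at least 1 + x + x^2/2 by Taylor, a
  polynomial inequality is left. The bound holds for all x \<ge> 0, as \<open>prob_hit_ge\<close>
  needs for large sums.\<close>

lemma exp_minus_le_quadratic: "exp (- x) \<le> 1 - x + x\<^sup>2" if "x \<ge> 0" for x :: real
proof -
  have "1 \<le> (1 + x + x\<^sup>2 / 2) * (1 - x + x\<^sup>2)"
  proof -
    have "(1 + x + x\<^sup>2 / 2) * (1 - x + x\<^sup>2) = 1 + x^2/2 + x^3/2 + x^4/2"
      by (simp add: field_simps power2_eq_square power3_eq_cube power4_eq_xxxx)
    then show ?thesis using that by simp
  qed
  also have "\<dots> \<le> exp x * (1 - x + x\<^sup>2)"
  proof (rule mult_right_mono)
    show "1 + x + x\<^sup>2 / 2 \<le> exp x" using exp_lower_Taylor_quadratic[OF that] by simp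
    have "0 \<le> (1 - x)\<^sup>2 + x" using that by simp
    then show "0 \<le> 1 - x + x\<^sup>2" by (simp add: power2_eq_square algebra_simps)
  qed
  finally show ?thesis by (simp add: exp_minus divide_simps mult.commute)
qed

lemma exp_le_quadratic: "exp x \<le> 1 + x + x\<^sup>2" if "\<bar>x\<bar> \<le> 1" for x :: real
proof (cases "x \<ge> 0")
  case True then show ?thesis using that exp_bound[of x] by simp
next
  case False then show ?thesis using exp_minus_le_quadratic[of "- x"] by simp
qed

section \<open>Chernoff bound for sums over disjoint blocks of coins\<close>

context coin_flips
begin

text \<open>For values in [0,1] the square is at most the value, so only the mean enters. Values
  other than 0 and 1 are allowed because \<open>edges_chernoff\<close> gives some edges the weight
  1/2.\<close>

lemma mgf_block_sum_le:
  assumes "finite I" "disjoint_family_on D I" "\<And>b. b \<in> I \<Longrightarrow> depends_on (D b) (f b)"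
    and f01: "\<And>b G. b \<in> I \<Longrightarrow> 0 \<le> f b G \<and> f b G \<le> 1" and s: "\<bar>s\<bar> \<le> 1"
  shows "expec (\<lambda>G. exp (s * (\<Sum>b\<in>I. f b G)))
    \<le> exp ((s + s\<^sup>2) * (\<Sum>b\<in>I. expec (f b)))"
proof -
  have "expec (\<lambda>G. exp (s * (\<Sum>b\<in>I. f b G))) = expec (\<lambda>G. \<Prod>b\<in>I. exp (s * f b G))"
    using assms(1) by (simp add: exp_sum sum_distrib_left)
  also have "\<dots> = (\<Prod>b\<in>I. expec (\<lambda>G. exp (s * f b G)))"
    by (rule expec_prod_indep[OF assms(1,2)])
      (rule depends_on_comp[OF assms(3), where h = "\<lambda>x. exp (s * x)"])
  also have "\<dots> \<le> (\<Prod>b\<in>I. exp ((s + s\<^sup>2) * expec (f b)))"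
  proof (rule prod_mono, safe)
    fix b assume b: "b \<in> I"
    show "0 \<le> expec (\<lambda>G. exp (s * f b G))" by (rule integral_nonneg_AE) simp
    have "exp (s * f b G) \<le> 1 + (s + s\<^sup>2) * f b G" for G
    proof -
      have "\<bar>s * f b G\<bar> \<le> 1" using f01[OF b, of G] s by (simp add: abs_mult mult_le_one)
      then have "exp (s * f b G) \<le> 1 + s * f b G + (s * f b G)\<^sup>2" by (rule exp_le_quadratic)
      also have "(s * f b G)\<^sup>2 \<le> s\<^sup>2 * f b G"
        unfolding power_mult_distrib using f01[OF b, of G]
        by (intro mult_left_mono) (auto simp: power2_eq_square mult_left_le)
      finally show ?thesis by (simp add: algebra_simps)
    qed
    then have "expec (\<lambda>G. exp (s * f b G)) \<le> expec (\<lambda>G. 1 + (s + s\<^sup>2) * f b G)"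
      by (rule expec_mono)
    also have "\<dots> = 1 + (s + s\<^sup>2) * expec (f b)" by simp
    also have "\<dots> \<le> exp ((s + s\<^sup>2) * expec (f b))" by simp
    finally show "expec (\<lambda>G. exp (s * f b G)) \<le> exp ((s + s\<^sup>2) * expec (f b))" .
  qed
  also have "\<dots> = exp ((s + s\<^sup>2) * (\<Sum>b\<in>I. expec (f b)))"
    using assms(1) by (simp add: exp_sum sum_distrib_left)
  finally show ?thesis .
qed

lemma prob_le_mgf:
  "prob {G. t \<le> X G} \<le> expec (\<lambda>G. exp (X G)) / exp t"
proof -
  have "prob {G. t \<le> X G} = expec (\<lambda>G. of_bool (t \<le> X G))"
    by (simp add: expec_of_bool)
  also have "\<dots> \<le> expec (\<lambda>G. exp (X G) / exp t)"
    by (rule expec_mono) (auto simp: divide_simps)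
  finally show ?thesis by simp
qed

lemma chernoff_block_sum:
  assumes "finite I" "disjoint_family_on D I" "\<And>b. b \<in> I \<Longrightarrow> depends_on (D b) (f b)"
    and f01: "\<And>b G. b \<in> I \<Longrightarrow> 0 \<le> f b G \<and> f b G \<le> 1"
    and \<mu>: "\<mu> = (\<Sum>b\<in>I. expec (f b))" and \<nu>: "\<mu> \<le> \<nu>" "L \<le> \<nu>" "0 < L"
  shows "prob {G. 2 * sqrt (L * \<nu>) < \<bar>(\<Sum>b\<in>I. f b G) - \<mu>\<bar>} \<le> 2 * exp (- L)"
proof -
  define X where "X G = (\<Sum>b\<in>I. f b G)" for G
  \<comment> \<open>This tilt satisfies s^2 \<nu> = L and s sqrt(L \<nu>) = L, so the exponent s^2
    \<mu> - 2 L is at most - L; \<open>L \<le> \<nu>\<close> keeps s at most 1.\<close>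
  define s where "s = sqrt (L / \<nu>)"
  have s: "0 \<le> s" "s \<le> 1" "s * sqrt (L * \<nu>) = L" "s\<^sup>2 * \<nu> = L"
    using \<nu> by (auto simp: s_def real_sqrt_mult real_sqrt_divide power_divide)
  have s2: "s\<^sup>2 * \<mu> \<le> L" using mult_left_mono[OF \<nu>(1), of "s\<^sup>2"] s(4) by simp
  have up: "prob {G. \<mu> + 2 * sqrt (L * \<nu>) \<le> X G} \<le> exp (- L)"
  proof (cases "s = 0")
    case True then show ?thesis using s \<nu> by simp
  next
    case False
    have "prob {G. \<mu> + 2 * sqrt (L * \<nu>) \<le> X G}
        = prob {G. s * (\<mu> + 2 * sqrt (L * \<nu>)) \<le> s * X G}" using False s by simp
    also have "\<dots> \<le> expec (\<lambda>G. exp (s * X G)) / exp (s * (\<mu> + 2 * sqrt (L * \<nu>)))"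
      by (rule prob_le_mgf)
    also have "\<dots> \<le> exp ((s + s\<^sup>2) * \<mu>) / exp (s * (\<mu> + 2 * sqrt (L * \<nu>)))"
      unfolding X_def \<mu> using assms(1-3) f01 s
      by (intro divide_right_mono mgf_block_sum_le[where D = D]) auto
    also have "\<dots> = exp (s\<^sup>2 * \<mu> - 2 * (s * sqrt (L * \<nu>)))"
      by (simp add: algebra_simps flip: exp_diff)
    also have "\<dots> \<le> exp (- L)" using s2 s by simp
    finally show ?thesis .
  qed
  have low: "prob {G. X G \<le> \<mu> - 2 * sqrt (L * \<nu>)} \<le> exp (- L)"
  proof (cases "s = 0")
    case True then show ?thesis using s \<nu> by simp
  next
    case False
    have "{G. X G \<le> \<mu> - 2 * sqrt (L * \<nu>)} = {G. - s * (\<mu> - 2 * sqrt (L * \<nu>)) \<le> - s * X G}"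
      using False s by auto
    then have "prob {G. X G \<le> \<mu> - 2 * sqrt (L * \<nu>)}
        \<le> expec (\<lambda>G. exp (- s * X G)) / exp (- s * (\<mu> - 2 * sqrt (L * \<nu>)))"
      using prob_le_mgf[of "- s * (\<mu> - 2 * sqrt (L * \<nu>))" "\<lambda>G. - s * X G"] by simp
    also have "\<dots> \<le> exp ((- s + (- s)\<^sup>2) * \<mu>) / exp (- s * (\<mu> - 2 * sqrt (L * \<nu>)))"
      unfolding X_def \<mu> using assms(1-3) f01 s
      by (intro divide_right_mono mgf_block_sum_le[where D = D]) auto
    also have "\<dots> = exp (s\<^sup>2 * \<mu> - 2 * (s * sqrt (L * \<nu>)))"
      by (simp add: algebra_simps flip: exp_diff)
    also have "\<dots> \<le> exp (- L)" using s2 s by simp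
    finally show ?thesis .
  qed
  have "prob {G. 2 * sqrt (L * \<nu>) < \<bar>X G - \<mu>\<bar>}
     \<le> prob ({G. \<mu> + 2 * sqrt (L * \<nu>) \<le> X G} \<union> {G. X G \<le> \<mu> - 2 * sqrt (L * \<nu>)})"
    by (rule measure_pmf.finite_measure_mono) auto
  also have "\<dots> \<le> exp (- L) + exp (- L)"
    by (rule order.trans[OF measure_Un_le add_mono[OF up low]]) auto
  finally show ?thesis by (simp add: X_def)
qed

end

section \<open>Breadth-first search and graph distance\<close>

text \<open>Breadth-first search: \<open>nearer G V i m\<close> and \<open>layer G V i m\<close> are the sets of vertices at
  distance less than \<open>m\<close>, respectively exactly \<open>m\<close>, from \<open>i\<close>.\<close>

primrec explore :: "(nat set \<Rightarrow> bool) \<Rightarrow> nat set \<Rightarrow> nat \<Rightarrow> nat \<Rightarrow> nat set \<times> nat set" where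
  "explore G V i 0 = ({}, {i})"
| "explore G V i (Suc m) =
    (let (B, A) = explore G V i m in (B \<union> A, {v \<in> V - (B \<union> A). \<exists>u\<in>A. G {u, v}}))"

definition nearer where "nearer G V i m = fst (explore G V i m)"
definition layer where "layer G V i m = snd (explore G V i m)"

lemma nearer_0 [simp]: "nearer G V i 0 = {}"
  and layer_0 [simp]: "layer G V i 0 = {i}"
  and nearer_Suc: "nearer G V i (Suc m) = nearer G V i m \<union> layer G V i m"
  and layer_Suc: "layer G V i (Suc m) =
    {v \<in> V - nearer G V i (Suc m). \<exists>u\<in>layer G V i m. G {u, v}}"
  by (simp_all add: nearer_def layer_def split_beta Let_def)

lemma layer_subset: "i \<in> V \<Longrightarrow> layer G V i m \<subseteq> V"
  by (cases m) (auto simp: layer_Suc)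

lemma nearer_subset: "i \<in> V \<Longrightarrow> nearer G V i m \<subseteq> V"
  by (induction m) (auto simp: nearer_Suc dest: layer_subset)

lemma nearer_Int_layer: "nearer G V i m \<inter> layer G V i m = {}"
  by (cases m) (auto simp: layer_Suc)

lemma nearer_mono: "m \<le> m' \<Longrightarrow> nearer G V i m \<subseteq> nearer G V i m'"
  by (induction rule: dec_induct) (auto simp: nearer_Suc)

lemma layer_subset_nearer: "m < m' \<Longrightarrow> layer G V i m \<subseteq> nearer G V i m'"
  using nearer_mono[of "Suc m" m' G V i] by (auto simp: nearer_Suc)

lemma nearer_eq_UN: "nearer G V i m = (\<Union>l<m. layer G V i l)"
  by (induction m) (auto simp: nearer_Suc lessThan_Suc)

lemma layer_disjoint: "l \<noteq> m \<Longrightarrow> layer G V i l \<inter> layer G V i m = {}"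
  using layer_subset_nearer[of l m G V i] layer_subset_nearer[of m l G V i]
    nearer_Int_layer[of G V i m] nearer_Int_layer[of G V i l]
  by (cases "l < m") auto

lemma nearer_neighbour:
  assumes "u \<in> nearer G V i m" "v \<in> V" "G {u, v}"
  shows "v \<in> nearer G V i (Suc m)"
proof -
  obtain l where l: "l < m" "u \<in> layer G V i l" using assms(1) by (auto simp: nearer_eq_UN)
  then have "v \<in> nearer G V i (Suc (Suc l))"
    using assms(2,3) by (auto simp: nearer_Suc[of _ _ _ "Suc l"] layer_Suc)
  then show ?thesis using nearer_mono[of "Suc (Suc l)" "Suc m" G V i] l by auto
qed

lemma layer_neighbour:
  assumes "u \<in> layer G V i m" "v \<in> V" "G {u, v}"
  shows "v \<in> nearer G V i (Suc (Suc m))"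
  using nearer_neighbour[of u G V i "Suc m" v] assms by (auto simp: nearer_Suc)

text \<open>The level changes by at most one across an edge. Hence vertices lying deep inside the
  other exploration have no edge into the layer being counted.\<close>

lemma nearer_layer_no_edge:
  assumes "u \<in> nearer G V i m" "v \<in> layer G V i (Suc m)" "i \<in> V"
  shows "\<not> G {u, v}"
  using nearer_neighbour[of u G V i m v] nearer_Int_layer[of G V i "Suc m"] assms layer_subset[of i V G "Suc m"]
  by auto

text \<open>Finding levels up to m requires reading only edges that touch an earlier level; edges
  inside level m stay unread. This is the stopping property that \<open>prob_exploration_le\<close>
  asks for.\<close>

lemma explore_cong:
  assumes "\<forall>e. e \<inter> nearer G V i m \<noteq> {} \<longrightarrow> G e = H e"
  shows "nearer H V i m = nearer G V i m \<and> layer H V i m = layer G V i m"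
  using assms
proof (induction m)
  case 0
  show ?case by simp
next
  case (Suc m)
  have "\<forall>e. e \<inter> nearer G V i m \<noteq> {} \<longrightarrow> G e = H e"
    using Suc.prems unfolding nearer_Suc by blast
  from Suc.IH[OF this]
  have IH: "nearer H V i m = nearer G V i m" "layer H V i m = layer G V i m" by auto
  have "G {u, v} = H {u, v}" if "u \<in> layer G V i m" for u v
    using Suc.prems[rule_format, of "{u, v}"] that by (simp add: nearer_Suc)
  then show ?case by (auto simp: nearer_Suc layer_Suc IH)
qed

section \<open>Layers are the spheres of the graph distance\<close>

abbreviation adj_matrix :: "(nat set \<Rightarrow> bool) \<Rightarrow> matrix" where
  "adj_matrix G \<equiv> \<lambda>i j. of_bool (G {i, j})"

lemma nearer_iff_path:
  assumes "i \<in> V"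
  shows "v \<in> nearer G V i (Suc m) \<longleftrightarrow> (\<exists>p\<in>graph_paths V (adj_matrix G) i v. length p \<le> Suc m)"
proof
  assume "v \<in> nearer G V i (Suc m)"
  then show "\<exists>p\<in>graph_paths V (adj_matrix G) i v. length p \<le> Suc m"
  proof -
    \<comment> \<open>Keeping the path inside \<open>nearer\<close> makes the appended vertex new,
      so the path remains distinct, as \<open>graph_paths\<close> demands.\<close>
    have path: "\<exists>p\<in>graph_paths V (adj_matrix G) i v. length p = Suc l \<and> set p \<subseteq> nearer G V i (Suc l)"
      if "v \<in> layer G V i l" for l v
      using that
    proof (induction l arbitrary: v)
      case 0
      then show ?case using assms by (auto simp: graph_paths_def nearer_Suc intro!: bexI[of _ "[i]"])
    next
      case (Suc l)
      obtain u where u: "u \<in> layer G V i l" "G {u, v}" and v: "v \<in> V" "v \<notin> nearer G V i (Suc l)"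
        using Suc.prems by (auto simp: layer_Suc)
      obtain p where p: "p \<in> graph_paths V (adj_matrix G) i u" "length p = Suc l"
        "set p \<subseteq> nearer G V i (Suc l)" using Suc.IH[OF u(1)] by auto
      then have "p @ [v] \<in> graph_paths V (adj_matrix G) i v"
        using u v by (auto simp: graph_paths_def successively_append_iff)
      then show ?case using p Suc.prems
        by (intro bexI[of _ "p @ [v]"]) (auto simp: nearer_Suc[of _ _ _ "Suc l"])
    qed
    obtain l where l: "l < Suc m" "v \<in> layer G V i l"
      using \<open>v \<in> nearer G V i (Suc m)\<close> by (auto simp: nearer_eq_UN)
    show ?thesis using path[OF l(2)] l(1) by (elim bexE conjE, intro bexI) auto
  qed
next
  assume "\<exists>p\<in>graph_paths V (adj_matrix G) i v. length p \<le> Suc m"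
  then obtain p where p: "p \<in> graph_paths V (adj_matrix G) i v" "length p \<le> Suc m" by auto
  \<comment> \<open>Induction from the end of the path: each further vertex raises the level by at
    most one.\<close>
  have "p \<noteq> [] \<Longrightarrow> hd p = i \<Longrightarrow> set p \<subseteq> V \<Longrightarrow> successively (\<lambda>u v. adj_matrix G u v = 1) p
    \<Longrightarrow> last p \<in> nearer G V i (length p)"
  proof (induction p rule: rev_induct)
    case Nil
    then show ?case by simp
  next
    case (snoc w p)
    show ?case
    proof (cases "p = []")
      case True
      then show ?thesis using snoc by (simp add: nearer_Suc)
    next
      case False
      then have "last p \<in> nearer G V i (length p)" "G {last p, w}"
        using snoc by (auto simp: successively_append_iff split: if_splits)
      then show ?thesis using nearer_neighbour[of "last p" G V i "length p" w] snoc.prems by simp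
    qed
  qed
  then have "v \<in> nearer G V i (length p)" using p by (auto simp: graph_paths_def)
  then show "v \<in> nearer G V i (Suc m)" using nearer_mono[OF p(2)] by auto
qed

lemma graph_dist_le_iff:
  assumes "i \<in> V"
  shows "graph_dist V (adj_matrix G) i v \<le> enat m \<longleftrightarrow> v \<in> nearer G V i (Suc m)"
proof -
  have "graph_dist V (adj_matrix G) i v \<le> enat m \<longleftrightarrow>
      (\<exists>p\<in>graph_paths V (adj_matrix G) i v. enat (length p - 1) \<le> enat m)"
  proof
    assume le: "graph_dist V (adj_matrix G) i v \<le> enat m"
    let ?S = "(\<lambda>p. enat (length p - 1)) ` graph_paths V (adj_matrix G) i v"
    \<comment> \<open>The infimum of the empty set is infinity, so a finite distance supplies a
      path; over a nonempty set the infimum in \<open>enat\<close> is attained.\<close>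
    have "?S \<noteq> {}" using le by (auto simp: graph_dist_def Inf_enat_def)
    then have "Inf ?S \<in> ?S" unfolding Inf_enat_def by (auto intro: LeastI)
    then show "\<exists>p\<in>graph_paths V (adj_matrix G) i v. enat (length p - 1) \<le> enat m"
      using le by (auto simp: graph_dist_def)
  qed (auto simp: graph_dist_def intro: INF_lower2)
  also have "\<dots> \<longleftrightarrow> v \<in> nearer G V i (Suc m)"
    unfolding nearer_iff_path[OF assms] by (intro bex_cong) (auto simp: graph_paths_def)
  finally show ?thesis .
qed

lemma sphere_at_eq:
  assumes "i \<in> V"
  shows "sphere_at V (adj_matrix G) m i = layer G V i m"
proof (cases m)
  case 0
  have "graph_dist V (adj_matrix G) i v = enat 0 \<longleftrightarrow> v = i" for v
    using graph_dist_le_iff[OF assms, of G v 0] by (auto simp: nearer_Suc zero_enat_def[symmetric])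
  then show ?thesis using assms 0 by (auto simp: sphere_at_def)
next
  case (Suc l)
  have "graph_dist V (adj_matrix G) i v = enat (Suc l) \<longleftrightarrow>
      v \<in> nearer G V i (Suc (Suc l)) \<and> v \<notin> nearer G V i (Suc l)" for v
  proof -
    have "x = enat (Suc l) \<longleftrightarrow> x \<le> enat (Suc l) \<and> \<not> x \<le> enat l" for x
      by (cases x) auto
    then show ?thesis by (simp add: graph_dist_le_iff[OF assms])
  qed
  moreover have "layer G V i (Suc l) \<inter> nearer G V i (Suc l) = {}"
    using nearer_Int_layer by blast
  ultimately show ?thesis using layer_subset[OF assms, of G "Suc l"] Suc
    by (auto simp: sphere_at_def nearer_Suc[of _ _ _ "Suc l"])
qed

section \<open>Concentration in the stochastic block model\<close>

locale sbm_graph =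
  fixes n K :: nat and \<theta> \<rho> :: real and z :: "nat \<Rightarrow> nat"
  assumes labelling: "community_labelling n K z"
    and rho_pos: "0 < \<rho>" and rho_less: "\<rho> < \<theta>" and theta_le: "\<theta> \<le> 1"
begin

abbreviation V :: "nat set" where "V \<equiv> vertices n K"

definition E :: "nat set set" where "E = {e. e \<subseteq> V \<and> card e = 2}"

definition flip :: "nat set \<Rightarrow> bool pmf" where
  "flip e = bernoulli_pmf (if \<forall>i\<in>e. \<forall>j\<in>e. z i = z j then \<theta> else \<rho>)"

sublocale coin_flips E flip
  by standard (auto simp: E_def intro: finite_subset[of _ "Pow V"])

lemma SBM_eq: "SBM n K \<theta> \<rho> z = map_pmf adj_matrix P"
  unfolding SBM_def E_def flip_def by simp

definition comm :: "nat \<Rightarrow> nat set" where "comm a = {v \<in> V. z v = a}"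

lemma comm_subset: "comm a \<subseteq> V"
  and finite_comm [simp]: "finite (comm a)"
  and card_comm: "a < K \<Longrightarrow> card (comm a) = n"
  and z_less: "v \<in> V \<Longrightarrow> z v < K"
  using labelling by (auto simp: comm_def community_labelling_def)

lemma finite_V_subset: "A \<subseteq> V \<Longrightarrow> finite A"
  by (rule finite_subset) auto

lemma theta_pos: "0 < \<theta>"
  using rho_pos rho_less by simp

text \<open>The mean of the adjacency matrix; the zero diagonal agrees with the default
  \<open>False\<close> outside \<open>E\<close>.\<close>

definition pr :: "nat \<Rightarrow> nat \<Rightarrow> real" where
  "pr u v = (if u = v then 0 else if z u = z v then \<theta> else \<rho>)"

lemma pr_bounds: "0 \<le> pr u v" "pr u v \<le> \<theta>" "pr u v \<le> 1"
  using rho_pos rho_less theta_le by (auto simp: pr_def)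

lemma prob_edge:
  assumes "u \<in> V" "v \<in> V"
  shows "prob {G. G {u, v}} = pr u v"
proof -
  have "prob {G. G {u, v}} = measure_pmf.prob (map_pmf (\<lambda>G. G {u, v}) P) {True}"
    by (auto simp: vimage_def)
  also have "map_pmf (\<lambda>G. G {u, v}) P = (if {u, v} \<in> E then flip {u, v} else return_pmf False)"
    using finite_E by (rule Pi_pmf_component)
  also have "measure_pmf.prob \<dots> {True} = pr u v"
  proof (cases "u = v")
    case True
    then show ?thesis by (simp add: E_def pr_def)
  next
    case False
    then have "{u, v} \<in> E" using assms by (simp add: E_def)
    moreover have "pmf (bernoulli_pmf (if z u = z v then \<theta> else \<rho>)) True = (if z u = z v then \<theta> else \<rho>)"
      using rho_pos rho_less theta_le by simp
    ultimately show ?thesis using False by (auto simp: flip_def pr_def measure_pmf_single)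
  qed
  finally show ?thesis .
qed

text \<open>Ordered pairs are counted, as in \<open>edge_count\<close>: an edge inside
  \<open>A \<inter> B\<close> contributes 2.\<close>

definition edges :: "(nat set \<Rightarrow> bool) \<Rightarrow> nat set \<Rightarrow> nat set \<Rightarrow> real" where
  "edges G A B = (\<Sum>u\<in>A. \<Sum>v\<in>B. of_bool (G {u, v}))"

definition mean_edges :: "nat set \<Rightarrow> nat set \<Rightarrow> real" where
  "mean_edges A B = (\<Sum>u\<in>A. \<Sum>v\<in>B. pr u v)"

lemma mean_edges_le: "mean_edges A B \<le> \<theta> * real (card A) * real (card B)"
proof -
  have "mean_edges A B \<le> (\<Sum>u\<in>A. \<Sum>v\<in>B. \<theta>)"
    unfolding mean_edges_def by (intro sum_mono pr_bounds)
  then show ?thesis by (simp add: mult_ac)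
qed

text \<open>When \<open>A\<close> and \<open>B\<close> overlap, two ordered pairs may share one
  coin. Grouping by unordered pairs and halving restores independent summands in [0,1]; undoing the
  halving doubles the constant 2 of \<open>chernoff_block_sum\<close>.\<close>

lemma edges_chernoff:
  assumes AB: "A \<subseteq> V" "B \<subseteq> V" and L: "0 < L"
  shows "prob {G. 4 * sqrt (L * (L + \<theta> * real (card A) * real (card B))) < \<bar>edges G A B - mean_edges A B\<bar>}
    \<le> 2 * exp (- L)"
proof -
  define g where "g = (\<lambda>p :: nat \<times> nat. {fst p, snd p})"
  define I where "I = g ` (A \<times> B)"
  define w where "w e = real (card {p \<in> A \<times> B. g p = e}) / 2" for e
  define f where "f e G = w e * of_bool (G e)" for e and G :: "nat set \<Rightarrow> bool"
  have fin: "finite A" "finite B" "finite I" using AB by (auto simp: I_def intro: finite_V_subset)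
  have sum_f: "edges G A B = 2 * (\<Sum>e\<in>I. f e G)" for G
  proof -
    have "edges G A B = (\<Sum>p\<in>A \<times> B. of_bool (G (g p)))"
      by (simp add: edges_def sum.cartesian_product g_def case_prod_beta)
    also have "\<dots> = (\<Sum>e\<in>I. \<Sum>p\<in>{p \<in> A \<times> B. g p = e}. of_bool (G (g p)))"
      unfolding I_def by (rule sum.image_gen) (use fin in auto)
    also have "\<dots> = (\<Sum>e\<in>I. 2 * f e G)"
      by (intro sum.cong refl) (simp add: f_def w_def)
    finally show ?thesis by (simp add: sum_distrib_left)
  qed
  have w: "0 \<le> w e \<and> w e \<le> 1" for e
  proof -
    have "\<exists>x y. {p \<in> A \<times> B. g p = e} \<subseteq> {(x, y), (y, x)}"
    proof (cases "\<exists>x y. e = {x, y}")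
      case True
      then obtain x y where "e = {x, y}" by auto
      then show ?thesis
        by (intro exI[of _ x] exI[of _ y]) (auto simp: g_def doubleton_eq_iff)
    qed (auto simp: g_def)
    then obtain x y where "{p \<in> A \<times> B. g p = e} \<subseteq> {(x, y), (y, x)}" by auto
    from card_mono[OF _ this] have "card {p \<in> A \<times> B. g p = e} \<le> card {(x, y), (y, x)}" by simp
    moreover have "card {(x, y), (y, x)} \<le> 2" by (rule card_insert_le_m1) simp_all
    ultimately have "real (card {p \<in> A \<times> B. g p = e}) \<le> 2" by linarith
    then show ?thesis unfolding w_def by simp
  qed
  have mean: "mean_edges A B / 2 = (\<Sum>e\<in>I. expec (f e))"
  proof -
    have "mean_edges A B = (\<Sum>u\<in>A. \<Sum>v\<in>B. expec (\<lambda>G. of_bool (G {u, v})))"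
      unfolding mean_edges_def expec_of_bool using AB
      by (intro sum.cong refl prob_edge[symmetric]) auto
    also have "\<dots> = expec (\<lambda>G. edges G A B)"
      unfolding edges_def expec_sum ..
    also have "\<dots> = 2 * (\<Sum>e\<in>I. expec (f e))"
      unfolding sum_f by (simp add: expec_sum)
    finally show ?thesis by simp
  qed
  have "prob {G. 2 * sqrt (L * (L + \<theta> * real (card A) * real (card B))) < \<bar>(\<Sum>e\<in>I. f e G) - mean_edges A B / 2\<bar>}
    \<le> 2 * exp (- L)"
  proof (rule chernoff_block_sum[where D = "\<lambda>e. {e}"])
    show "depends_on {e} (f e)" for e by (rule depends_onI) (simp add: f_def)
    show "0 \<le> f e G \<and> f e G \<le> 1" for e G using w[of e] by (simp add: f_def)
    have "0 \<le> mean_edges A B" unfolding mean_edges_def by (intro sum_nonneg pr_bounds)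
    then show "mean_edges A B / 2 \<le> L + \<theta> * real (card A) * real (card B)"
      using mean_edges_le[of A B] L by linarith
    show "L \<le> L + \<theta> * real (card A) * real (card B)" using theta_pos by simp
  qed (use fin L mean in \<open>auto simp: disjoint_family_on_def\<close>)
  moreover have "\<bar>edges G A B - mean_edges A B\<bar> = 2 * \<bar>(\<Sum>e\<in>I. f e G) - mean_edges A B / 2\<bar>" for G
    unfolding sum_f by (simp add: abs_if)
  ultimately show ?thesis by simp
qed

definition hit :: "(nat set \<Rightarrow> bool) \<Rightarrow> nat set \<Rightarrow> nat \<Rightarrow> bool" where
  "hit G A v \<longleftrightarrow> (\<exists>u\<in>A. G {u, v})"

lemma depends_on_hit: "depends_on ((\<lambda>u. {u, v}) ` A) (\<lambda>G. hit G A v)"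
  by (rule depends_onI) (auto simp: hit_def)

lemma prob_hit_le:
  assumes "A \<subseteq> V" "v \<in> V"
  shows "prob {G. hit G A v} \<le> (\<Sum>u\<in>A. pr u v)"
proof -
  have "{G. hit G A v} = (\<Union>u\<in>A. {G. G {u, v}})" by (auto simp: hit_def)
  then have "prob {G. hit G A v} \<le> (\<Sum>u\<in>A. prob {G. G {u, v}})"
    using finite_V_subset[OF assms(1)] by (simp add: measure_UNION_le)
  also have "\<dots> = (\<Sum>u\<in>A. pr u v)"
    using assms by (intro sum.cong refl prob_edge) auto
  finally show ?thesis .
qed

text \<open>With s the sum of the edge probabilities, missing all edges has probability at most
  exp(- s). The quadratic term is the price of several members of \<open>A\<close> hitting the same
  vertex.\<close>

lemma prob_hit_ge:
  assumes "A \<subseteq> V" "v \<in> V" "v \<notin> A"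
  shows "(\<Sum>u\<in>A. pr u v) - (\<Sum>u\<in>A. pr u v)\<^sup>2 \<le> prob {G. hit G A v}"
proof -
  define f where "f u G = (1 - of_bool (G {u, v}) :: real)" for u and G :: "nat set \<Rightarrow> bool"
  have fin: "finite A" using assms by (auto intro: finite_V_subset)
  have "prob {G. \<not> hit G A v} = expec (\<lambda>G. \<Prod>u\<in>A. f u G)"
  proof -
    have "of_bool (\<not> hit G A v) = (\<Prod>u\<in>A. f u G)" for G
      using fin by (auto simp: hit_def f_def prod_zero_iff)
    then show ?thesis by (simp flip: expec_of_bool)
  qed
  also have "\<dots> = (\<Prod>u\<in>A. expec (f u))"
  proof (rule expec_prod_indep[OF fin])
    show "disjoint_family_on (\<lambda>u. {{u, v}}) A"
      using assms(3) by (auto simp: disjoint_family_on_def doubleton_eq_iff)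
    show "depends_on {{u, v}} (f u)" for u by (rule depends_onI) (simp add: f_def)
  qed
  also have "\<dots> = (\<Prod>u\<in>A. 1 - pr u v)"
  proof (rule prod.cong[OF refl])
    fix u assume "u \<in> A"
    then have "expec (\<lambda>G. of_bool (G {u, v})) = pr u v"
      unfolding expec_of_bool using assms by (intro prob_edge) auto
    then show "expec (f u) = 1 - pr u v" unfolding f_def by simp
  qed
  also have "\<dots> \<le> (\<Prod>u\<in>A. exp (- pr u v))"
    by (intro prod_mono) (use pr_bounds exp_ge_add_one_self[of "- pr u v" for u] in \<open>auto simp: add.commute\<close>)
  also have "\<dots> = exp (- (\<Sum>u\<in>A. pr u v))" using fin by (simp add: exp_sum flip: sum_negf)
  also have "\<dots> \<le> 1 - (\<Sum>u\<in>A. pr u v) + (\<Sum>u\<in>A. pr u v)\<^sup>2"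
    by (intro exp_minus_le_quadratic sum_nonneg pr_bounds)
  finally have "prob {G. \<not> hit G A v} \<le> 1 - (\<Sum>u\<in>A. pr u v) + (\<Sum>u\<in>A. pr u v)\<^sup>2" .
  moreover have "prob {G. \<not> hit G A v} = 1 - prob {G. hit G A v}"
    by (subst measure_pmf.prob_compl[symmetric]) (auto intro!: arg_cong[where f = prob])
  ultimately show ?thesis by simp
qed

lemma sum_pr_le: "(\<Sum>u\<in>A. pr u v) \<le> \<theta> * real (card A)"
  using sum_mono[of A "\<lambda>u. pr u v" "\<lambda>_. \<theta>"] pr_bounds by (simp add: mult.commute)

lemma prob_hit_both_le:
  assumes "A \<subseteq> V" "B \<subseteq> V" "v \<in> V" "A \<inter> B = {}" "v \<notin> A" "v \<notin> B"
  shows "prob {G. hit G A v \<and> hit G B v} \<le> \<theta>\<^sup>2 * real (card A) * real (card B)"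
proof -
  have "depends_on (- (\<lambda>u. {u, v}) ` A) (\<lambda>G. hit G B v)"
    by (rule depends_on_mono[OF depends_on_hit]) (use assms in \<open>auto simp: doubleton_eq_iff\<close>)
  from prob_Int_indep[OF depends_on_hit this]
  have "prob {G. hit G A v \<and> hit G B v} =
      prob {G. hit G A v} * prob {G. hit G B v}" .
  also have "\<dots> \<le> (\<theta> * real (card A)) * (\<theta> * real (card B))"
    using assms prob_hit_le[of A v] prob_hit_le[of B v] sum_pr_le[of v A] sum_pr_le[of v B] theta_pos
    by (intro mult_mono) auto
  finally show ?thesis by (simp add: power2_eq_square mult_ac)
qed

text \<open>With \<open>A = B\<close> this counts the next layer of one search, with two different
  sets the collisions of two searches.\<close>

lemma hit_count_chernoff:
  assumes U: "U \<subseteq> V" and disj: "U \<inter> A = {}" "U \<inter> B = {}"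
    and \<mu>: "\<mu> = (\<Sum>v\<in>U. prob {G. hit G A v \<and> hit G B v})"
    and \<nu>: "\<mu> \<le> \<nu>" "L \<le> \<nu>" "0 < L"
  shows "prob {G. 2 * sqrt (L * \<nu>) < \<bar>real (card {v \<in> U. hit G A v \<and> hit G B v}) - \<mu>\<bar>}
    \<le> 2 * exp (- L)"
proof -
  define f where "f v G = (of_bool (hit G A v \<and> hit G B v) :: real)" for v G
  have fin: "finite U" using U by (rule finite_V_subset)
  have card: "real (card {v \<in> U. hit G A v \<and> hit G B v}) = (\<Sum>v\<in>U. f v G)" for G
    using fin by (simp add: f_def of_bool_def sum.If_cases Int_def)
  show ?thesis unfolding card
  \<comment> \<open>One block per target vertex: all pairs joining it to
    \<open>A \<union> B\<close>. Distinct targets share no pair because \<open>U\<close> avoids both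
    sets.\<close>
  proof (rule chernoff_block_sum[where D = "\<lambda>v. (\<lambda>u. {u, v}) ` (A \<union> B)"])
    show "disjoint_family_on (\<lambda>v. (\<lambda>u. {u, v}) ` (A \<union> B)) U"
      using disj by (auto simp: disjoint_family_on_def doubleton_eq_iff)
    show "depends_on ((\<lambda>u. {u, v}) ` (A \<union> B)) (f v)" for v
      by (rule depends_onI) (auto simp: f_def hit_def)
    show "\<mu> = (\<Sum>v\<in>U. expec (f v))" unfolding f_def \<mu> expec_of_bool ..
  qed (use fin \<nu> in \<open>auto simp: f_def\<close>)
qed

section \<open>Communities and the expected growth of a layer\<close>

definition share :: "nat \<Rightarrow> nat set \<Rightarrow> real" where
  "share a A = real (card (A \<inter> comm a))"

text \<open>The expected number of neighbours in \<open>A\<close> of a vertex of community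
  \<open>a\<close> outside \<open>A\<close>.\<close>

definition pull :: "nat \<Rightarrow> nat set \<Rightarrow> real" where
  "pull a A = \<rho> * real (card A) + (\<theta> - \<rho>) * share a A"

text \<open>The expected degree with a loop added, and the top eigenvalue of the layer
  recursion.\<close>

definition deg :: real where
  "deg = real n * (\<theta> + (real K - 1) * \<rho>)"

lemma sum_of_bool_card: "finite A \<Longrightarrow> (\<Sum>u\<in>A. of_bool (Q u) :: real) = real (card {u \<in> A. Q u})"
  by (simp add: of_bool_def sum.If_cases Int_def)

lemma sum_pr_pull:
  assumes "A \<subseteq> V" "v \<in> comm a" "v \<notin> A"
  shows "(\<Sum>u\<in>A. pr u v) = pull a A"
proof -
  have "(\<Sum>u\<in>A. pr u v) = (\<Sum>u\<in>A. \<rho> + (\<theta> - \<rho>) * of_bool (u \<in> comm a))"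
    using assms by (intro sum.cong refl) (auto simp: pr_def comm_def)
  also have "\<dots> = \<rho> * real (card A) + (\<theta> - \<rho>) * (\<Sum>u\<in>A. of_bool (u \<in> comm a))"
    by (simp add: sum.distrib sum_distrib_left mult.commute)
  also have "(\<Sum>u\<in>A. of_bool (u \<in> comm a)) = share a A"
    using finite_V_subset[OF assms(1)] by (simp add: sum_of_bool_card share_def Int_def)
  finally show ?thesis by (simp add: pull_def)
qed

lemma share_nonneg [simp]: "0 \<le> share a A"
  and share_le: "finite A \<Longrightarrow> share a A \<le> real (card A)"
  by (auto simp: share_def intro: card_mono)

lemma sum_share:
  assumes "A \<subseteq> V"
  shows "(\<Sum>a<K. share a A) = real (card A)"
proof -
  have "A = (\<Union>a\<in>{..<K}. A \<inter> comm a)" using assms z_less by (auto simp: comm_def)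
  then have "card A = card (\<Union>a\<in>{..<K}. A \<inter> comm a)" by simp
  also have "\<dots> = (\<Sum>a<K. card (A \<inter> comm a))"
    by (rule card_UN_disjoint) (auto simp: comm_def)
  finally show ?thesis by (simp add: share_def)
qed

lemma pull_bounds:
  assumes "finite A"
  shows "0 \<le> pull a A" "pull a A \<le> \<theta> * real (card A)"
proof -
  show "0 \<le> pull a A" using rho_pos rho_less by (simp add: pull_def)
  have "(\<theta> - \<rho>) * share a A \<le> (\<theta> - \<rho>) * real (card A)"
    using rho_less share_le[OF assms] by (intro mult_left_mono) auto
  then show "pull a A \<le> \<theta> * real (card A)" by (simp add: pull_def algebra_simps)
qed

text \<open>Specialises \<open>prob_exploration_le\<close> to two simultaneous searches; the edges
  already read are those that meet \<open>N \<union> N'\<close>.\<close>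

lemma prob_explore_le:
  assumes ij: "i \<in> V" "j \<in> V" and \<epsilon>: "0 \<le> \<epsilon>"
    and bad: "\<And>N S N' S'. \<lbrakk>N \<subseteq> V; S \<subseteq> V; N' \<subseteq> V; S' \<subseteq> V; N \<inter> S = {}; N' \<inter> S' = {}\<rbrakk> \<Longrightarrow>
      depends_on {e. e \<inter> (N \<union> N') = {}} (bad N S N' S') \<and>
      prob {G. bad N S N' S' G} \<le> \<epsilon>"
  shows "prob {G. bad (nearer G V i a) (layer G V i a) (nearer G V j b) (layer G V j b) G} \<le> \<epsilon>"
proof -
  define F where "F G = ((nearer G V i a, layer G V i a), (nearer G V j b, layer G V j b))" for G
  \<comment> \<open>The general bound ranges over all conceivable data, including sets that no
    search produces; \<open>ok\<close> makes these harmless by declaring them never bad.\<close>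
  define ok where "ok = (\<lambda>((N, S), (N', S')). N \<subseteq> V \<and> S \<subseteq> V \<and> N' \<subseteq> V \<and> S' \<subseteq> V \<and> N \<inter> S = {} \<and> N' \<inter> S' = {})"
  define D where "D = (\<lambda>((N :: nat set, S :: nat set), (N' :: nat set, S' :: nat set)). {e. e \<inter> (N \<union> N') \<noteq> {}})"
  define Bad where "Bad = (\<lambda>((N, S), (N', S')) G. ok ((N, S), (N', S')) \<and> bad N S N' S' G)"
  have "prob {G. Bad (F G) G} \<le> \<epsilon>"
  proof (rule prob_exploration_le[where D = D])
    fix G H assume eq: "\<And>e. e \<in> D (F G) \<Longrightarrow> G e = H e"
    have "\<forall>e. e \<inter> nearer G V i a \<noteq> {} \<longrightarrow> G e = H e" "\<forall>e. e \<inter> nearer G V j b \<noteq> {} \<longrightarrow> G e = H e"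
      by (intro allI impI eq; auto simp: D_def F_def)+
    from explore_cong[OF this(1)] explore_cong[OF this(2)] show "F H = F G" by (simp add: F_def)
  next
    fix x :: "(nat set \<times> nat set) \<times> (nat set \<times> nat set)"
    obtain N S N' S' where x: "x = ((N, S), (N', S'))" by (metis surj_pair)
    have D: "- D x = {e. e \<inter> (N \<union> N') = {}}" by (auto simp: D_def x)
    have "depends_on (- D x) (Bad x) \<and> prob {G. Bad x G} \<le> \<epsilon>"
    proof (cases "ok x")
      case True
      then have "Bad x = bad N S N' S'" by (simp add: Bad_def x fun_eq_iff)
      then show ?thesis using bad[of N S N' S'] True D by (simp add: ok_def x)
    next
      case False
      then have "Bad x = (\<lambda>_. False)" by (simp add: Bad_def x fun_eq_iff)
      then show ?thesis using \<epsilon> by (simp add: depends_on_def)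
    qed
    then show "depends_on (- D x) (Bad x)" "prob {G. Bad x G} \<le> \<epsilon>" by simp_all
  qed
  moreover have "ok (F G)" for G
    using ij by (simp add: ok_def F_def nearer_subset layer_subset nearer_Int_layer)
  ultimately show ?thesis by (simp add: Bad_def F_def)
qed

text \<open>The first term covers vertices already used, the second vertices hit by several members
  of \<open>S\<close>; the third is the Chernoff deviation.\<close>

definition composition_dev :: "real \<Rightarrow> nat \<Rightarrow> nat set \<Rightarrow> nat set \<Rightarrow> (nat set \<Rightarrow> bool) \<Rightarrow> bool" where
  "composition_dev L a N S G \<longleftrightarrow>
     \<theta> * real (card S) * real (card (N \<union> S)) + real n * (\<theta> * real (card S))\<^sup>2
       + 2 * sqrt (L * (L + real n * \<theta> * real (card S)))
     < \<bar>real (card {v \<in> comm a - (N \<union> S). hit G S v}) - real n * pull a S\<bar>"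

text \<open>One-sided, because it serves for upper bounds: on degrees at level 0 and on the edges
  leaving layer k - 1.\<close>

definition boundary_dev :: "real \<Rightarrow> nat set \<Rightarrow> nat set \<Rightarrow> (nat set \<Rightarrow> bool) \<Rightarrow> bool" where
  "boundary_dev L N S G \<longleftrightarrow>
     deg * real (card S) + 4 * sqrt (L * (L + \<theta> * real (card S) * real (n * K))) < edges G S (V - (N \<union> S))"

text \<open>Removing the interior of the other search leaves exactly the pairs that avoid
  \<open>N \<union> N'\<close>, hence the unread ones.\<close>

definition pair_dev :: "real \<Rightarrow> nat set \<Rightarrow> nat set \<Rightarrow> nat set \<Rightarrow> nat set \<Rightarrow> (nat set \<Rightarrow> bool) \<Rightarrow> bool" where
  "pair_dev L N S N' S' G \<longleftrightarrow>
     4 * sqrt (L * (L + \<theta> * real (card (S - N')) * real (card (S' - N))))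
     < \<bar>edges G (S - N') (S' - N) - mean_edges (S - N') (S' - N)\<bar>"

text \<open>The set differences exclude a common predecessor, so each counted vertex is reached
  through two different unread edges.\<close>

definition collision_dev :: "real \<Rightarrow> nat set \<Rightarrow> nat set \<Rightarrow> nat set \<Rightarrow> nat set \<Rightarrow> (nat set \<Rightarrow> bool) \<Rightarrow> bool" where
  "collision_dev L N S N' S' G \<longleftrightarrow>
     4 * (real (n * K) * \<theta>\<^sup>2 * real (card S) * real (card S') + L)
     < real (card {v \<in> V - (N \<union> S \<union> N' \<union> S'). hit G (S - (N' \<union> S')) v \<and> hit G (S' - (N \<union> S)) v})"

lemma prob_composition_dev:
  assumes S: "N \<subseteq> V" "S \<subseteq> V" "N \<inter> S = {}" and a: "a < K" and L: "0 < L"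
  shows "depends_on {e. e \<inter> N = {}} (composition_dev L a N S)"
    and "prob {G. composition_dev L a N S G} \<le> 2 * exp (- L)"
proof -
  define U where "U = comm a - (N \<union> S)"
  define \<mu> where "\<mu> = (\<Sum>v\<in>U. prob {G. hit G S v \<and> hit G S v})"
  have fin: "finite S" "finite N" "finite U" using S by (auto simp: U_def intro: finite_V_subset)
  have UV: "U \<subseteq> V" using comm_subset by (auto simp: U_def)
  have pull_eq: "(\<Sum>u\<in>S. pr u v) = pull a S" if "v \<in> U" for v
    using that S by (intro sum_pr_pull) (auto simp: U_def)
  define p where "p = pull a S"
  have p: "0 \<le> p" "p \<le> \<theta> * real (card S)" using pull_bounds[OF fin(1), of a] by (auto simp: p_def)
  have cardU: "real (card U) \<le> real n" "real n - real (card (N \<union> S)) \<le> real (card U)"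
  proof -
    show "real (card U) \<le> real n"
      using card_mono[of "comm a" U] card_comm[OF a] by (auto simp: U_def)
    have "card (comm a) - card (N \<union> S) \<le> card U"
      unfolding U_def using fin by (intro diff_card_le_card_Diff) auto
    then show "real n - real (card (N \<union> S)) \<le> real (card U)" using card_comm[OF a] by linarith
  qed
  have qle: "prob {G. hit G S v \<and> hit G S v} \<le> p" if "v \<in> U" for v
    using prob_hit_le[of S v] that S UV pull_eq[OF that] by (auto simp: p_def)
  have qge: "p - p\<^sup>2 \<le> prob {G. hit G S v \<and> hit G S v}" if "v \<in> U" for v
    using prob_hit_ge[of S v] that S UV pull_eq[OF that] by (auto simp: p_def U_def)
  have up: "\<mu> \<le> real n * p"
  proof -
    have "\<mu> \<le> (\<Sum>v\<in>U. p)" unfolding \<mu>_def by (rule sum_mono) (rule qle)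
    also have "\<dots> \<le> real n * p" using cardU p by (simp add: mult_right_mono)
    finally show ?thesis .
  qed
  have low: "real n * p - \<theta> * real (card S) * real (card (N \<union> S)) - real n * (\<theta> * real (card S))\<^sup>2 \<le> \<mu>"
  proof -
    have "(real n - real (card (N \<union> S))) * p \<le> real (card U) * p"
      using cardU p by (intro mult_right_mono) auto
    moreover have "real (card U) * p\<^sup>2 \<le> real n * (\<theta> * real (card S))\<^sup>2"
      using cardU p by (intro mult_mono power_mono) auto
    moreover have "real (card (N \<union> S)) * p \<le> real (card (N \<union> S)) * (\<theta> * real (card S))"
      using p by (intro mult_left_mono) auto
    moreover have "real (card U) * (p - p\<^sup>2) \<le> \<mu>"
      using sum_mono[of U "\<lambda>_. p - p\<^sup>2", OF qge] unfolding \<mu>_def by simp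
    ultimately show ?thesis by (simp add: algebra_simps)
  qed
  define \<nu> where "\<nu> = L + real n * \<theta> * real (card S)"
  have "prob {G. composition_dev L a N S G} \<le>
      prob {G. 2 * sqrt (L * \<nu>) < \<bar>real (card {v \<in> U. hit G S v \<and> hit G S v}) - \<mu>\<bar>}"
    using up low
    by (intro measure_pmf.finite_measure_mono) (auto simp: composition_dev_def U_def[symmetric] p_def[symmetric] \<nu>_def abs_if split: if_splits)
  also have "\<dots> \<le> 2 * exp (- L)"
  proof (rule hit_count_chernoff[OF UV _ _ \<mu>_def _ _ L])
    have "real n * p \<le> real n * (\<theta> * real (card S))" using p by (intro mult_left_mono) auto
    then show "\<mu> \<le> \<nu>" using up L by (simp add: \<nu>_def mult_ac)
    show "L \<le> \<nu>" using theta_pos by (simp add: \<nu>_def)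
  qed (auto simp: U_def)
  finally show "prob {G. composition_dev L a N S G} \<le> 2 * exp (- L)" .
  show "depends_on {e. e \<inter> N = {}} (composition_dev L a N S)"
  proof (rule depends_onI)
    fix G H :: "nat set \<Rightarrow> bool" assume eq: "\<And>e. e \<in> {e. e \<inter> N = {}} \<Longrightarrow> G e = H e"
    have "hit G S v = hit H S v" if "v \<in> comm a - (N \<union> S)" for v
      unfolding hit_def using that S(3) by (intro bex_cong refl eq) auto
    then have "{v \<in> comm a - (N \<union> S). hit G S v} = {v \<in> comm a - (N \<union> S). hit H S v}" by auto
    then show "composition_dev L a N S G = composition_dev L a N S H"
      by (simp only: composition_dev_def)
  qed
qed

lemma edges_cong:
  assumes "\<And>u v. u \<in> A \<Longrightarrow> v \<in> B \<Longrightarrow> G {u, v} = H {u, v}"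
  shows "edges G A B = edges H A B"
  unfolding edges_def by (intro sum.cong refl) (simp add: assms)

lemma sum_pr_V_le:
  assumes "u \<in> V"
  shows "(\<Sum>v\<in>V. pr u v) \<le> deg"
proof -
  have "(\<Sum>v\<in>V. pr u v) \<le> (\<Sum>v\<in>V. \<rho> + (\<theta> - \<rho>) * of_bool (v \<in> comm (z u)))"
    using rho_pos rho_less by (intro sum_mono) (auto simp: pr_def comm_def)
  also have "\<dots> = \<rho> * real (n * K) + (\<theta> - \<rho>) * (\<Sum>v\<in>V. of_bool (v \<in> comm (z u)))"
    by (simp add: sum.distrib sum_distrib_left mult.commute)
  also have "(\<Sum>v\<in>V. of_bool (v \<in> comm (z u)) :: real) = real (card (comm (z u)))"
    by (subst sum_of_bool_card) (auto simp: comm_def intro: arg_cong[where f = card])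
  also have "\<dots> = real n" using z_less[OF assms] by (simp add: card_comm)
  finally show ?thesis by (simp add: deg_def algebra_simps)
qed

lemma prob_boundary_dev:
  assumes S: "N \<subseteq> V" "S \<subseteq> V" "N \<inter> S = {}" and L: "0 < L"
  shows "depends_on {e. e \<inter> N = {}} (boundary_dev L N S)"
    and "prob {G. boundary_dev L N S G} \<le> 2 * exp (- L)"
proof -
  define U where "U = V - (N \<union> S)"
  have "mean_edges S U \<le> (\<Sum>u\<in>S. \<Sum>v\<in>V. pr u v)"
    unfolding mean_edges_def by (intro sum_mono sum_mono2) (auto simp: U_def pr_bounds)
  also have "\<dots> \<le> (\<Sum>u\<in>S. deg)" using S by (intro sum_mono sum_pr_V_le) auto
  finally have mean: "mean_edges S U \<le> deg * real (card S)" by (simp add: mult.commute)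
  have "card U \<le> n * K" using card_mono[of V U] by (auto simp: U_def)
  then have "sqrt (L * (L + \<theta> * real (card S) * real (card U))) \<le> sqrt (L * (L + \<theta> * real (card S) * real (n * K)))"
    using L theta_pos by (intro real_sqrt_le_mono mult_left_mono add_left_mono) (auto simp del: of_nat_mult)
  then have "4 * sqrt (L * (L + \<theta> * real (card S) * real (card U))) < \<bar>edges G S U - mean_edges S U\<bar>"
    if "boundary_dev L N S G" for G
    using mean that unfolding boundary_dev_def U_def[symmetric] by linarith
  then have "prob {G. boundary_dev L N S G} \<le>
    prob {G. 4 * sqrt (L * (L + \<theta> * real (card S) * real (card U))) < \<bar>edges G S U - mean_edges S U\<bar>}"
    by (intro measure_pmf.finite_measure_mono Collect_mono impI) auto
  also have "\<dots> \<le> 2 * exp (- L)" by (rule edges_chernoff) (use S L in \<open>auto simp: U_def\<close>)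
  finally show "prob {G. boundary_dev L N S G} \<le> 2 * exp (- L)" .
  show "depends_on {e. e \<inter> N = {}} (boundary_dev L N S)"
  proof (rule depends_onI)
    fix G H :: "nat set \<Rightarrow> bool" assume eq: "\<And>e. e \<in> {e. e \<inter> N = {}} \<Longrightarrow> G e = H e"
    have "edges G S (V - (N \<union> S)) = edges H S (V - (N \<union> S))"
      by (intro edges_cong eq) (use S in auto)
    then show "boundary_dev L N S G = boundary_dev L N S H"
      by (simp only: boundary_dev_def)
  qed
qed

lemma prob_pair_dev:
  assumes S: "N \<subseteq> V" "S \<subseteq> V" "N \<inter> S = {}" "N' \<subseteq> V" "S' \<subseteq> V" "N' \<inter> S' = {}" and L: "0 < L"
  shows "depends_on {e. e \<inter> (N \<union> N') = {}} (pair_dev L N S N' S')"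
    and "prob {G. pair_dev L N S N' S' G} \<le> 2 * exp (- L)"
proof -
  show "prob {G. pair_dev L N S N' S' G} \<le> 2 * exp (- L)"
    unfolding pair_dev_def by (rule edges_chernoff) (use S L in auto)
  show "depends_on {e. e \<inter> (N \<union> N') = {}} (pair_dev L N S N' S')"
  proof (rule depends_onI)
    fix G H :: "nat set \<Rightarrow> bool" assume eq: "\<And>e. e \<in> {e. e \<inter> (N \<union> N') = {}} \<Longrightarrow> G e = H e"
    have "edges G (S - N') (S' - N) = edges H (S - N') (S' - N)"
      by (intro edges_cong eq) (use S in auto)
    then show "pair_dev L N S N' S' G = pair_dev L N S N' S' H"
      by (simp only: pair_dev_def)
  qed
qed

lemma prob_collision_dev:
  assumes S: "N \<subseteq> V" "S \<subseteq> V" "N \<inter> S = {}" "N' \<subseteq> V" "S' \<subseteq> V" "N' \<inter> S' = {}" and L: "0 < L"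
  shows "depends_on {e. e \<inter> (N \<union> N') = {}} (collision_dev L N S N' S')"
    and "prob {G. collision_dev L N S N' S' G} \<le> 2 * exp (- L)"
proof -
  define U where "U = V - (N \<union> S \<union> N' \<union> S')"
  define A where "A = S - (N' \<union> S')"
  define B where "B = S' - (N \<union> S)"
  define \<mu> where "\<mu> = (\<Sum>v\<in>U. prob {G. hit G A v \<and> hit G B v})"
  define \<nu> where "\<nu> = real (n * K) * \<theta>\<^sup>2 * real (card S) * real (card S')"
  have fin: "finite S" "finite S'" using S by (auto intro: finite_V_subset)
  have cards: "card A \<le> card S" "card B \<le> card S'" "card U \<le> n * K"
    using card_mono[OF fin(1), of A] card_mono[OF fin(2), of B] card_mono[of V U]
    by (auto simp: A_def B_def U_def)
  have "\<mu> \<le> (\<Sum>v\<in>U. \<theta>\<^sup>2 * real (card A) * real (card B))"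
    unfolding \<mu>_def by (intro sum_mono prob_hit_both_le) (use S in \<open>auto simp: A_def B_def U_def\<close>)
  also have "\<dots> = real (card U) * (\<theta>\<^sup>2 * real (card A) * real (card B))" by simp
  also have "\<dots> \<le> real (n * K) * (\<theta>\<^sup>2 * real (card S) * real (card S'))"
    using cards by (intro mult_mono) (auto simp del: of_nat_mult)
  finally have \<mu>: "\<mu> \<le> \<nu>" by (simp add: \<nu>_def mult_ac)
  have \<nu>: "0 \<le> \<nu>" by (simp add: \<nu>_def)
  have "sqrt (L * (L + \<nu>)) \<le> sqrt ((L + \<nu>) * (L + \<nu>))"
    using L \<nu> by (intro real_sqrt_le_mono mult_right_mono) auto
  then have sq: "sqrt (L * (L + \<nu>)) \<le> L + \<nu>" using L \<nu> by simp
  have "2 * sqrt (L * (L + \<nu>)) < \<bar>real (card {v \<in> U. hit G A v \<and> hit G B v}) - \<mu>\<bar>"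
    if "collision_dev L N S N' S' G" for G
  proof -
    have "4 * (\<nu> + L) < real (card {v \<in> U. hit G A v \<and> hit G B v})"
      using that unfolding collision_dev_def U_def[symmetric] A_def[symmetric] B_def[symmetric] \<nu>_def[symmetric] .
    moreover have "x \<le> \<bar>x\<bar>" for x :: real by simp
    note this[of "real (card {v \<in> U. hit G A v \<and> hit G B v}) - \<mu>"]
    ultimately show ?thesis using sq \<mu> L \<nu> by argo
  qed
  then have "prob {G. collision_dev L N S N' S' G} \<le>
    prob {G. 2 * sqrt (L * (L + \<nu>)) < \<bar>real (card {v \<in> U. hit G A v \<and> hit G B v}) - \<mu>\<bar>}"
    by (intro measure_pmf.finite_measure_mono Collect_mono impI) auto
  also have "\<dots> \<le> 2 * exp (- L)"
    by (rule hit_count_chernoff[OF _ _ _ \<mu>_def _ _ L]) (use \<mu> \<nu> L in \<open>auto simp: U_def A_def B_def\<close>)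
  finally show "prob {G. collision_dev L N S N' S' G} \<le> 2 * exp (- L)" .
  show "depends_on {e. e \<inter> (N \<union> N') = {}} (collision_dev L N S N' S')"
  proof (rule depends_onI)
    fix G H :: "nat set \<Rightarrow> bool" assume eq: "\<And>e. e \<in> {e. e \<inter> (N \<union> N') = {}} \<Longrightarrow> G e = H e"
    have "hit G A v = hit H A v" "hit G B v = hit H B v" if "v \<in> U" for v
      unfolding hit_def using that S by (intro bex_cong refl eq; auto simp: A_def B_def U_def)+
    then have "{v \<in> U. hit G A v \<and> hit G B v} = {v \<in> U. hit H A v \<and> hit H B v}" by auto
    then show "collision_dev L N S N' S' G = collision_dev L N S N' S' H"
      by (simp only: collision_dev_def U_def A_def B_def)
  qed
qed

end

section \<open>Composition of the layers\<close>

context sbm_graph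
begin

text \<open>The first clause excludes loops and holds almost surely by the default value.
  \<open>pair_dev\<close> is also required below level k because level k - 1 reappears in
  \<open>cross_edges_le\<close>.\<close>

definition good :: "nat \<Rightarrow> real \<Rightarrow> (nat set \<Rightarrow> bool) \<Rightarrow> bool" where
  "good k L G \<longleftrightarrow>
     (\<forall>e. e \<notin> E \<longrightarrow> \<not> G e) \<and>
     (\<forall>i\<in>V. \<forall>m<k. \<forall>a<K. \<not> composition_dev L a (nearer G V i m) (layer G V i m) G) \<and>
     (\<forall>i\<in>V. \<forall>m<k. \<not> boundary_dev L (nearer G V i m) (layer G V i m) G) \<and>
     (\<forall>i\<in>V. \<forall>j\<in>V. \<forall>m\<le>k.
        \<not> pair_dev L (nearer G V i m) (layer G V i m) (nearer G V j m) (layer G V j m) G) \<and>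
     (\<forall>i\<in>V. \<forall>j\<in>V. \<forall>a<k. \<forall>b<k.
        \<not> collision_dev L (nearer G V i a) (layer G V i a) (nearer G V j b) (layer G V j b) G)"

text \<open>A single search is a pair whose second search stops at level 0, where nothing has been
  read.\<close>

lemma prob_explore1_le:
  assumes i: "i \<in> V" and \<epsilon>: "0 \<le> \<epsilon>"
    and bad: "\<And>N S. \<lbrakk>N \<subseteq> V; S \<subseteq> V; N \<inter> S = {}\<rbrakk> \<Longrightarrow>
      depends_on {e. e \<inter> N = {}} (bad N S) \<and> prob {G. bad N S G} \<le> \<epsilon>"
  shows "prob {G. bad (nearer G V i a) (layer G V i a) G} \<le> \<epsilon>"
proof -
  define bad' where "bad' N S N' (S' :: nat set) G \<longleftrightarrow> N' = {} \<and> bad N S G"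
    for N S N' :: "nat set" and S' G
  have "prob {G. bad' (nearer G V i a) (layer G V i a) (nearer G V i 0) (layer G V i 0) G} \<le> \<epsilon>"
  proof (rule prob_explore_le[OF i i \<epsilon>])
    fix N S N' S' :: "nat set" assume *: "N \<subseteq> V" "S \<subseteq> V" "N \<inter> S = {}"
    show "depends_on {e. e \<inter> (N \<union> N') = {}} (bad' N S N' S') \<and>
        prob {G. bad' N S N' S' G} \<le> \<epsilon>"
    proof (cases "N' = {}")
      case True
      then have "bad' N S N' S' = bad N S" by (simp add: bad'_def fun_eq_iff)
      then show ?thesis using bad[OF *] True by simp
    next
      case False
      then have "bad' N S N' S' = (\<lambda>_. False)" by (simp add: bad'_def fun_eq_iff)
      then show ?thesis using \<epsilon> by (simp add: depends_on_def)
    qed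
  qed
  then show ?thesis by (simp add: bad'_def)
qed

lemma union_bound:
  assumes "finite I" "\<And>x. x \<in> I \<Longrightarrow> prob {G. B x G} \<le> \<epsilon>"
  shows "prob {G. \<exists>x\<in>I. B x G} \<le> real (card I) * \<epsilon>"
proof -
  have "{G. \<exists>x\<in>I. B x G} = (\<Union>x\<in>I. {G. B x G})" by auto
  then have "prob {G. \<exists>x\<in>I. B x G} \<le> (\<Sum>x\<in>I. prob {G. B x G})"
    using assms(1) by (simp add: measure_UNION_le)
  also have "\<dots> \<le> real (card I) * \<epsilon>" by (rule sum_bounded_above) (rule assms(2))
  finally show ?thesis .
qed

lemma prob_not_good:
  assumes L: "0 < L"
  shows "prob {G. \<not> good k L G} \<le>
    (real (n * K * (k * K)) + real (n * K * k) + real (n * K * (n * K * Suc k)) + real (n * K * (n * K * (k * k)))) * (2 * exp (- L))"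
proof -
  let ?\<epsilon> = "2 * exp (- L)"
  have \<epsilon>: "0 \<le> ?\<epsilon>" by simp
  define B1 where "B1 = (\<lambda>(i, m, a) G. composition_dev L a (nearer G V i m) (layer G V i m) G)"
  define B2 where "B2 = (\<lambda>(i, m) G. boundary_dev L (nearer G V i m) (layer G V i m) G)"
  define B3 where "B3 = (\<lambda>(i, j, m) G. pair_dev L (nearer G V i m) (layer G V i m) (nearer G V j m) (layer G V j m) G)"
  define B4 where "B4 = (\<lambda>(i, j, a, b) G. collision_dev L (nearer G V i a) (layer G V i a) (nearer G V j b) (layer G V j b) G)"
  define I1 where "I1 = V \<times> {..<k} \<times> {..<K}"
  define I2 where "I2 = V \<times> {..<k}"
  define I3 where "I3 = V \<times> V \<times> {..k}"
  define I4 where "I4 = V \<times> V \<times> {..<k} \<times> {..<k}"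
  have b1: "prob {G. \<exists>x\<in>I1. B1 x G} \<le> real (card I1) * ?\<epsilon>"
  proof (rule union_bound)
    fix x assume "x \<in> I1"
    then obtain i m a where x: "x = (i, m, a)" "i \<in> V" "a < K" by (auto simp: I1_def)
    show "prob {G. B1 x G} \<le> ?\<epsilon>"
      unfolding B1_def x split
      by (rule prob_explore1_le[OF x(2) \<epsilon>]) (intro conjI prob_composition_dev x L)
  qed (simp add: I1_def)
  have b2: "prob {G. \<exists>x\<in>I2. B2 x G} \<le> real (card I2) * ?\<epsilon>"
  proof (rule union_bound)
    fix x assume "x \<in> I2"
    then obtain i m where x: "x = (i, m)" "i \<in> V" by (auto simp: I2_def)
    show "prob {G. B2 x G} \<le> ?\<epsilon>"
      unfolding B2_def x split
      by (rule prob_explore1_le[OF x(2) \<epsilon>]) (intro conjI prob_boundary_dev x L)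
  qed (simp add: I2_def)
  have b3: "prob {G. \<exists>x\<in>I3. B3 x G} \<le> real (card I3) * ?\<epsilon>"
  proof (rule union_bound)
    fix x assume "x \<in> I3"
    then obtain i j m where x: "x = (i, j, m)" "i \<in> V" "j \<in> V" by (auto simp: I3_def)
    show "prob {G. B3 x G} \<le> ?\<epsilon>"
      unfolding B3_def x split
      by (rule prob_explore_le[OF x(2,3) \<epsilon>]) (intro conjI prob_pair_dev L)
  qed (simp add: I3_def)
  have b4: "prob {G. \<exists>x\<in>I4. B4 x G} \<le> real (card I4) * ?\<epsilon>"
  proof (rule union_bound)
    fix x assume "x \<in> I4"
    then obtain i j a b where x: "x = (i, j, a, b)" "i \<in> V" "j \<in> V" by (auto simp: I4_def)
    show "prob {G. B4 x G} \<le> ?\<epsilon>"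
      unfolding B4_def x split
      by (rule prob_explore_le[OF x(2,3) \<epsilon>]) (intro conjI prob_collision_dev L)
  qed (simp add: I4_def)
  have off: "\<forall>e. e \<notin> E \<longrightarrow> \<not> G e" if "G \<in> set_pmf P" for G
    using that set_Pi_pmf_subset[OF finite_E, of False flip] by auto
  have split: "\<not> good k L G \<longleftrightarrow> \<not> (\<forall>e. e \<notin> E \<longrightarrow> \<not> G e) \<or>
      (\<exists>x\<in>I1. B1 x G) \<or> (\<exists>x\<in>I2. B2 x G) \<or> (\<exists>x\<in>I3. B3 x G) \<or> (\<exists>x\<in>I4. B4 x G)" for G
    unfolding good_def I1_def I2_def I3_def I4_def B1_def B2_def B3_def B4_def
    by (simp add: Bex_def)
  have "prob {G. \<not> good k L G} \<le> prob
     ({G. \<exists>x\<in>I1. B1 x G} \<union> ({G. \<exists>x\<in>I2. B2 x G} \<union> ({G. \<exists>x\<in>I3. B3 x G} \<union> {G. \<exists>x\<in>I4. B4 x G})))"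
  proof (rule measure_pmf.finite_measure_mono_AE)
    show "AE G in measure_pmf P. G \<in> {G. \<not> good k L G} \<longrightarrow> G \<in> {G. \<exists>x\<in>I1. B1 x G} \<union>
      ({G. \<exists>x\<in>I2. B2 x G} \<union> ({G. \<exists>x\<in>I3. B3 x G} \<union> {G. \<exists>x\<in>I4. B4 x G}))"
      by (rule AE_pmfI) (drule off, simp only: split mem_Collect_eq Un_iff, blast)
  qed simp
  also have "\<dots> \<le> real (card I1) * ?\<epsilon> + (real (card I2) * ?\<epsilon> + (real (card I3) * ?\<epsilon> + real (card I4) * ?\<epsilon>))"
    by (intro order.trans[OF measure_Un_le add_mono] b1 b2 b3 b4) auto
  also have "\<dots> = (real (n * K * (k * K)) + real (n * K * k) + real (n * K * (n * K * Suc k)) + real (n * K * (n * K * (k * k)))) * ?\<epsilon>"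
    unfolding I1_def I2_def I3_def I4_def card_cartesian_product card_lessThan card_atMost
    by (simp only: distrib_right add.assoc)
  finally show ?thesis .
qed

end

text \<open>The factor 3 makes \<open>exp (- L)\<close> equal to n^(-3), enough against the order
  n^2 pairs in the union bound. The last two assumptions keep each summand of
  \<open>\<delta>\<close> at most 1.\<close>

locale good_graph = sbm_graph +
  fixes k :: nat and G :: "nat set \<Rightarrow> bool"
  assumes good: "good k (3 * ln (real n)) G"
    and k2: "2 \<le> k" and K2: "2 \<le> K" and ln1: "1 \<le> ln (real n)"
    and ln_le: "ln (real n) \<le> real n * \<theta>"
    and volume: "(real n * \<theta>) ^ k \<le> real n"
begin

abbreviation "lay i m \<equiv> layer G V i m"
abbreviation "ner i m \<equiv> nearer G V i m"
abbreviation "L \<equiv> 3 * ln (real n)"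

definition D :: real where "D = real n * \<theta>"
definition \<delta> :: real where "\<delta> = sqrt (ln (real n) / D) + D ^ k / real n"
text \<open>In \<open>card_layer_le_aux\<close> each of the K shares is at most (K^k + 1)
  D^m.\<close>

definition Q :: real where "Q = real K * (real K ^ k + 1)"
text \<open>Error constant of one search step: k Q^2 from used vertices, Q^2 from multiple hits, 6
  (3 + Q) from the Chernoff term.\<close>

definition J :: real where "J = (real k + 1) * Q\<^sup>2 + 6 * (3 + Q)"
text \<open>Starts at 0 and dominates the error recursion, in which a step multiplies by K + 1 and
  adds \<open>J\<close>.\<close>

definition M :: "nat \<Rightarrow> real" where "M m = J * real m * (real K + 1) ^ m"

text \<open>The initial vector, concentrated on the community of \<open>i\<close>, is split into its
  uniform part and its deviation. Both are eigenvectors of the layer recursion, and each is scaled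
  by the m-th power of its eigenvalue.\<close>

definition \<xi> :: "nat \<Rightarrow> nat \<Rightarrow> nat \<Rightarrow> real" where
  "\<xi> i m a = deg ^ m / real K + (real n * (\<theta> - \<rho>)) ^ m * (of_bool (a = z i) - 1 / real K)"

lemma n_pos: "0 < real n"
  using ln1 by (cases "n = 0") auto

lemma D_ge: "1 \<le> D" "ln (real n) \<le> D" and volume': "D ^ k \<le> real n"
  using ln1 ln_le volume by (auto simp: D_def)

lemma K_real: "2 \<le> real K"
  using K2 by simp

lemma deg_bounds: "D \<le> deg" "deg \<le> real K * D" "real n * (\<theta> - \<rho>) \<le> D" "0 \<le> real n * (\<theta> - \<rho>)"
proof -
  have "0 \<le> (real K - 1) * \<rho>" "(real K - 1) * \<rho> \<le> (real K - 1) * \<theta>"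
    using K_real rho_pos rho_less by (auto intro!: mult_left_mono)
  then have "\<theta> \<le> \<theta> + (real K - 1) * \<rho>" "\<theta> + (real K - 1) * \<rho> \<le> real K * \<theta>"
    by (auto simp: algebra_simps)
  then show "D \<le> deg" "deg \<le> real K * D"
    unfolding D_def deg_def mult.left_commute[of "real K"] by (auto intro!: mult_left_mono)
  show "real n * (\<theta> - \<rho>) \<le> D" "0 \<le> real n * (\<theta> - \<rho>)"
    using rho_pos rho_less by (auto simp: D_def intro!: mult_left_mono)
qed

lemma \<delta>_bounds: "D ^ k / real n \<le> \<delta>" "sqrt (ln (real n) / D) \<le> \<delta>" "1 / D \<le> \<delta>" "0 \<le> \<delta>" 
proof -
  have nn: "0 \<le> D ^ k / real n" "0 \<le> sqrt (ln (real n) / D)" using D_ge n_pos ln1 by auto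
  then show "D ^ k / real n \<le> \<delta>" "sqrt (ln (real n) / D) \<le> \<delta>" "0 \<le> \<delta>" by (auto simp: \<delta>_def)
  have "(1 / D)\<^sup>2 \<le> ln (real n) / D"
    using D_ge ln1 by (auto simp: power2_eq_square divide_simps intro: mult_mono order.trans[of 1 D "ln (real n) * D"])
  then have "1 / D \<le> sqrt (ln (real n) / D)" by (rule real_le_rsqrt)
  then show "1 / D \<le> \<delta>" using nn by (simp add: \<delta>_def)
qed

lemma Q_ge: "1 \<le> Q" "real K ^ k \<le> Q"
proof -
  have "1 \<le> real K ^ k" using K_real by simp
  moreover have "1 * (real K ^ k + 1) \<le> Q" unfolding Q_def using K_real by (intro mult_right_mono) auto
  ultimately show "1 \<le> Q" "real K ^ k \<le> Q" by auto
qed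

lemma J_nonneg: "0 \<le> J" and M_nonneg: "0 \<le> M m"
  using Q_ge by (auto simp: J_def M_def)

lemma M_Suc: "(real K + 1) * M m + J \<le> M (Suc m)"
proof -
  have "J * 1 \<le> J * (real K + 1) ^ Suc m" using J_nonneg by (intro mult_left_mono one_le_power) auto
  then show ?thesis by (simp add: M_def algebra_simps)
qed

lemma M_mono: "m \<le> m' \<Longrightarrow> M m \<le> M m'"
  unfolding M_def using J_nonneg by (intro mult_mono power_increasing) auto

lemma D_power_mono: "m \<le> m' \<Longrightarrow> D ^ m \<le> D ^ m'"
  using D_ge by (intro power_increasing) auto

lemma D_power_ge1: "1 \<le> D ^ m"
  using D_ge by simp

lemma deg_power_le: "m \<le> k \<Longrightarrow> deg ^ m \<le> real K ^ k * D ^ m"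
proof -
  assume "m \<le> k"
  have "deg ^ m \<le> (real K * D) ^ m" using deg_bounds D_ge by (intro power_mono) auto
  also have "\<dots> = real K ^ m * D ^ m" by (simp add: power_mult_distrib)
  also have "\<dots> \<le> real K ^ k * D ^ m"
    using D_ge K_real \<open>m \<le> k\<close> by (intro mult_right_mono power_increasing) auto
  finally show ?thesis .
qed

lemma deg_power_bounds: "D ^ m \<le> deg ^ m" "m \<le> k \<Longrightarrow> deg ^ m \<le> Q * D ^ m"
proof -
  show "D ^ m \<le> deg ^ m" using deg_bounds D_ge by (intro power_mono) auto
  have "real K ^ k * D ^ m \<le> Q * D ^ m" using Q_ge D_ge by (intro mult_right_mono) auto
  then show "m \<le> k \<Longrightarrow> deg ^ m \<le> Q * D ^ m" using deg_power_le[of m] by linarith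
qed

lemma \<xi>_bounds: "0 \<le> \<xi> i m a" "\<xi> i m a \<le> deg ^ m"
proof -
  define x where "x = (real n * (\<theta> - \<rho>)) ^ m"
  have x: "0 \<le> x" "x \<le> deg ^ m"
    unfolding x_def using deg_bounds by (auto intro!: power_mono)
  have "0 \<le> x * (1 - 1 / real K)" "x * (1 - 1 / real K) \<le> deg ^ m * (1 - 1 / real K)"
    "x * (1 / real K) \<le> deg ^ m * (1 / real K)" "0 \<le> x * (1 / real K)" "0 \<le> deg ^ m * (1 - 1 / real K)"
    using x K_real by (auto intro!: mult_nonneg_nonneg mult_right_mono divide_right_mono)
  then show "0 \<le> \<xi> i m a" "\<xi> i m a \<le> deg ^ m"
    unfolding \<xi>_def x_def[symmetric] by (auto simp: algebra_simps of_bool_def)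
qed

lemma sum_\<xi>:
  assumes "i \<in> V"
  shows "(\<Sum>a<K. \<xi> i m a) = deg ^ m"
proof -
  have "(\<Sum>a<K. of_bool (a = z i) :: real) = 1"
    using z_less[OF assms] by (simp add: of_bool_def sum.delta)
  then show ?thesis
    using K_real by (simp add: \<xi>_def sum.distrib sum_subtractf flip: sum_distrib_left)
qed

lemma \<xi>_Suc:
  assumes "i \<in> V"
  shows "real n * (\<rho> * (\<Sum>b<K. \<xi> i m b) + (\<theta> - \<rho>) * \<xi> i m a) = \<xi> i (Suc m) a"
proof -
  have "deg / real K = real n * \<rho> + real n * (\<theta> - \<rho>) / real K"
    using K_real by (simp add: deg_def field_simps)
  then have "deg ^ Suc m / real K = deg ^ m * (real n * \<rho> + real n * (\<theta> - \<rho>) / real K)"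
    by (metis power_Suc2 times_divide_eq_right)
  then show ?thesis
    unfolding sum_\<xi>[OF assms] by (simp add: \<xi>_def diff_divide_distrib algebra_simps)
qed

text \<open>Since ln n \<le> D, the additive \<open>L\<close> is absorbed into D^(m+1). The radicand
  is then at most of order D^(2m+2) ln n / D, which turns every Chernoff term into a relative error
  \<open>\<delta>\<close>.\<close>

lemma sqrt_dev_le:
  assumes "0 \<le> x" "x \<le> q * D ^ Suc m" "0 \<le> q"
  shows "sqrt (L * (L + x)) \<le> 3 * (3 + q) * (\<delta> * D ^ Suc m)"
proof -
  have "L + x \<le> 3 * D ^ Suc m + q * D ^ Suc m"
    using assms(2) D_ge(2) D_power_mono[of 1 "Suc m"] unfolding power_one_right by linarith
  then have "L * (L + x) \<le> (3 * ln (real n)) * ((3 + q) * D ^ Suc m)"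
    using ln1 by (intro mult_left_mono) (auto simp: algebra_simps)
  also have "\<dots> \<le> (3 * (3 + q)) * (ln (real n) * (D ^ m * D ^ Suc m))"
    using D_power_ge1[of m] D_ge ln1 assms by (simp add: algebra_simps mult_left_mono add_mono)
  also have "\<dots> \<le> (3 * (3 + q))\<^sup>2 * (ln (real n) * (D ^ m * D ^ Suc m))"
    using D_ge ln1 assms by (intro mult_right_mono) (auto simp: power2_eq_square)
  also have "\<dots> = (3 * (3 + q) * (sqrt (ln (real n) / D) * D ^ Suc m))\<^sup>2"
  proof -
    have "(sqrt (ln (real n) / D))\<^sup>2 = ln (real n) / D" using D_ge ln1 by (intro real_sqrt_pow2) auto
    then have "(sqrt (ln (real n) / D) * D ^ Suc m)\<^sup>2 = ln (real n) * (D ^ m * D ^ Suc m)"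
      unfolding power_mult_distrib using D_ge by (simp add: power2_eq_square)
    then show ?thesis unfolding power_mult_distrib[of "3 * (3 + q)"] by simp
  qed
  finally have "sqrt (L * (L + x)) \<le> 3 * (3 + q) * (sqrt (ln (real n) / D) * D ^ Suc m)"
    using D_ge ln1 assms by (intro real_le_lsqrt) auto
  also have "\<dots> \<le> 3 * (3 + q) * (\<delta> * D ^ Suc m)"
    using \<delta>_bounds D_ge assms by (intro mult_left_mono mult_right_mono) auto
  finally show ?thesis .
qed

lemma card_layer_Suc:
  assumes "i \<in> V"
  shows "share a (lay i (Suc m)) = real (card {v \<in> comm a - (ner i m \<union> lay i m). hit G (lay i m) v})"
proof -
  have "lay i (Suc m) \<inter> comm a = {v \<in> comm a - (ner i m \<union> lay i m). hit G (lay i m) v}"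
    by (auto simp: layer_Suc nearer_Suc hit_def comm_def)
  then show ?thesis by (simp add: share_def)
qed

end

text \<open>The assumption keeps every share within D^m of its prediction, so that the size bound
  survives the induction.\<close>

locale concentrated_graph = good_graph +
  assumes small: "M k * \<delta> \<le> 1"
begin

text \<open>The last hypothesis is the conclusion of \<open>composition\<close>, whose induction
  needs the size bound at the earlier levels.\<close>

lemma card_layer_le_aux:
  assumes "i \<in> V" "m \<le> k" "\<And>a. a < K \<Longrightarrow> \<bar>share a (lay i m) - \<xi> i m a\<bar> \<le> M m * \<delta> * D ^ m"
  shows "real (card (lay i m)) \<le> Q * D ^ m"
proof -
  have "M m * \<delta> \<le> 1"
    using mult_right_mono[OF M_mono[OF assms(2)] \<delta>_bounds(4)] small by simp
  then have "M m * \<delta> * D ^ m \<le> 1 * D ^ m" using D_ge by (intro mult_right_mono) auto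
  then have "share a (lay i m) \<le> (real K ^ k + 1) * D ^ m" if "a < K" for a
    using assms(3)[OF that] \<xi>_bounds(2)[of i m a] deg_power_le[OF assms(2)] unfolding distrib_right abs_le_iff by linarith
  then have "(\<Sum>a<K. share a (lay i m)) \<le> (\<Sum>a<K. (real K ^ k + 1) * D ^ m)"
    by (intro sum_mono) auto
  then show ?thesis
    using sum_share[OF layer_subset[OF assms(1)], of G m] by (simp add: Q_def mult.assoc)
qed

lemma card_nearer_le_aux:
  assumes "\<And>l. l \<le> m \<Longrightarrow> real (card (lay i l)) \<le> Q * D ^ l"
  shows "real (card (ner i (Suc m))) \<le> real (Suc m) * Q * D ^ m"
proof -
  have "card (ner i (Suc m)) \<le> (\<Sum>l<Suc m. card (lay i l))"
    unfolding nearer_eq_UN by (rule card_UN_le) simp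
  then have "real (card (ner i (Suc m))) \<le> (\<Sum>l<Suc m. real (card (lay i l)))"
    by (simp flip: of_nat_sum)
  also have "\<dots> \<le> (\<Sum>l<Suc m. Q * D ^ m)"
  proof (rule sum_mono)
    fix l assume "l \<in> {..<Suc m}"
    then have "l \<le> m" by simp
    then show "real (card (lay i l)) \<le> Q * D ^ m"
      using assms[of l] mult_left_mono[OF D_power_mono, of l m Q] Q_ge by linarith
  qed
  finally show ?thesis by simp
qed

text \<open>A step adds four errors: \<open>t1\<close> from used vertices, \<open>t2\<close> from
  multiple hits and \<open>t3\<close> from fluctuation, which sum to the constant \<open>J\<close>,
  and \<open>t4\<close>, the earlier error passed through the linear recursion. Strong induction
  supplies the sizes of all earlier layers for \<open>t1\<close>.\<close>

lemma composition:
  assumes i: "i \<in> V"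
  shows "m \<le> k \<Longrightarrow> a < K \<Longrightarrow> \<bar>share a (lay i m) - \<xi> i m a\<bar> \<le> M m * \<delta> * D ^ m"
proof (induction m arbitrary: a rule: less_induct)
  case (less m)
  show ?case
  proof (cases m)
    case 0
    have "share a {i} = of_bool (a = z i)" using i by (auto simp: share_def comm_def)
    then show ?thesis using 0 by (simp add: \<xi>_def M_def)
  next
    case (Suc l)
    have lk: "Suc l \<le> k" using less.prems Suc by simp
    have IH: "\<bar>share b (lay i l') - \<xi> i l' b\<bar> \<le> M l' * \<delta> * D ^ l'" if "l' \<le> l" "b < K" for l' b
      using less.IH[of l' b] that Suc lk by simp
    have card: "real (card (lay i l')) \<le> Q * D ^ l'" if "l' \<le> l" for l'
      by (rule card_layer_le_aux[OF i]) (use that lk IH in auto)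
    define s where "s = real (card (lay i l))"
    define b where "b = real (card (ner i l \<union> lay i l))"
    have s: "0 \<le> s" "s \<le> Q * D ^ l" using card by (auto simp: s_def)
    have b: "0 \<le> b" "b \<le> real k * Q * D ^ l"
    proof -
      have "b \<le> real (Suc l) * Q * D ^ l"
        using card_nearer_le_aux[of l i, OF card] by (simp add: b_def nearer_Suc)
      also have "\<dots> \<le> real k * Q * D ^ l" using lk Q_ge D_ge by (intro mult_right_mono) auto
      finally show "b \<le> real k * Q * D ^ l" .
    qed (simp add: b_def)
    define Z where "Z = \<delta> * D ^ Suc l"
    have \<theta>D: "\<theta> * x * y = x * (D * y) / real n" for x y using n_pos by (simp add: D_def)
    \<comment> \<open>As l < k, the ratio D^(l+1)/n is at most D^k/n, the depletion part of
      \<open>\<delta>\<close>.\<close>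
    have DZ: "D ^ Suc l * D ^ Suc l / real n \<le> Z"
    proof -
      have "D ^ Suc l / real n \<le> \<delta>"
        using order.trans[OF divide_right_mono[OF D_power_mono[OF lk]] \<delta>_bounds(1)] n_pos by simp
      then have "D ^ Suc l / real n * D ^ Suc l \<le> Z" unfolding Z_def using D_ge by (intro mult_right_mono) auto
      then show ?thesis by simp
    qed
    have t1: "\<theta> * s * b \<le> real k * Q\<^sup>2 * Z"
    proof -
      have "\<theta> * s * b \<le> \<theta> * (Q * D ^ l) * (real k * Q * D ^ l)"
      proof (rule mult_mono)
        show "\<theta> * s \<le> \<theta> * (Q * D ^ l)" using s(2) theta_pos by (intro mult_left_mono) auto
        show "0 \<le> \<theta> * (Q * D ^ l)" using Q_ge(1) D_power_ge1[of l] theta_pos by (intro mult_nonneg_nonneg) auto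
      qed (fact b)+
      also have "\<dots> = real k * Q\<^sup>2 * (D ^ l * D ^ Suc l / real n)"
        unfolding \<theta>D by (simp add: power2_eq_square)
      also have "\<dots> \<le> real k * Q\<^sup>2 * (D ^ Suc l * D ^ Suc l / real n)"
        using n_pos D_ge by (intro mult_left_mono divide_right_mono mult_right_mono D_power_mono) auto
      also have "\<dots> \<le> real k * Q\<^sup>2 * Z" using DZ by (intro mult_left_mono) auto
      finally show ?thesis .
    qed
    have t2: "real n * (\<theta> * s)\<^sup>2 \<le> Q\<^sup>2 * Z"
    proof -
      have "real n * (\<theta> * s)\<^sup>2 \<le> real n * (\<theta> * (Q * D ^ l))\<^sup>2"
        using s theta_pos by (intro mult_left_mono power_mono) auto
      also have "\<dots> = Q\<^sup>2 * (D ^ l * D ^ l * (real n * \<theta>\<^sup>2))"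
        by (simp add: power2_eq_square)
      also have "real n * \<theta>\<^sup>2 = D * D / real n" using n_pos by (simp add: D_def power2_eq_square)
      also have "Q\<^sup>2 * (D ^ l * D ^ l * (D * D / real n)) = Q\<^sup>2 * (D ^ Suc l * D ^ Suc l / real n)"
        by simp
      also have "\<dots> \<le> Q\<^sup>2 * Z" using DZ by (intro mult_left_mono) auto
      finally show ?thesis .
    qed
    have t3: "sqrt (L * (L + real n * \<theta> * s)) \<le> 3 * (3 + Q) * Z"
      unfolding Z_def
    proof (rule sqrt_dev_le)
      have "D * s \<le> D * (Q * D ^ l)" using s D_ge by (intro mult_left_mono) auto
      then show "real n * \<theta> * s \<le> Q * D ^ Suc l" by (simp add: D_def mult_ac)
    qed (use s Q_ge theta_pos in auto)
    \<comment> \<open>The recursion multiplies an error by at most n (K \<rho> + \<theta> - \<rho>)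
      \<le> (K + 1) D, whence the base K + 1 in \<open>M\<close>.\<close>
    have t4: "\<bar>real n * pull a (lay i l) - \<xi> i (Suc l) a\<bar> \<le> (real K + 1) * M l * Z"
    proof -
      define e where "e = M l * \<delta> * D ^ l"
      have e: "0 \<le> e" using M_nonneg \<delta>_bounds D_ge by (simp add: e_def)
      have "\<bar>(\<Sum>c<K. share c (lay i l)) - (\<Sum>c<K. \<xi> i l c)\<bar> \<le> (\<Sum>c<K. \<bar>share c (lay i l) - \<xi> i l c\<bar>)"
        unfolding sum_subtractf[symmetric] by (rule sum_abs)
      also have "\<dots> \<le> (\<Sum>c<K. e)" unfolding e_def by (intro sum_mono IH) auto
      finally have A: "\<bar>real (card (lay i l)) - (\<Sum>c<K. \<xi> i l c)\<bar> \<le> real K * e"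
        using sum_share[OF layer_subset[OF i], of G l] by simp
      have B: "\<bar>share a (lay i l) - \<xi> i l a\<bar> \<le> e" unfolding e_def using less.prems by (intro IH) auto
      have "real n * pull a (lay i l) - \<xi> i (Suc l) a =
          real n * (\<rho> * (real (card (lay i l)) - (\<Sum>c<K. \<xi> i l c)) + (\<theta> - \<rho>) * (share a (lay i l) - \<xi> i l a))"
        unfolding \<xi>_Suc[OF i, symmetric] pull_def by (simp add: algebra_simps)
      also have "\<bar>\<dots>\<bar> \<le> real n * (\<rho> * (real K * e) + (\<theta> - \<rho>) * e)"
        unfolding abs_mult[of "real n"]
        using A B rho_pos rho_less
        by (intro mult_mono order.trans[OF abs_triangle_ineq] add_mono) (auto simp: abs_mult)
      also have "\<dots> \<le> real n * (\<theta> * (real K * e) + \<theta> * e)"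
        using e rho_pos rho_less by (intro mult_left_mono add_mono mult_right_mono) auto
      also have "\<dots> = (real K + 1) * M l * Z"
        by (simp add: e_def Z_def D_def algebra_simps)
      finally show ?thesis .
    qed
    have "\<not> composition_dev L a (ner i l) (lay i l) G"
      using good i less.prems lk unfolding good_def by (auto simp: Suc_le_eq)
    then have "\<bar>share a (lay i (Suc l)) - real n * pull a (lay i l)\<bar>
        \<le> \<theta> * s * b + real n * (\<theta> * s)\<^sup>2 + 2 * sqrt (L * (L + real n * \<theta> * s))"
      unfolding composition_dev_def card_layer_Suc[OF i] s_def b_def by linarith
    then have "\<bar>share a (lay i (Suc l)) - \<xi> i (Suc l) a\<bar> \<le>
        real k * Q\<^sup>2 * Z + Q\<^sup>2 * Z + 2 * (3 * (3 + Q) * Z) + (real K + 1) * M l * Z"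
      using t1 t2 t3 t4 by linarith
    also have "\<dots> = ((real K + 1) * M l + J) * Z" by (simp add: J_def algebra_simps)
    also have "\<dots> \<le> M (Suc l) * Z"
      using M_Suc \<delta>_bounds D_ge by (intro mult_right_mono) (auto simp: Z_def)
    finally show ?thesis using Suc by (simp add: Z_def mult.assoc)
  qed
qed

lemma card_layer_le: "i \<in> V \<Longrightarrow> m \<le> k \<Longrightarrow> real (card (lay i m)) \<le> Q * D ^ m"
  by (rule card_layer_le_aux) (auto intro: composition)

lemma card_nearer_Suc_le: "i \<in> V \<Longrightarrow> m < k \<Longrightarrow> real (card (ner i (Suc m))) \<le> real k * Q * D ^ m"
proof -
  assume i: "i \<in> V" and m: "m < k"
  have "real (card (ner i (Suc m))) \<le> real (Suc m) * Q * D ^ m"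
    by (rule card_nearer_le_aux) (use i m in \<open>auto intro: card_layer_le\<close>)
  also have "\<dots> \<le> real k * Q * D ^ m" using m Q_ge D_ge by (intro mult_right_mono) auto
  finally show ?thesis .
qed

end

section \<open>Overlaps of layers around two vertices\<close>

context sbm_graph
begin

lemma edges_nonneg: "0 \<le> edges G A B"
  unfolding edges_def by (intro sum_nonneg) auto

lemma edges_mono:
  assumes "A \<subseteq> A'" "B \<subseteq> B'" "finite A'" "finite B'"
  shows "edges G A B \<le> edges G A' B'"
proof -
  have "edges G A B \<le> (\<Sum>u\<in>A. \<Sum>v\<in>B'. of_bool (G {u, v}))"
    unfolding edges_def using assms by (intro sum_mono sum_mono2) auto
  also have "\<dots> \<le> edges G A' B'"
    unfolding edges_def using assms by (intro sum_mono2) (auto intro: sum_nonneg)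
  finally show ?thesis .
qed

lemma edges_commute: "edges G A B = edges G B A"
  unfolding edges_def by (subst sum.swap) (simp add: insert_commute)

lemma edges_Un_disjoint:
  assumes "finite A" "finite A'" "A \<inter> A' = {}"
  shows "edges G (A \<union> A') B = edges G A B + edges G A' B"
  unfolding edges_def by (rule sum.union_disjoint[OF assms])

lemma edges_Un_le:
  assumes "finite A" "finite A'"
  shows "edges G (A \<union> A') B \<le> edges G A B + edges G A' B"
proof -
  have "edges G (A \<union> A') B = edges G A B + edges G (A' - A) B"
    using edges_Un_disjoint[of A "A' - A" G B] assms by simp
  also have "edges G (A' - A) B \<le> edges G A' B"
    unfolding edges_def using assms by (intro sum_mono2) (auto intro: sum_nonneg)
  finally show ?thesis by simp
qed

lemma edges_eq_0: "(\<And>u v. u \<in> A \<Longrightarrow> v \<in> B \<Longrightarrow> \<not> G {u, v}) \<Longrightarrow> edges G A B = 0"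
  by (simp add: edges_def)

end

context good_graph
begin

lemma no_loop: "\<not> G {u, u}"
  using good by (auto simp: good_def E_def)

lemma boundary:
  assumes "i \<in> V" "m < k"
  shows "edges G (lay i m) (V - ner i (Suc m)) \<le>
    deg * real (card (lay i m)) + 4 * sqrt (L * (L + \<theta> * real (card (lay i m)) * real (n * K)))"
  using good assms unfolding good_def boundary_dev_def nearer_Suc by (auto simp: not_less)

lemma pair_concentration:
  assumes "i \<in> V" "j \<in> V" "m \<le> k"
  shows "\<bar>edges G (lay i m - ner j m) (lay j m - ner i m) - mean_edges (lay i m - ner j m) (lay j m - ner i m)\<bar>
    \<le> 4 * sqrt (L * (L + \<theta> * real (card (lay i m - ner j m)) * real (card (lay j m - ner i m))))"
  using good assms unfolding good_def pair_dev_def by (auto simp: not_less)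

lemma layer_finite: "i \<in> V \<Longrightarrow> finite (lay i m)" and nearer_finite: "i \<in> V \<Longrightarrow> finite (ner i m)"
  using layer_subset[of i V G m] nearer_subset[of i V G m] by (auto intro: finite_V_subset)

end

context concentrated_graph
begin

lemma \<delta>_le_1: "\<delta> \<le> 1"
proof -
  have "1 \<le> J" unfolding J_def using Q_ge(1) by (smt (verit) mult_nonneg_nonneg of_nat_0_le_iff zero_le_power2)
  moreover have "1 \<le> real k * (real K + 1) ^ k"
    using k2 mult_mono[of 1 "real k" 1 "(real K + 1) ^ k"] by simp
  ultimately have "1 * 1 \<le> J * (real k * (real K + 1) ^ k)" by (intro mult_mono) auto
  then have "1 * \<delta> \<le> M k * \<delta>" using \<delta>_bounds(4) by (intro mult_right_mono) (auto simp: M_def mult.assoc)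
  then show ?thesis using small by simp
qed

text \<open>Bound for the maximal degree in units of D: K from the mean and 12 (3 + K) from the
  Chernoff term with \<open>\<delta> \<le> 1\<close>.\<close>

definition H :: real where "H = 13 * real K + 36"

lemma degree_le:
  assumes "u \<in> V"
  shows "real (card {v \<in> V. G {u, v}}) \<le> H * D"
proof -
  have "real (card {v \<in> V. G {u, v}}) = edges G {u} (V - ner u (Suc 0))"
  proof -
    have "{v \<in> V - {u}. G {u, v}} = {v \<in> V. G {u, v}}" using no_loop[of u] by auto
    moreover have "edges G {u} (V - {u}) = real (card {v \<in> V - {u}. G {u, v}})"
      unfolding edges_def using sum_of_bool_card[of "V - {u}" "\<lambda>v. G {u, v}"] by simp
    moreover have "ner u (Suc 0) = {u}" by (simp add: nearer_Suc)
    ultimately show ?thesis by (simp only:)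
  qed
  also have "\<dots> \<le> deg * 1 + 4 * sqrt (L * (L + \<theta> * real (n * K)))"
    using boundary[OF assms, of 0] k2 by simp
  also have "sqrt (L * (L + \<theta> * real (n * K))) \<le> 3 * (3 + real K) * (\<delta> * D ^ Suc 0)"
    using theta_pos by (intro sqrt_dev_le) (auto simp: D_def)
  also have "3 * (3 + real K) * (\<delta> * D ^ Suc 0) \<le> 3 * (3 + real K) * (1 * D)"
    using \<delta>_le_1 D_ge by (intro mult_left_mono) auto
  finally have "real (card {v \<in> V. G {u, v}}) \<le> deg + 4 * (3 * (3 + real K) * (1 * D))" by simp
  also have "\<dots> \<le> real K * D + 4 * (3 * (3 + real K) * (1 * D))" using deg_bounds by simp
  also have "\<dots> = H * D" by (simp add: H_def algebra_simps)
  finally show ?thesis .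
qed

lemma edges_le_degree:
  assumes "A \<subseteq> V" "B \<subseteq> V"
  shows "edges G A B \<le> real (card A) * (H * D)"
proof -
  have "(\<Sum>v\<in>B. of_bool (G {u, v}) :: real) \<le> H * D" if "u \<in> A" for u
  proof -
    have "(\<Sum>v\<in>B. of_bool (G {u, v}) :: real) \<le> (\<Sum>v\<in>V. of_bool (G {u, v}))"
      using assms by (intro sum_mono2) auto
    also have "\<dots> = real (card {v \<in> V. G {u, v}})" by (rule sum_of_bool_card) simp
    also have "\<dots> \<le> H * D" using that assms by (intro degree_le) auto
    finally show ?thesis .
  qed
  then show ?thesis unfolding edges_def by (rule sum_bounded_above)
qed

text \<open>A common vertex of two layers is a neighbour of a common vertex of the preceding layers, or it
  has two different predecessors, one in each of them, through edges that are both still fresh.\<close>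

lemma overlap_Suc:
  assumes i: "i \<in> V" and j: "j \<in> V" and ab: "a < k" "b < k"
  shows "real (card (lay i (Suc a) \<inter> lay j (Suc b))) \<le>
    H * D * real (card (lay i a \<inter> lay j b)) + 4 * real K * Q\<^sup>2 * (D ^ Suc a * D ^ Suc b / real n) + 12 * ln (real n)"
proof -
  define U where "U = (\<Union>u\<in>lay i a \<inter> lay j b. {v \<in> V. G {u, v}})"
  define W where "W = {v \<in> V - (ner i a \<union> lay i a \<union> ner j b \<union> lay j b).
     hit G (lay i a - (ner j b \<union> lay j b)) v \<and> hit G (lay j b - (ner i a \<union> lay i a)) v}"
  have "lay i (Suc a) \<inter> lay j (Suc b) \<subseteq> U \<union> W"
  proof
    fix v assume v: "v \<in> lay i (Suc a) \<inter> lay j (Suc b)"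
    then have vV: "v \<in> V" "v \<notin> ner i (Suc a)" "v \<notin> ner j (Suc b)" by (auto simp: layer_Suc)
    obtain u w where u: "u \<in> lay i a" "G {u, v}" and w: "w \<in> lay j b" "G {w, v}"
      using v by (auto simp: layer_Suc)
    \<comment> \<open>A predecessor of \<open>v\<close> strictly nearer to the other root would pull
      \<open>v\<close> itself below its layer there.\<close>
    have "u \<notin> ner j b" "w \<notin> ner i a"
      using nearer_neighbour[of u G V j b v] nearer_neighbour[of w G V i a v] u w vV by auto
    then show "v \<in> U \<union> W"
      using u w vV by (auto simp: U_def W_def hit_def nearer_Suc)
  qed
  moreover have fin: "finite (U \<union> W)" by (rule finite_V_subset) (auto simp: U_def W_def)
  ultimately have "card (lay i (Suc a) \<inter> lay j (Suc b)) \<le> card U + card W"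
    using card_mono card_Un_le order.trans by metis
  moreover have "real (card U) \<le> H * D * real (card (lay i a \<inter> lay j b))"
  proof -
    have fin: "finite (lay i a \<inter> lay j b)" using layer_finite[OF i] by simp
    have "card U \<le> (\<Sum>u\<in>lay i a \<inter> lay j b. card {v \<in> V. G {u, v}})"
      unfolding U_def by (rule card_UN_le[OF fin])
    then have "real (card U) \<le> (\<Sum>u\<in>lay i a \<inter> lay j b. real (card {v \<in> V. G {u, v}}))"
      by (simp flip: of_nat_sum)
    also have "\<dots> \<le> real (card (lay i a \<inter> lay j b)) * (H * D)"
      using layer_subset[OF i] by (intro sum_bounded_above degree_le) auto
    finally show ?thesis by (simp add: mult_ac)
  qed
  moreover have "real (card W) \<le> 4 * real K * Q\<^sup>2 * (D ^ Suc a * D ^ Suc b / real n) + 12 * ln (real n)"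
  proof -
    have "\<not> collision_dev L (ner i a) (lay i a) (ner j b) (lay j b) G"
      using good i j ab by (auto simp: good_def)
    then have "real (card W) \<le> 4 * (real (n * K) * \<theta>\<^sup>2 * real (card (lay i a)) * real (card (lay j b)) + L)"
      unfolding collision_dev_def W_def by (simp only: not_less)
    also have "real (n * K) * \<theta>\<^sup>2 * real (card (lay i a)) * real (card (lay j b)) \<le>
        real (n * K) * \<theta>\<^sup>2 * (Q * D ^ a) * (Q * D ^ b)"
      using i j ab by (intro mult_mono mult_left_mono card_layer_le) (use Q_ge D_ge in auto)
    also have "\<dots> = real K * Q\<^sup>2 * (D ^ Suc a * D ^ Suc b / real n)"
    proof -
      have *: "real n * \<theta>\<^sup>2 = D * D / real n" using n_pos by (simp add: D_def power2_eq_square)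
      have "real (n * K) * \<theta>\<^sup>2 * (Q * D ^ a) * (Q * D ^ b) = real K * Q\<^sup>2 * (D ^ a * D ^ b) * (real n * \<theta>\<^sup>2)"
        by (simp add: power2_eq_square mult_ac)
      then show ?thesis unfolding * by (simp add: mult_ac)
    qed
    finally show ?thesis by simp
  qed
  ultimately show ?thesis by linarith
qed

definition collision_const :: real where "collision_const = 4 * real K * Q\<^sup>2 + 12"
text \<open>Dominates the overlap recursion: each level multiplies an overlap by the degree bound
  \<open>H\<close> and adds new collisions.\<close>

definition overlap_const :: "nat \<Rightarrow> real" where "overlap_const a = collision_const * real a * (H + 1) ^ a"

lemma overlap_const_Suc: "H * overlap_const a + collision_const \<le> overlap_const (Suc a)" and overlap_const_nonneg: "0 \<le> overlap_const a" and collision_const_nonneg: "0 \<le> collision_const"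
  and H_ge_1: "1 \<le> H"
proof -
  show H: "1 \<le> H" by (simp add: H_def)
  show B: "0 \<le> collision_const" by (simp add: collision_const_def)
  show P: "0 \<le> overlap_const a" using B H by (simp add: overlap_const_def)
  have "collision_const * 1 \<le> collision_const * (H + 1) ^ Suc a" using B H by (intro mult_left_mono one_le_power) auto
  moreover have "0 \<le> collision_const * real a * (H + 1) ^ a" using P by (simp add: overlap_const_def)
  ultimately show "H * overlap_const a + collision_const \<le> overlap_const (Suc a)" by (simp add: overlap_const_def algebra_simps)
qed

text \<open>The shift \<open>c\<close> is 0 for distinct roots and 1 for distinct non-adjacent ones;
  \<open>base\<close> says that there is no overlap at the start. The factor D on the left avoids
  the exponent a - 1 in the logarithmic term.\<close>

lemma overlap_le:
  assumes i: "i \<in> V" and j: "j \<in> V" and base: "lay i 0 \<inter> lay j c = {}"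
  shows "a + c \<le> k \<Longrightarrow> D * real (card (lay i a \<inter> lay j (a + c))) \<le>
    overlap_const a * (D ^ (2 * a + c + 1) / real n + D ^ a * ln (real n))"
proof (induction a)
  case 0
  show ?case using base by (simp add: overlap_const_def)
next
  case (Suc a)
  define x where "x = D ^ (2 * a + c + 1) / real n"
  define y where "y = D ^ a * ln (real n)"
  have xy: "0 \<le> x" "0 \<le> y" "0 \<le> D" "1 \<le> D" using D_ge ln1 n_pos by (auto simp: x_def y_def)
  have x': "D ^ (2 * Suc a + c + 1) / real n = D * D * x" and y': "D ^ Suc a * ln (real n) = D * y"
    by (simp_all add: x_def y_def)
  have lny: "ln (real n) \<le> y" unfolding y_def using D_power_ge1[of a] ln1 by (simp add: mult_le_cancel_right1)
  have IH: "D * real (card (lay i a \<inter> lay j (a + c))) \<le> overlap_const a * (x + y)"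
    using Suc by (simp add: x_def y_def)
  have "D * real (card (lay i (Suc a) \<inter> lay j (Suc (a + c)))) \<le>
    D * (H * D * real (card (lay i a \<inter> lay j (a + c))) + 4 * real K * Q\<^sup>2 * (D ^ Suc a * D ^ Suc (a + c) / real n) + 12 * ln (real n))"
    using Suc.prems xy by (intro mult_left_mono overlap_Suc i j) auto
  also have "\<dots> = H * D * (D * real (card (lay i a \<inter> lay j (a + c)))) + 4 * real K * Q\<^sup>2 * (D * (D ^ Suc a * D ^ Suc (a + c) / real n)) + 12 * (D * ln (real n))"
    by (simp add: algebra_simps)
  also have "D * (D ^ Suc a * D ^ Suc (a + c) / real n) = D * D * x"
  proof -
    have "D * (D ^ Suc a * D ^ Suc (a + c)) = D ^ (1 + Suc a + Suc (a + c))" by (simp add: power_add)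
    also have "1 + Suc a + Suc (a + c) = 2 + (2 * a + c + 1)" by simp
    also have "D ^ \<dots> = D * D * D ^ (2 * a + c + 1)" by (simp only: power_add power2_eq_square)
    finally show ?thesis unfolding x_def by (simp only: times_divide_eq_right)
  qed
  also have "H * D * (D * real (card (lay i a \<inter> lay j (a + c)))) \<le> H * D * (overlap_const a * (x + y))"
    using IH H_ge_1 xy by (intro mult_left_mono) auto
  also have "H * D * (overlap_const a * (x + y)) + 4 * real K * Q\<^sup>2 * (D * D * x) + 12 * (D * ln (real n))
      \<le> (H * overlap_const a + collision_const) * (D * D * x + D * y)"
  proof -
    have Dx: "D * x \<le> D * D * x" "0 \<le> D * D * x" "0 \<le> D * y" "D * ln (real n) \<le> D * y"
      using xy lny mult_right_mono[of 1 D "D * x"] by (auto intro!: mult_left_mono)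
    have "H * overlap_const a * (D * (x + y)) \<le> H * overlap_const a * (D * D * x + D * y)"
      using Dx H_ge_1 overlap_const_nonneg[of a] by (intro mult_left_mono) (auto simp: algebra_simps)
    moreover have "0 \<le> 4 * real K * Q\<^sup>2 * (D * y)" using xy by (intro mult_nonneg_nonneg) auto
    then have "4 * real K * Q\<^sup>2 * (D * D * x) + 12 * (D * ln (real n)) \<le> collision_const * (D * D * x + D * y)"
      using Dx unfolding collision_const_def distrib_left distrib_right by linarith
    ultimately show ?thesis by (simp add: algebra_simps)
  qed
  also have "\<dots> \<le> overlap_const (Suc a) * (D * D * x + D * y)"
    using xy by (intro mult_right_mono overlap_const_Suc) auto
  finally show ?case unfolding x' y' by simp
qed

lemma ln_over_D: "ln (real n) / D \<le> \<delta>"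
proof -
  have "(ln (real n) / D)\<^sup>2 \<le> ln (real n) / D"
    using D_ge ln1 unfolding power2_eq_square by (intro mult_left_le) auto
  then have "ln (real n) / D \<le> sqrt (ln (real n) / D)" by (rule real_le_rsqrt)
  then show ?thesis using \<delta>_bounds(2) by simp
qed

text \<open>Accidental overlaps carry few edges: by the degree bound their number is smaller than
  the order D^k of a layer by a factor \<open>\<delta>\<close>.\<close>

lemma edges_overlap_le:
  assumes i: "i \<in> V" and j: "j \<in> V" and base: "lay i 0 \<inter> lay j c = {}" and c: "c \<le> 1"
    and B: "B \<subseteq> V" and kk: "k = Suc l"
  shows "edges G (lay i l \<inter> lay j (l + c)) B \<le> H * overlap_const k * (\<delta> * D ^ k)"
proof -
  have "edges G (lay i l \<inter> lay j (l + c)) B \<le> H * (D * real (card (lay i l \<inter> lay j (l + c))))"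
    using edges_le_degree[OF _ B, of "lay i l \<inter> lay j (l + c)"] layer_subset[OF i, of G l] by (auto simp: mult_ac)
  also have "\<dots> \<le> H * (overlap_const l * (D ^ (2 * l + c + 1) / real n + D ^ l * ln (real n)))"
    using overlap_le[OF i j base, of l] c kk H_ge_1 by (intro mult_left_mono) auto
  also have "\<dots> \<le> H * (overlap_const k * (\<delta> * D ^ k))"
  proof (intro mult_left_mono mult_mono)
    have "overlap_const l \<le> H * overlap_const l + collision_const" using mult_right_mono[OF H_ge_1 overlap_const_nonneg[of l]] collision_const_nonneg by simp
    then show "overlap_const l \<le> overlap_const k" using overlap_const_Suc[of l] kk by simp
    \<comment> \<open>The exponent is 2 k - 1 + c, so this is where \<open>c \<le> 1\<close>
      enters.\<close>
    have "D ^ (2 * l + c + 1) / real n \<le> D ^ (k + k) / real n"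
      using c kk n_pos by (intro divide_right_mono D_power_mono) auto
    then have 1: "D ^ (2 * l + c + 1) / real n \<le> D ^ k / real n * D ^ k" by (simp add: power_add)
    have 2: "D ^ l * ln (real n) = sqrt (ln (real n) / D) * sqrt (ln (real n) / D) * D ^ k"
      using D_ge ln1 kk by simp
    have "sqrt (ln (real n) / D) * sqrt (ln (real n) / D) \<le> sqrt (ln (real n) / D) * 1"
      using D_ge ln1 by (intro mult_left_mono) auto
    then have "D ^ l * ln (real n) \<le> sqrt (ln (real n) / D) * D ^ k"
      unfolding 2 using D_ge by (intro mult_right_mono) auto
    with 1 show "D ^ (2 * l + c + 1) / real n + D ^ l * ln (real n) \<le> \<delta> * D ^ k"
      unfolding \<delta>_def distrib_right by linarith
  qed (use H_ge_1 overlap_const_nonneg D_ge ln1 n_pos in auto)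
  finally show ?thesis by simp
qed

section \<open>Fresh and already revealed edges between two layers\<close>

definition fresh :: "nat \<Rightarrow> nat \<Rightarrow> nat \<Rightarrow> real" where
  "fresh i j m = edges G (lay i m - ner j m) (lay j m - ner i m)"

text \<open>The order of magnitude of the number of vertex pairs between two layers of depth
  k.\<close>

definition T :: real where "T = D ^ k * D ^ k"

lemma T_pos: "0 < T"
  using D_ge by (simp add: T_def)

text \<open>Vertices strictly inside layer l of \<open>j\<close> have no edge to layer l + 1 of
  \<open>j\<close>, so removing layer l alone discards the same edges as removing the whole
  interior.\<close>

lemma edges_split_left:
  assumes i: "i \<in> V" and j: "j \<in> V" and B: "B \<subseteq> lay j (Suc l)"
  shows "edges G (lay i (Suc l)) B =
    edges G (lay i (Suc l) - ner j (Suc l)) B + edges G (lay i (Suc l) \<inter> lay j l) B"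
    and "edges G (lay i (Suc l) - lay j l) B = edges G (lay i (Suc l) - ner j (Suc l)) B"
proof -
  let ?A = "lay i (Suc l)"
  have fin: "finite ?A" by (rule layer_finite[OF i])
  have 0: "edges G (?A \<inter> ner j l) B = 0"
    using B nearer_layer_no_edge[of _ G V j l] j by (intro edges_eq_0) blast
  have "?A - lay j l = (?A - ner j (Suc l)) \<union> (?A \<inter> ner j l)"
    using nearer_Int_layer[of G V j l] by (auto simp: nearer_Suc)
  then show *: "edges G (?A - lay j l) B = edges G (?A - ner j (Suc l)) B"
    using edges_Un_disjoint[of "?A - ner j (Suc l)" "?A \<inter> ner j l" G B] fin 0 by (auto simp: nearer_Suc)
  have "?A = (?A - lay j l) \<union> (?A \<inter> lay j l)" by auto
  then show "edges G ?A B = edges G (?A - ner j (Suc l)) B + edges G (?A \<inter> lay j l) B"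
    using edges_Un_disjoint[of "?A - lay j l" "?A \<inter> lay j l" G B] fin * by auto
qed

text \<open>Inclusion-exclusion; the two middle terms are the revealed edges, with an endpoint in
  layer l of the other root.\<close>

lemma edges_layers:
  assumes i: "i \<in> V" and j: "j \<in> V"
  shows "edges G (lay i (Suc l)) (lay j (Suc l)) = fresh i j (Suc l)
    + edges G (lay i (Suc l) \<inter> lay j l) (lay j (Suc l))
    + edges G (lay i (Suc l)) (lay j (Suc l) \<inter> lay i l)
    - edges G (lay i (Suc l) \<inter> lay j l) (lay j (Suc l) \<inter> lay i l)"
proof -
  let ?A = "lay i (Suc l)" and ?B = "lay j (Suc l)"
  have "edges G ?A ?B = edges G (?A - ner j (Suc l)) ?B + edges G (?A \<inter> lay j l) ?B"
    by (rule edges_split_left[OF i j]) simp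
  moreover have "edges G ?A (?B \<inter> lay i l) =
      edges G (?A - ner j (Suc l)) (?B \<inter> lay i l) + edges G (?A \<inter> lay j l) (?B \<inter> lay i l)"
    by (rule edges_split_left[OF i j]) simp
  moreover have "edges G ?B (?A - ner j (Suc l)) =
      edges G (?B - ner i (Suc l)) (?A - ner j (Suc l)) + edges G (?B \<inter> lay i l) (?A - ner j (Suc l))"
    by (rule edges_split_left[OF j i]) auto
  ultimately show ?thesis
    unfolding fresh_def edges_commute[of G ?B] edges_commute[of G "?B - ner i (Suc l)"]
      edges_commute[of G "?B \<inter> lay i l"] by linarith
qed

text \<open>Why \<open>AWCD_plus\<close> has no bias: deleting the single sphere of radius k - 1
  already deletes every revealed edge.\<close>

lemma edges_layers_minus:
  assumes i: "i \<in> V" and j: "j \<in> V"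
  shows "edges G (lay i (Suc l) - lay j l) (lay j (Suc l) - lay i l) = fresh i j (Suc l)"
proof -
  let ?A = "lay i (Suc l)" and ?B = "lay j (Suc l)"
  have "edges G (?A - lay j l) (?B - lay i l) = edges G (?A - ner j (Suc l)) (?B - lay i l)"
    by (rule edges_split_left(2)[OF i j]) auto
  also have "\<dots> = edges G (?B - lay i l) (?A - ner j (Suc l))" by (rule edges_commute)
  also have "\<dots> = edges G (?B - ner i (Suc l)) (?A - ner j (Suc l))"
    by (rule edges_split_left(2)[OF j i]) auto
  finally show ?thesis by (simp only: fresh_def edges_commute[of G "?B - ner i (Suc l)"])
qed

text \<open>An upper bound for the revealed edges seen from one root; it is close to the size of
  layer k, since few vertices there have several parents.\<close>

definition out_edges :: "nat \<Rightarrow> real" where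
  "out_edges i = edges G (lay i (k - 1)) (V - ner i k)"

lemma k_Suc: "k = Suc (k - 1)" "k - 1 = Suc (k - 2)"
  using k2 by auto

lemma D_power_k: "D ^ k = D * D ^ (k - 1)"
  by (subst k_Suc(1)) simp

lemma out_edges_le: "i \<in> V \<Longrightarrow> out_edges i \<le> deg * real (card (lay i (k - 1))) + 12 * (3 + real K * Q) * (\<delta> * D ^ k)"
proof -
  assume i: "i \<in> V"
  have "out_edges i \<le> deg * real (card (lay i (k - 1))) + 4 * sqrt (L * (L + \<theta> * real (card (lay i (k - 1))) * real (n * K)))"
    using boundary[OF i, of "k - 1"] k_Suc unfolding out_edges_def by (metis lessI)
  also have "sqrt (L * (L + \<theta> * real (card (lay i (k - 1))) * real (n * K)))
      \<le> 3 * (3 + real K * Q) * (\<delta> * D ^ Suc (k - 1))"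
  proof (rule sqrt_dev_le)
    have "real K * D * real (card (lay i (k - 1))) \<le> real K * D * (Q * D ^ (k - 1))"
      using i D_ge by (intro mult_left_mono card_layer_le) auto
    then show "\<theta> * real (card (lay i (k - 1))) * real (n * K) \<le> real K * Q * D ^ Suc (k - 1)"
      by (simp add: D_def mult_ac)
  qed (use theta_pos Q_ge in auto)
  finally show ?thesis unfolding k_Suc(1)[symmetric] by (simp add: algebra_simps)
qed

definition circ_const :: real where "circ_const = real K * Q + 12 * (3 + real K * Q)"

lemma out_edges_le_power: "i \<in> V \<Longrightarrow> out_edges i \<le> circ_const * D ^ k"
proof -
  assume i: "i \<in> V"
  have "deg * real (card (lay i (k - 1))) \<le> (real K * D) * (Q * D ^ (k - 1))"
    using i D_ge deg_bounds by (intro mult_mono card_layer_le) auto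
  also have "\<dots> = real K * Q * D ^ k" by (simp add: D_power_k)
  finally have "deg * real (card (lay i (k - 1))) \<le> real K * Q * D ^ k" .
  moreover have "12 * (3 + real K * Q) * (\<delta> * D ^ k) \<le> 12 * (3 + real K * Q) * (1 * D ^ k)"
    using \<delta>_le_1 D_ge Q_ge by (intro mult_left_mono mult_right_mono) auto
  ultimately show ?thesis using out_edges_le[OF i] unfolding circ_const_def distrib_right mult_1 by linarith
qed

lemma card_layer_dev: "i \<in> V \<Longrightarrow> m \<le> k \<Longrightarrow> \<bar>real (card (lay i m)) - deg ^ m\<bar> \<le> real K * M k * (\<delta> * D ^ m)"
proof -
  assume i: "i \<in> V" and m: "m \<le> k"
  have "\<bar>(\<Sum>a<K. share a (lay i m)) - (\<Sum>a<K. \<xi> i m a)\<bar> \<le> (\<Sum>a<K. \<bar>share a (lay i m) - \<xi> i m a\<bar>)"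
    unfolding sum_subtractf[symmetric] by (rule sum_abs)
  also have "\<dots> \<le> (\<Sum>a<K. M k * (\<delta> * D ^ m))"
  proof (rule sum_mono)
    fix a assume "a \<in> {..<K}"
    then have "\<bar>share a (lay i m) - \<xi> i m a\<bar> \<le> M m * \<delta> * D ^ m" using composition[OF i m] by simp
    also have "\<dots> \<le> M k * \<delta> * D ^ m"
      using M_mono[OF m] \<delta>_bounds D_ge by (intro mult_right_mono) auto
    finally show "\<bar>share a (lay i m) - \<xi> i m a\<bar> \<le> M k * (\<delta> * D ^ m)" by (simp add: mult.assoc)
  qed
  finally show ?thesis using sum_share[OF layer_subset[OF i], of G m] sum_\<xi>[OF i, of m] by simp
qed

definition parents_const :: real where "parents_const = real K * real K * M k + real K * M k + 12 * (3 + real K * Q)"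

text \<open>Both sides are compared with deg^k. As every vertex of layer k has a parent, the small
  excess means that almost all have only one.\<close>

lemma out_edges_le_card: "i \<in> V \<Longrightarrow> out_edges i \<le> real (card (lay i k)) + parents_const * (\<delta> * D ^ k)"
proof -
  assume i: "i \<in> V"
  have "real (card (lay i (k - 1))) \<le> deg ^ (k - 1) + real K * M k * (\<delta> * D ^ (k - 1))"
    using card_layer_dev[OF i, of "k - 1"] by (auto simp: abs_le_iff)
  then have "deg * real (card (lay i (k - 1))) \<le> deg * (deg ^ (k - 1) + real K * M k * (\<delta> * D ^ (k - 1)))"
    using deg_bounds D_ge by (intro mult_left_mono) auto
  also have "\<dots> = deg ^ k + deg * (real K * M k * (\<delta> * D ^ (k - 1)))"
    by (subst (4) k_Suc(1)) (simp add: distrib_left)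
  also have "deg * (real K * M k * (\<delta> * D ^ (k - 1))) \<le> (real K * D) * (real K * M k * (\<delta> * D ^ (k - 1)))"
    using deg_bounds M_nonneg \<delta>_bounds D_ge by (intro mult_right_mono) auto
  also have "\<dots> = real K * real K * M k * (\<delta> * D ^ k)" by (simp add: D_power_k)
  finally show ?thesis
    using out_edges_le[OF i] card_layer_dev[OF i order_refl] unfolding parents_const_def distrib_right abs_le_iff by linarith
qed

lemma card_layer_le_edges: "i \<in> V \<Longrightarrow> real (card (lay i k)) \<le> edges G (lay i (k - 1)) (lay i k)"
proof -
  assume i: "i \<in> V"
  have fin: "finite (lay i (k - 1))" by (rule layer_finite[OF i])
  have "(\<Sum>v\<in>lay i k. 1 :: real) \<le> (\<Sum>v\<in>lay i k. \<Sum>u\<in>lay i (k - 1). of_bool (G {v, u}))"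
  proof (rule sum_mono)
    fix v assume "v \<in> lay i k"
    then have "v \<in> lay i (Suc (k - 1))" unfolding k_Suc(1)[symmetric] .
    then obtain u where u: "u \<in> lay i (k - 1)" "G {u, v}" by (auto simp: layer_Suc)
    then have "(\<Sum>w\<in>{u}. of_bool (G {v, w}) :: real) \<le> (\<Sum>u\<in>lay i (k - 1). of_bool (G {v, u}))"
      using fin by (intro sum_mono2) auto
    then show "1 \<le> (\<Sum>u\<in>lay i (k - 1). of_bool (G {v, u}) :: real)"
      using u by (simp add: insert_commute)
  qed
  then show ?thesis unfolding edges_commute[of G "lay i (k - 1)"] by (simp add: edges_def)
qed

lemma layer_k_subset: "i \<in> V \<Longrightarrow> lay i k \<subseteq> V - ner i k"
  using layer_subset[of i V G k] nearer_Int_layer[of G V i k] by auto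

lemma edges_parents_le_out_edges:
  assumes "j \<in> V" "A \<subseteq> lay j (k - 1)" "B \<subseteq> lay j k"
  shows "edges G A B \<le> out_edges j"
  unfolding out_edges_def using assms layer_k_subset[of j] layer_finite[of j "k - 1"] by (intro edges_mono) auto

text \<open>Revealed edges join layers k - 1 and k of one root, so they are among its outgoing
  edges. By \<open>adjacent_half\<close> the order D^k is genuine for adjacent roots once
  \<open>\<delta>\<close> is small.\<close>

lemma circ_remainder:
  assumes i: "i \<in> V" and j: "j \<in> V"
  shows "\<bar>edges G (lay i k) (lay j k) - fresh i j k\<bar> \<le> 2 * circ_const * D ^ k"
proof -
  let ?l = "k - 1"
  define P where "P = lay i k \<inter> lay j ?l"
  define R where "R = lay j k \<inter> lay i ?l"
  have eq: "edges G (lay i k) (lay j k) = fresh i j k + edges G P (lay j k) + edges G (lay i k) R - edges G P R"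
    using edges_layers[OF i j, of ?l] k_Suc(1) unfolding P_def R_def by simp
  have 1: "edges G P (lay j k) \<le> circ_const * D ^ k"
    using edges_parents_le_out_edges[OF j, of P "lay j k"] out_edges_le_power[OF j] by (auto simp: P_def)
  have 2: "edges G (lay i k) R \<le> circ_const * D ^ k"
    using edges_parents_le_out_edges[OF i, of R "lay i k"] out_edges_le_power[OF i] edges_commute[of G R] by (auto simp: R_def)
  have 3: "edges G P R \<le> edges G P (lay j k)"
    using layer_finite[OF i] layer_finite[OF j] by (intro edges_mono) (auto simp: P_def R_def)
  show ?thesis using eq 1 2 3 edges_nonneg[of G P R] edges_nonneg[of G "lay i k" R] by linarith
qed

text \<open>The summands account for multiple parents, for overlaps of equal layers and for the
  inner ball in \<open>adjacent_half\<close>.\<close>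

definition adjacent_const :: real where "adjacent_const = parents_const + H * overlap_const k + H * real k * Q"

lemma neighbour_layers:
  assumes "i \<in> V" "G {i, j}"
  shows "lay j m \<subseteq> ner i (Suc (Suc m))"
proof (induction m)
  case 0
  have "j \<in> ner i (Suc (Suc 0))"
  proof -
    have "{i, j} \<in> E" using good assms(2) by (auto simp: good_def)
    then have "j \<in> V" by (auto simp: E_def)
    then show ?thesis using layer_neighbour[of i G V i 0 j] assms by simp
  qed
  then show ?case by simp
next
  case (Suc m)
  show ?case
  proof
    fix v assume "v \<in> lay j (Suc m)"
    then obtain u where "u \<in> lay j m" "G {u, v}" "v \<in> V" by (auto simp: layer_Suc)
    then show "v \<in> ner i (Suc (Suc (Suc m)))" using nearer_neighbour[of u G V i "Suc (Suc m)" v] Suc by auto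
  qed
qed

text \<open>If \<open>i\<close> and \<open>j\<close> are adjacent, almost all of the layer \<open>k - 1\<close> of \<open>j\<close> lies in the layer \<open>k\<close> of \<open>i\<close>,
  and almost every vertex of the layer \<open>k\<close> of \<open>j\<close> has exactly one neighbour there. The correction
  term of AWCD removes this bias.\<close>

lemma adjacent_half:
  assumes i: "i \<in> V" and j: "j \<in> V" and ne: "i \<noteq> j" and adj: "G {i, j}"
  shows "\<bar>edges G (lay i k \<inter> lay j (k - 1)) (lay j k) - real (card (lay j k))\<bar> \<le> adjacent_const * (\<delta> * D ^ k)"
proof -
  define l where "l = k - 1"
  have kl: "k = Suc l" "l = Suc (k - 2)" using k_Suc by (auto simp: l_def)
  define P where "P = lay i k \<inter> lay j l"
  have \<delta>D: "0 \<le> \<delta> * D ^ k" using \<delta>_bounds D_ge by simp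
  have up: "edges G P (lay j k) \<le> real (card (lay j k)) + parents_const * (\<delta> * D ^ k)"
    using edges_parents_le_out_edges[OF j, of P "lay j k"] out_edges_le_card[OF j] by (auto simp: P_def l_def)
  \<comment> \<open>The exceptional vertices lie too close to \<open>i\<close>: at distance exactly
    l, where the overlap bound for distinct roots applies, or in the ball of radius k - 2, which is
    smaller than layer k - 1 by a factor of order D.\<close>
  have sub: "lay j l - P \<subseteq> (lay j l \<inter> lay i (l + 0)) \<union> ner i l"
    using neighbour_layers[OF i adj, of l] by (auto simp: P_def kl(1) nearer_Suc)
  have fin: "finite (lay j l)" "finite (lay j k)" "finite (ner i l)" "finite (lay i l)"
    using layer_finite[OF j] nearer_finite[OF i] layer_finite[OF i] by auto
  have "real (card (lay j k)) \<le> edges G (P \<union> (lay j l - P)) (lay j k)"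
    using card_layer_le_edges[OF j] by (simp add: l_def P_def Un_absorb1)
  also have "\<dots> = edges G P (lay j k) + edges G (lay j l - P) (lay j k)"
    using fin by (intro edges_Un_disjoint) (auto simp: P_def)
  also have "edges G (lay j l - P) (lay j k) \<le> edges G ((lay j l \<inter> lay i (l + 0)) \<union> ner i l) (lay j k)"
    using sub fin by (intro edges_mono) auto
  also have "\<dots> \<le> edges G (lay j l \<inter> lay i (l + 0)) (lay j k) + edges G (ner i l) (lay j k)"
    using fin by (intro edges_Un_le) auto
  also have "edges G (lay j l \<inter> lay i (l + 0)) (lay j k) \<le> H * overlap_const k * (\<delta> * D ^ k)"
    using ne layer_subset[OF j] by (intro edges_overlap_le j i kl) auto
  also have "edges G (ner i l) (lay j k) \<le> H * real k * Q * (\<delta> * D ^ k)"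
  proof -
    have "edges G (ner i l) (lay j k) \<le> real (card (ner i l)) * (H * D)"
      using nearer_subset[OF i] layer_subset[OF j] by (intro edges_le_degree) auto
    also have "\<dots> \<le> (real k * Q * D ^ (k - 2)) * (H * D)"
      unfolding kl(2) using i k2 H_ge_1 D_ge by (intro mult_right_mono card_nearer_Suc_le) auto
    also have "\<dots> = H * real k * Q * (1 / D * D ^ k)"
      using D_ge by (subst (5) kl(1), subst kl(2)) simp
    also have "\<dots> \<le> H * real k * Q * (\<delta> * D ^ k)"
      using \<delta>_bounds D_ge H_ge_1 Q_ge by (intro mult_left_mono mult_right_mono) auto
    finally show ?thesis .
  qed
  finally have low: "real (card (lay j k)) \<le> edges G P (lay j k) + (H * overlap_const k * (\<delta> * D ^ k) + H * real k * Q * (\<delta> * D ^ k))"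
    by simp
  have nn: "0 \<le> parents_const * (\<delta> * D ^ k)" "0 \<le> H * overlap_const k * (\<delta> * D ^ k)" "0 \<le> H * real k * Q * (\<delta> * D ^ k)"
    using \<delta>D Q_ge M_nonneg H_ge_1 overlap_const_nonneg by (auto simp: parents_const_def intro!: mult_nonneg_nonneg add_nonneg_nonneg)
  show ?thesis using up low nn unfolding P_def[symmetric] l_def[symmetric] adjacent_const_def distrib_right by linarith
qed

text \<open>The edges counted twice by the inclusion-exclusion join the fresh parts of the two
  layers k - 1. Pair concentration one level lower applies to them, with a mean below \<theta> T by
  a factor of order D^2.\<close>

lemma cross_edges_le:
  assumes i: "i \<in> V" and j: "j \<in> V"
  shows "edges G (lay i k \<inter> lay j (k - 1)) (lay j k \<inter> lay i (k - 1))
    \<le> 5 * Q\<^sup>2 * (\<theta> * \<delta> * T) + 12 * (\<delta> * D ^ k)"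
proof -
  define l where "l = k - 1"
  have kl: "k = Suc l" using k_Suc by (auto simp: l_def)
  define A where "A = lay j l - ner i l"
  define B where "B = lay i l - ner j l"
  define p where "p = \<theta> * real (card A) * real (card B)"
  have fin: "finite (lay j l)" "finite (lay i l)" "finite A" "finite B"
    using layer_finite[OF j] layer_finite[OF i] by (auto simp: A_def B_def)
  have sub: "lay i k \<inter> lay j l \<subseteq> A" "lay j k \<inter> lay i l \<subseteq> B"
    using nearer_Int_layer[of G V i k] nearer_Int_layer[of G V j k] by (auto simp: A_def B_def kl nearer_Suc)
  have "edges G (lay i k \<inter> lay j l) (lay j k \<inter> lay i l) \<le> edges G A B"
    using sub fin by (intro edges_mono) auto
  also have "\<dots> \<le> mean_edges A B + 4 * sqrt (L * (L + p))"
    using pair_concentration[OF j i, of l] kl unfolding A_def B_def p_def by linarith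
  also have "mean_edges A B \<le> p" unfolding p_def by (rule mean_edges_le)
  also have "sqrt (L * (L + p)) \<le> L + p"
  proof -
    have p: "0 \<le> p" using theta_pos by (simp add: p_def)
    have "sqrt (L * (L + p)) \<le> sqrt ((L + p) * (L + p))"
      using p ln1 by (intro real_sqrt_le_mono mult_right_mono) auto
    then show ?thesis using p ln1 by simp
  qed
  finally have "edges G (lay i k \<inter> lay j l) (lay j k \<inter> lay i l) \<le> 5 * p + 12 * ln (real n)" by simp
  moreover have "p \<le> Q\<^sup>2 * (\<theta> * \<delta> * T)"
  proof -
    have "card A \<le> card (lay j l)" "card B \<le> card (lay i l)"
      using fin by (auto simp: A_def B_def intro: card_mono)
    then have AB: "real (card A) \<le> Q * D ^ l" "real (card B) \<le> Q * D ^ l"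
      using card_layer_le[OF j, of l] card_layer_le[OF i, of l] kl by linarith+
    have "p \<le> \<theta> * (Q * D ^ l) * (Q * D ^ l)"
      unfolding p_def using AB theta_pos Q_ge D_ge by (intro mult_mono mult_left_mono) auto
    also have "\<dots> = \<theta> * Q\<^sup>2 * (1 / D * (1 / D) * T)"
    proof -
      have "D ^ k = D * D ^ l" using kl by simp
      then show ?thesis using D_ge by (simp add: T_def power2_eq_square)
    qed
    also have "\<dots> \<le> \<theta> * Q\<^sup>2 * (\<delta> * 1 * T)"
      using \<delta>_bounds D_ge theta_pos T_pos by (intro mult_left_mono mult_right_mono mult_mono) auto
    finally show ?thesis by (simp add: mult_ac)
  qed
  moreover have "ln (real n) \<le> \<delta> * D ^ k"
  proof -
    have "ln (real n) / D * D ^ 1 \<le> \<delta> * D ^ k"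
      using ln_over_D D_ge ln1 k2 \<delta>_bounds by (intro mult_mono D_power_mono) auto
    then show ?thesis using D_ge by simp
  qed
  ultimately show ?thesis unfolding l_def[symmetric] by linarith
qed

definition corr_const :: real where "corr_const = 2 * adjacent_const + 12 + 2 * (H * overlap_const k) + 5 * Q\<^sup>2"

text \<open>Three cases. For \<open>i = j\<close> the layers k - 1 and k are disjoint; for adjacent
  roots \<open>adjacent_half\<close> matches the correction from each side; for the other pairs
  layers 0 and 1 of the two roots are disjoint, and the overlap bound with shift 1 shows that no
  correction is due.\<close>

lemma corr_remainder:
  assumes i: "i \<in> V" and j: "j \<in> V"
  shows "\<bar>edges G (lay i k) (lay j k) - fresh i j k
      - of_bool (G {i, j}) * (real (card (lay i k)) + real (card (lay j k)))\<bar> \<le> corr_const * (\<delta> * (D ^ k + \<theta> * T))"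
proof -
  let ?l = "k - 1"
  define P where "P = lay i k \<inter> lay j ?l"
  define R where "R = lay j k \<inter> lay i ?l"
  define Z where "Z = \<delta> * D ^ k"
  define W where "W = \<theta> * \<delta> * T"
  have ZW: "0 \<le> Z" "0 \<le> W" using \<delta>_bounds D_ge theta_pos T_pos by (auto simp: Z_def W_def)
  have cs: "0 \<le> adjacent_const" "0 \<le> H * overlap_const k" "0 \<le> Q\<^sup>2"
    using Q_ge M_nonneg H_ge_1 overlap_const_nonneg by (auto simp: adjacent_const_def parents_const_def intro!: mult_nonneg_nonneg add_nonneg_nonneg)
  have eq: "edges G (lay i k) (lay j k) = fresh i j k + edges G P (lay j k) + edges G R (lay i k) - edges G P R"
    using edges_layers[OF i j, of ?l] k_Suc(1) edges_commute[of G "lay i k" R] unfolding P_def R_def by simp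
  have PR: "edges G P R \<le> edges G P (lay j k)"
    using layer_finite[OF i] layer_finite[OF j] by (intro edges_mono) (auto simp: P_def R_def)
  have "\<bar>edges G (lay i k) (lay j k) - fresh i j k
      - of_bool (G {i, j}) * (real (card (lay i k)) + real (card (lay j k)))\<bar>
      \<le> 2 * adjacent_const * Z + 12 * Z + 2 * (H * overlap_const k) * Z + 5 * Q\<^sup>2 * W"
  proof (cases "i = j")
    case True
    have "P = {}" "R = {}" using layer_disjoint[of k ?l G V i] k2 True by (auto simp: P_def R_def)
    then have "edges G (lay i k) (lay j k) = fresh i j k" using eq by (simp add: edges_def)
    moreover have "\<not> G {i, j}" using no_loop[of i] True by simp
    ultimately show ?thesis using ZW cs by simp
  next
    case ne: False
    show ?thesis
    proof (cases "G {i, j}")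
      case adj: True
      have 1: "\<bar>edges G P (lay j k) - real (card (lay j k))\<bar> \<le> adjacent_const * Z"
        unfolding P_def Z_def by (rule adjacent_half[OF i j ne adj])
      have 2: "\<bar>edges G R (lay i k) - real (card (lay i k))\<bar> \<le> adjacent_const * Z"
        unfolding R_def Z_def by (rule adjacent_half[OF j i]) (use ne adj in \<open>auto simp: insert_commute\<close>)
      have 3: "edges G P R \<le> 5 * Q\<^sup>2 * W + 12 * Z"
        unfolding P_def R_def Z_def W_def by (rule cross_edges_le[OF i j])
      have "0 \<le> 2 * (H * overlap_const k) * Z" "0 \<le> 12 * Z" "0 \<le> 5 * Q\<^sup>2 * W" using cs ZW by auto
      note * = this
      have ob: "of_bool (G {i, j}) = (1 :: real)" using adj by simp
      show ?thesis using eq 1 2 3 edges_nonneg[of G P R] * unfolding ob mult_1 by linarith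
    next
      case nadj: False
      have 1: "edges G P (lay j k) \<le> H * overlap_const k * Z"
      proof -
        have "P = lay j ?l \<inter> lay i (?l + 1)" using k_Suc(1) by (auto simp: P_def)
        moreover have "lay j 0 \<inter> lay i 1 = {}" using nadj by (auto simp: layer_Suc)
        ultimately show ?thesis unfolding Z_def
          using edges_overlap_le[OF j i, of 1 "lay j k" ?l] k_Suc(1) layer_subset[OF j] by simp
      qed
      have 2: "edges G R (lay i k) \<le> H * overlap_const k * Z"
      proof -
        have "R = lay i ?l \<inter> lay j (?l + 1)" using k_Suc(1) by (auto simp: R_def)
        moreover have "lay i 0 \<inter> lay j 1 = {}" using nadj by (auto simp: layer_Suc insert_commute)
        ultimately show ?thesis unfolding Z_def
          using edges_overlap_le[OF i j, of 1 "lay i k" ?l] k_Suc(1) layer_subset[OF i] by simp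
      qed
      have "0 \<le> adjacent_const * Z" "0 \<le> 12 * Z" "0 \<le> 5 * Q\<^sup>2 * W" using cs ZW by auto
      note * = this
      have ob: "of_bool (G {i, j}) = (0 :: real)" using nadj by simp
      show ?thesis
        using eq 1 2 PR edges_nonneg[of G P R] edges_nonneg[of G R "lay i k"] * unfolding ob mult_zero_left by linarith
    qed
  qed
  also have "\<dots> \<le> corr_const * (Z + W)"
  proof -
    have "0 \<le> (2 * adjacent_const + 12 + 2 * (H * overlap_const k)) * W" "0 \<le> 5 * Q\<^sup>2 * Z" using cs ZW by auto
    then show ?thesis unfolding corr_const_def by (simp add: algebra_simps)
  qed
  also have "Z + W = \<delta> * (D ^ k + \<theta> * T)" by (simp add: Z_def W_def algebra_simps)
  finally show ?thesis .
qed

end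

section \<open>Approximation of the test statistics\<close>

context sbm_graph
begin

lemma sum_pull:
  assumes A: "A \<subseteq> V"
  shows "(\<Sum>u\<in>A. pull (z u) B) = \<rho> * real (card A) * real (card B) + (\<theta> - \<rho>) * (\<Sum>a<K. share a A * share a B)"
proof -
  have fin: "finite A" by (rule finite_V_subset[OF A])
  have "(\<Sum>u\<in>A. share (z u) B) = (\<Sum>u\<in>A. \<Sum>a<K. of_bool (u \<in> comm a) * share a B)"
  proof (rule sum.cong[OF refl])
    fix u assume u: "u \<in> A"
    then have "(\<Sum>a<K. of_bool (u \<in> comm a) * share a B) = (\<Sum>a<K. if a = z u then share a B else 0)"
      using A by (intro sum.cong) (auto simp: comm_def)
    then show "share (z u) B = (\<Sum>a<K. of_bool (u \<in> comm a) * share a B)"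
      using u A z_less[of u] by auto
  qed
  also have "\<dots> = (\<Sum>a<K. (\<Sum>u\<in>A. of_bool (u \<in> comm a)) * share a B)"
    by (subst sum.swap) (simp only: sum_distrib_right)
  also have "\<dots> = (\<Sum>a<K. share a A * share a B)"
    using fin by (intro sum.cong refl) (simp add: sum_of_bool_card share_def Int_def)
  finally have "(\<Sum>u\<in>A. share (z u) B) = (\<Sum>a<K. share a A * share a B)" .
  then show ?thesis
    by (simp add: pull_def sum.distrib mult_ac flip: sum_distrib_left)
qed

text \<open>The last term removes the pairs with equal entries, which the first two count with
  probability \<open>\<theta>\<close> although loops never occur.\<close>

lemma mean_edges_eq:
  assumes A: "A \<subseteq> V" and B: "B \<subseteq> V"
  shows "mean_edges A B = \<rho> * real (card A) * real (card B) + (\<theta> - \<rho>) * (\<Sum>a<K. share a A * share a B)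
     - \<theta> * real (card (A \<inter> B))"
proof -
  have fin: "finite A" "finite B" using A B by (auto intro: finite_V_subset)
  have "(\<Sum>v\<in>B. pr u v) = pull (z u) B - \<theta> * of_bool (u \<in> B)" if u: "u \<in> A" for u
  proof -
    have "(\<Sum>v\<in>B. pr u v) = (\<Sum>v\<in>B. \<rho> + (\<theta> - \<rho>) * of_bool (v \<in> comm (z u)) - \<theta> * of_bool (v = u))"
      using B by (intro sum.cong refl) (auto simp: pr_def comm_def)
    also have "\<dots> = \<rho> * real (card B) + (\<theta> - \<rho>) * (\<Sum>v\<in>B. of_bool (v \<in> comm (z u))) - \<theta> * (\<Sum>v\<in>B. of_bool (v = u))"
      by (simp add: sum.distrib sum_subtractf mult.commute flip: sum_distrib_left)
    also have "(\<Sum>v\<in>B. of_bool (v \<in> comm (z u)) :: real) = share (z u) B"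
      using fin by (simp add: sum_of_bool_card share_def Int_def)
    also have "(\<Sum>v\<in>B. of_bool (v = u) :: real) = of_bool (u \<in> B)"
      using fin by (simp add: of_bool_def)
    finally show ?thesis by (simp add: pull_def)
  qed
  then have "mean_edges A B = (\<Sum>u\<in>A. pull (z u) B) - \<theta> * (\<Sum>u\<in>A. of_bool (u \<in> B))"
    unfolding mean_edges_def by (simp add: sum_subtractf flip: sum_distrib_left)
  also have "(\<Sum>u\<in>A. of_bool (u \<in> B) :: real) = real (card (A \<inter> B))"
    using fin by (simp add: sum_of_bool_card Int_def)
  finally show ?thesis by (simp only: sum_pull[OF A])
qed

lemma mean_edges_remove:
  assumes sub: "A' \<subseteq> A" "B' \<subseteq> B" and AB: "A \<subseteq> V" "B \<subseteq> V"
  shows "mean_edges A' B' \<le> mean_edges A B"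
    and "mean_edges A B \<le> mean_edges A' B' + \<theta> * (real (card (A - A')) * real (card B) + real (card A) * real (card (B - B')))"
proof -
  have fin: "finite A" "finite B" using AB by (auto intro: finite_V_subset)
  have nn: "0 \<le> mean_edges X Y" for X Y unfolding mean_edges_def by (intro sum_nonneg pr_bounds)
  have 1: "mean_edges A B = mean_edges (A - A') B + mean_edges A' B"
    unfolding mean_edges_def by (rule sum.subset_diff[OF sub(1) fin(1)])
  have 2: "mean_edges A' B = mean_edges A' (B - B') + mean_edges A' B'"
    unfolding mean_edges_def sum.distrib[symmetric] by (intro sum.cong refl sum.subset_diff[OF sub(2) fin(2)])
  show "mean_edges A' B' \<le> mean_edges A B" using 1 2 nn[of "A - A'" B] nn[of A' "B - B'"] by simp
  have "\<theta> * real (card A') * real (card (B - B')) \<le> \<theta> * real (card A) * real (card (B - B'))"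
    using card_mono[OF fin(1) sub(1)] theta_pos by (intro mult_right_mono mult_left_mono) auto
  then show "mean_edges A B \<le> mean_edges A' B' + \<theta> * (real (card (A - A')) * real (card B) + real (card A) * real (card (B - B')))"
    using 1 2 mean_edges_le[of "A - A'" B] mean_edges_le[of A' "B - B'"] by (simp add: algebra_simps)
qed

end

section \<open>The limiting edge density between two layers\<close>

context concentrated_graph
begin

text \<open>The ratio of the two eigenvalues of the layer recursion.\<close>

definition lam :: real where "lam = real n * (\<theta> - \<rho>) / deg"

text \<open>Edge density between two layers that follow the recursion exactly; the last bracket is
  the chance that two of their vertices share a community.\<close>

definition target :: "nat \<Rightarrow> nat \<Rightarrow> real" where
  "target i j = \<rho> + (\<theta> - \<rho>) * (1 / real K + (of_bool (z i = z j) - 1 / real K) * lam ^ (2 * k))"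

definition N0 :: real where "N0 = deg ^ (2 * k)"

lemma N0_eq: "N0 = deg ^ k * deg ^ k"
  by (simp add: N0_def mult_2 power_add)

text \<open>Uniform parts are orthogonal to deviations, and two deviation vectors have inner product
  1 - 1/K or - 1/K.\<close>

lemma sum_\<xi>_\<xi>:
  assumes i: "i \<in> V" and j: "j \<in> V"
  shows "(\<Sum>a<K. \<xi> i k a * \<xi> j k a) = N0 / real K + (real n * (\<theta> - \<rho>)) ^ (2 * k) * (of_bool (z i = z j) - 1 / real K)"
proof -
  define d where "d = deg ^ k"
  define x where "x = (real n * (\<theta> - \<rho>)) ^ k"
  have p: "(\<Sum>a<K. of_bool (a = z i) :: real) = 1" "(\<Sum>a<K. of_bool (a = z j) :: real) = 1"
    using z_less[OF i] z_less[OF j] by (simp_all add: of_bool_def)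
  have pq: "(\<Sum>a<K. of_bool (a = z i) * of_bool (a = z j) :: real) = of_bool (z i = z j)"
  proof -
    have "(\<Sum>a<K. of_bool (a = z i) * of_bool (a = z j) :: real) = (\<Sum>a<K. if a = z i then of_bool (z i = z j) else 0)"
      by (intro sum.cong) auto
    then show ?thesis using z_less[OF i] by simp
  qed
  have "(\<Sum>a<K. \<xi> i k a * \<xi> j k a) = (\<Sum>a<K. (d / real K - x / real K)\<^sup>2
      + (d / real K - x / real K) * x * of_bool (a = z i) + (d / real K - x / real K) * x * of_bool (a = z j)
      + x\<^sup>2 * (of_bool (a = z i) * of_bool (a = z j)))"
    by (intro sum.cong refl) (simp add: \<xi>_def d_def x_def algebra_simps power2_eq_square)
  also have "\<dots> = real K * (d / real K - x / real K)\<^sup>2 + 2 * ((d / real K - x / real K) * x) + x\<^sup>2 * of_bool (z i = z j)"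
    by (simp only: sum.distrib sum_distrib_left[symmetric] p pq) simp
  also have "\<dots> = d\<^sup>2 / real K + x\<^sup>2 * (of_bool (z i = z j) - 1 / real K)"
    using K_real by (simp add: power2_eq_square field_simps)
  finally show ?thesis by (simp add: d_def x_def N0_def power_mult[symmetric] mult.commute)
qed

lemma target_N0:
  assumes i: "i \<in> V" and j: "j \<in> V"
  shows "target i j * N0 = \<rho> * N0 + (\<theta> - \<rho>) * (\<Sum>a<K. \<xi> i k a * \<xi> j k a)"
proof -
  have "0 < deg" using deg_bounds D_ge by linarith
  then have *: "lam ^ (2 * k) * N0 = (real n * (\<theta> - \<rho>)) ^ (2 * k)"
    by (simp add: lam_def N0_def power_divide)
  have "target i j * N0 = \<rho> * N0 + (\<theta> - \<rho>) * (N0 / real K + (of_bool (z i = z j) - 1 / real K) * (lam ^ (2 * k) * N0))"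
    by (simp add: target_def algebra_simps)
  then show ?thesis unfolding * sum_\<xi>_\<xi>[OF i j] by (simp add: mult.commute)
qed

definition product_const :: real where "product_const = 2 * real K * M k * Q"

lemma product_const_nonneg: "0 \<le> product_const"
  using Q_ge M_nonneg by (simp add: product_const_def)

text \<open>Because 1/D \<le> \<open>\<delta>\<close>, diagonal terms of order D^k and explored
  interiors of order D^(k-1) count as relative errors \<open>\<delta>\<close>.\<close>

lemma D_le_\<delta>: "D ^ k \<le> \<delta> * T" "D ^ (k - 1) \<le> \<delta> * D ^ k"
proof -
  show *: "D ^ (k - 1) \<le> \<delta> * D ^ k"
    using mult_right_mono[OF \<delta>_bounds(3), of "D ^ k"] D_ge by (simp add: D_power_k)
  have "1 \<le> \<delta> * D ^ k" using * D_power_ge1[of "k - 1"] by linarith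
  then have "1 * D ^ k \<le> (\<delta> * D ^ k) * D ^ k" using D_ge by (intro mult_right_mono) auto
  then show "D ^ k \<le> \<delta> * T" by (simp add: T_def mult.assoc)
qed

lemma product_dev:
  fixes x y x' y' e :: real
  assumes "\<bar>x - x'\<bar> \<le> e" "\<bar>y - y'\<bar> \<le> e" "0 \<le> x'" "x' \<le> q" "0 \<le> y" "y \<le> q"
  shows "\<bar>x * y - x' * y'\<bar> \<le> 2 * e * q"
proof -
  have "x * y - x' * y' = (x - x') * y + x' * (y - y')" by (simp add: algebra_simps)
  also have "\<bar>\<dots>\<bar> \<le> \<bar>x - x'\<bar> * y + x' * \<bar>y - y'\<bar>"
    using assms by (intro order.trans[OF abs_triangle_ineq]) (auto simp: abs_mult)
  also have "\<dots> \<le> e * q + q * e" using assms by (intro add_mono mult_mono) auto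
  finally show ?thesis by simp
qed

lemma card_product_dev:
  assumes i: "i \<in> V" and j: "j \<in> V"
  shows "\<bar>real (card (lay i k)) * real (card (lay j k)) - N0\<bar> \<le> product_const * (\<delta> * T)"
proof -
  have "\<bar>real (card (lay i k)) * real (card (lay j k)) - N0\<bar> \<le> 2 * (real K * M k * (\<delta> * D ^ k)) * (Q * D ^ k)"
    unfolding N0_eq using i j deg_bounds D_ge
    by (intro product_dev card_layer_dev card_layer_le deg_power_bounds) auto
  then show ?thesis by (simp add: product_const_def T_def mult_ac)
qed

lemma composition_product_dev:
  assumes i: "i \<in> V" and j: "j \<in> V"
  shows "\<bar>(\<Sum>a<K. share a (lay i k) * share a (lay j k)) - (\<Sum>a<K. \<xi> i k a * \<xi> j k a)\<bar> \<le> product_const * (\<delta> * T)"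
proof -
  have "\<bar>(\<Sum>a<K. share a (lay i k) * share a (lay j k)) - (\<Sum>a<K. \<xi> i k a * \<xi> j k a)\<bar>
      \<le> (\<Sum>a<K. \<bar>share a (lay i k) * share a (lay j k) - \<xi> i k a * \<xi> j k a\<bar>)"
    unfolding sum_subtractf[symmetric] by (rule sum_abs)
  also have "\<dots> \<le> (\<Sum>a<K. 2 * (M k * \<delta> * D ^ k) * (Q * D ^ k))"
  proof (intro sum_mono product_dev)
    fix a assume "a \<in> {..<K}"
    then have a: "a < K" by simp
    show "\<bar>share a (lay i k) - \<xi> i k a\<bar> \<le> M k * \<delta> * D ^ k" "\<bar>share a (lay j k) - \<xi> j k a\<bar> \<le> M k * \<delta> * D ^ k"
      using composition[OF i order_refl a] composition[OF j order_refl a] by auto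
    show "\<xi> i k a \<le> Q * D ^ k" using \<xi>_bounds(2)[of i k a] deg_power_bounds(2)[of k] by simp
    show "share a (lay j k) \<le> Q * D ^ k"
      using share_le[OF layer_finite[OF j], of a k] card_layer_le[OF j, of k] by simp
  qed (auto simp: \<xi>_bounds)
  also have "\<dots> = product_const * (\<delta> * T)" by (simp add: product_const_def T_def mult_ac)
  finally show ?thesis .
qed

lemma card_removed_le:
  assumes i: "i \<in> V" and j: "j \<in> V" and X: "X \<subseteq> ner j k"
  shows "real (card (lay i k - (lay i k - X))) \<le> real k * Q * (\<delta> * D ^ k)"
proof -
  have "card (lay i k - (lay i k - X)) \<le> card (ner j k)"
    using X nearer_finite[OF j] by (intro card_mono) auto
  also have "real (card (ner j k)) \<le> real k * Q * D ^ (k - 1)"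
    using card_nearer_Suc_le[OF j, of "k - 1"] k_Suc(1) k2 by simp
  also have "\<dots> \<le> real k * Q * (\<delta> * D ^ k)"
    using D_le_\<delta>(2) Q_ge by (intro mult_left_mono) auto
  finally show ?thesis by simp
qed

definition fresh_const :: real where "fresh_const = 2 * real k * Q\<^sup>2 + Q + product_const"

text \<open>Four replacements: the count by its mean (\<open>1\<close>), the trimmed layers by the
  full ones (\<open>2\<close>), the diagonal (\<open>3\<close>), and the actual composition by the
  recursion (\<open>4\<close>). \<open>fresh_const\<close> collects the last three.\<close>

lemma fresh_approx:
  assumes i: "i \<in> V" and j: "j \<in> V"
  shows "\<bar>fresh i j k - target i j * N0\<bar> \<le> fresh_const * (\<theta> * \<delta> * T) + 4 * sqrt (L * (L + Q\<^sup>2 * (\<theta> * T)))"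
proof -
  define A where "A = lay i k"
  define B where "B = lay j k"
  define A' where "A' = A - ner j k"
  define B' where "B' = B - ner i k"
  have AB: "A \<subseteq> V" "B \<subseteq> V" "finite A" "finite B" "A' \<subseteq> A" "B' \<subseteq> B"
    using layer_subset[OF i] layer_subset[OF j] layer_finite[OF i] layer_finite[OF j]
    by (auto simp: A_def B_def A'_def B'_def)
  have cA: "real (card A) \<le> Q * D ^ k" "real (card B) \<le> Q * D ^ k"
    unfolding A_def B_def using card_layer_le i j by auto
  have "real (card A') \<le> Q * D ^ k" "real (card B') \<le> Q * D ^ k"
    using cA card_mono[OF AB(3,5)] card_mono[OF AB(4,6)] by linarith+
  then have "\<theta> * real (card A') * real (card B') \<le> \<theta> * (Q * D ^ k) * (Q * D ^ k)"
    using theta_pos Q_ge D_ge by (intro mult_mono mult_left_mono) auto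
  also have "\<dots> = Q\<^sup>2 * (\<theta> * T)" by (simp add: T_def power2_eq_square)
  finally have "sqrt (L * (L + \<theta> * real (card A') * real (card B'))) \<le> sqrt (L * (L + Q\<^sup>2 * (\<theta> * T)))"
    using ln1 by (intro real_sqrt_le_mono mult_left_mono add_left_mono) auto
  then have 1: "\<bar>fresh i j k - mean_edges A' B'\<bar> \<le> 4 * sqrt (L * (L + Q\<^sup>2 * (\<theta> * T)))"
    using pair_concentration[OF i j order_refl] unfolding fresh_def A'_def B'_def A_def B_def by linarith
  have rem: "real (card (A - A')) * real (card B) + real (card A) * real (card (B - B'))
      \<le> (real k * Q * (\<delta> * D ^ k)) * (Q * D ^ k) + (Q * D ^ k) * (real k * Q * (\<delta> * D ^ k))"
    unfolding A'_def B'_def A_def B_def using Q_ge D_ge \<delta>_bounds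
    by (intro add_mono mult_mono card_removed_le[OF i j order_refl] card_removed_le[OF j i order_refl]
        card_layer_le i j) auto
  have "\<theta> * (real (card (A - A')) * real (card B) + real (card A) * real (card (B - B')))
      \<le> \<theta> * (2 * real k * Q\<^sup>2 * (\<delta> * T))"
    using rem theta_pos by (intro mult_left_mono) (auto simp: T_def power2_eq_square mult_ac)
  then have 2: "\<bar>mean_edges A' B' - mean_edges A B\<bar> \<le> 2 * real k * Q\<^sup>2 * (\<theta> * \<delta> * T)"
    using mean_edges_remove[OF AB(5,6,1,2)] by (simp add: mult_ac)
  define X where "X = \<rho> * (real (card A) * real (card B)) + (\<theta> - \<rho>) * (\<Sum>a<K. share a A * share a B)"
  have "real (card (A \<inter> B)) \<le> real (card A)" using AB by (auto intro: card_mono)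
  also have "\<dots> \<le> Q * (\<delta> * T)" using cA(1) mult_left_mono[OF D_le_\<delta>(1), of Q] Q_ge by linarith
  finally have "\<theta> * real (card (A \<inter> B)) \<le> \<theta> * (Q * (\<delta> * T))" using theta_pos by (intro mult_left_mono) auto
  moreover have "0 \<le> \<theta> * real (card (A \<inter> B))" using theta_pos by simp
  ultimately have 3: "\<bar>mean_edges A B - X\<bar> \<le> Q * (\<theta> * \<delta> * T)"
    unfolding mean_edges_eq[OF AB(1,2)] X_def by (simp add: mult_ac)
  have "X - target i j * N0 = \<rho> * (real (card A) * real (card B) - N0) +
      (\<theta> - \<rho>) * ((\<Sum>a<K. share a A * share a B) - (\<Sum>a<K. \<xi> i k a * \<xi> j k a))"
    unfolding target_N0[OF i j] X_def by (simp add: algebra_simps)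
  also have "\<bar>\<dots>\<bar> \<le> \<rho> * (product_const * (\<delta> * T)) + (\<theta> - \<rho>) * (product_const * (\<delta> * T))"
    using card_product_dev[OF i j] composition_product_dev[OF i j] rho_pos rho_less
    unfolding A_def[symmetric] B_def[symmetric]
    by (intro order.trans[OF abs_triangle_ineq] add_mono) (auto simp: abs_mult)
  also have "\<dots> = product_const * (\<theta> * \<delta> * T)" by (simp add: algebra_simps)
  finally have 4: "\<bar>X - target i j * N0\<bar> \<le> product_const * (\<theta> * \<delta> * T)" .
  show ?thesis using 1 2 3 4 unfolding fresh_const_def distrib_right by linarith
qed

definition size_const :: real where "size_const = product_const + Q + 2 * real k * Q\<^sup>2"

lemma sphere_at_lay: "i \<in> V \<Longrightarrow> sphere_at V (adj_matrix G) m i = lay i m"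
  by (rule sphere_at_eq)

lemma edge_count_eq: "edge_count (adj_matrix G) A B = edges G A B"
  by (simp add: edge_count_def edges_def)

lemma N_circ_dev:
  assumes i: "i \<in> V" and j: "j \<in> V"
  shows "\<bar>N_circ k V (adj_matrix G) i j - N0\<bar> \<le> size_const * (\<delta> * T)"
proof -
  have N: "N_circ k V (adj_matrix G) i j =
      real (card (lay i k)) * real (card (lay j k)) - real (card (lay i k)) * of_bool (i = j)"
    unfolding N_circ_def sphere_at_lay[OF i] sphere_at_lay[OF j] by (simp add: algebra_simps)
  have "real (card (lay i k)) \<le> Q * (\<delta> * T)"
    using card_layer_le[OF i order_refl] mult_left_mono[OF D_le_\<delta>(1), of Q] Q_ge by linarith
  then have "real (card (lay i k)) * of_bool (i = j) \<le> Q * (\<delta> * T)"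
    using Q_ge T_pos \<delta>_bounds by (cases "i = j") auto
  moreover have "0 \<le> real (card (lay i k)) * of_bool (i = j)" by simp
  moreover have "0 \<le> 2 * real k * Q\<^sup>2 * (\<delta> * T)" using \<delta>_bounds T_pos by simp
  ultimately show ?thesis
    using card_product_dev[OF i j] unfolding N size_const_def distrib_right by linarith
qed

lemma N_plus_dev:
  assumes i: "i \<in> V" and j: "j \<in> V"
  shows "\<bar>N_plus k V (adj_matrix G) i j - N0\<bar> \<le> size_const * (\<delta> * T)"
proof -
  define A where "A = lay i k"
  define B where "B = lay j k"
  define A' where "A' = A - lay j (k - 1)"
  define B' where "B' = B - lay i (k - 1)"
  have fin: "finite A" "finite B" "finite A'" "finite B'" "A' \<subseteq> A" "B' \<subseteq> B"
    using layer_finite[OF i] layer_finite[OF j] by (auto simp: A_def B_def A'_def B'_def)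
  have "N_plus k V (adj_matrix G) i j = real (card {(v1, v2). v1 \<in> A' \<and> v2 \<in> B' \<and> v1 \<noteq> v2})"
    using i j by (simp add: N_plus_def sphere_minus_def sphere_at_lay A_def B_def A'_def B'_def)
  also have "{(v1, v2). v1 \<in> A' \<and> v2 \<in> B' \<and> v1 \<noteq> v2} = A' \<times> B' - (\<lambda>v. (v, v)) ` (A' \<inter> B')" by auto
  also have "card \<dots> = card (A' \<times> B') - card (A' \<inter> B')"
    using fin by (subst card_Diff_subset) (auto simp: card_image inj_on_def)
  also have "real \<dots> = real (card A') * real (card B') - real (card (A' \<inter> B'))"
  proof -
    have "card ((\<lambda>v. (v, v)) ` (A' \<inter> B')) \<le> card (A' \<times> B')" using fin by (intro card_mono) auto
    then have "card (A' \<inter> B') \<le> card (A' \<times> B')" by (simp add: card_image inj_on_def)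
    then show ?thesis by (simp add: of_nat_diff card_cartesian_product)
  qed
  finally have N: "N_plus k V (adj_matrix G) i j = real (card A') * real (card B') - real (card (A' \<inter> B'))" .
  have "card (A' \<inter> B') \<le> card A" using fin by (intro card_mono) auto
  then have 1: "real (card (A' \<inter> B')) \<le> Q * (\<delta> * T)"
    using card_layer_le[OF i order_refl] mult_left_mono[OF D_le_\<delta>(1), of Q] Q_ge unfolding A_def by linarith
  have sub: "lay j (k - 1) \<subseteq> ner j k" "lay i (k - 1) \<subseteq> ner i k"
    using layer_subset_nearer[of "k - 1" k] k2 by auto
  have cards: "real (card A) - real (card A') = real (card (A - A'))" "real (card B) - real (card B') = real (card (B - B'))"
    using fin by (simp_all add: card_Diff_subset card_mono of_nat_diff)
  have rem: "real (card (A - A')) * real (card B) + real (card A) * real (card (B - B'))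
      \<le> (real k * Q * (\<delta> * D ^ k)) * (Q * D ^ k) + (Q * D ^ k) * (real k * Q * (\<delta> * D ^ k))"
    unfolding A'_def B'_def A_def B_def using Q_ge D_ge \<delta>_bounds
    by (intro add_mono mult_mono card_removed_le[OF i j sub(1)] card_removed_le[OF j i sub(2)]
        card_layer_le i j) auto
  have eq: "real (card A) * real (card B) - real (card A') * real (card B') =
      real (card (A - A')) * real (card B) + real (card A') * real (card (B - B'))"
    unfolding cards[symmetric] by (simp add: algebra_simps)
  have "real (card A') * real (card (B - B')) \<le> real (card A) * real (card (B - B'))"
    using fin by (intro mult_right_mono) (auto intro: card_mono)
  then have 2: "real (card A) * real (card B) - real (card A') * real (card B') \<le> 2 * real k * Q\<^sup>2 * (\<delta> * T)"
    using eq rem by (simp add: T_def power2_eq_square mult_ac)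
  have 3: "0 \<le> real (card A) * real (card B) - real (card A') * real (card B')" unfolding eq by simp
  have "0 \<le> Q * (\<delta> * T)" "0 \<le> 2 * real k * Q\<^sup>2 * (\<delta> * T)" using Q_ge \<delta>_bounds T_pos by auto
  then show ?thesis
    using 1 2 3 card_product_dev[OF i j] unfolding A_def[symmetric] B_def[symmetric] N size_const_def distrib_right by linarith
qed

lemma S_plus_eq: "i \<in> V \<Longrightarrow> j \<in> V \<Longrightarrow> S_plus k V (adj_matrix G) i j = fresh i j k"
  using edges_layers_minus[of i j "k - 1"] k_Suc(1)
  by (simp add: S_plus_def sphere_minus_def sphere_at_lay edge_count_eq)

lemma S_circ_dev:
  assumes i: "i \<in> V" and j: "j \<in> V"
  shows "\<bar>S_circ k V (adj_matrix G) i j - fresh i j k\<bar> \<le> 2 * circ_const * D ^ k"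
  unfolding S_circ_def sphere_at_lay[OF i] sphere_at_lay[OF j] edge_count_eq by (rule circ_remainder[OF i j])

lemma S_corr_dev:
  assumes i: "i \<in> V" and j: "j \<in> V"
  shows "\<bar>S_corr k V (adj_matrix G) i j - fresh i j k\<bar> \<le> corr_const * (\<delta> * (D ^ k + \<theta> * T))"
proof -
  have ob: "of_bool (adj_matrix G i j = 1) = (of_bool (G {i, j}) :: real)" by simp
  show ?thesis
    using corr_remainder[OF i j]
    unfolding S_corr_def sphere_at_lay[OF i] sphere_at_lay[OF j] edge_count_eq ob by linarith
qed

end

section \<open>Separation by the divergence\<close>

text \<open>The Hellinger distance bounds the divergence from below, since \<open>ln x \<le> x - 1\<close> at
  \<open>x = sqrt (q / p)\<close>.\<close>

lemma KL_bernoulli_ge: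
  assumes p: "0 \<le> p" "p \<le> 1" and q: "0 < q" "q < 1" and m: "p \<le> m" "q \<le> m"
  shows "(p - q)\<^sup>2 / (4 * m) \<le> KL_bernoulli p q"
proof -
  have half: "2 * x - 2 * sqrt (x * y) \<le> x * ln (x / y)" if "0 \<le> x" "0 < y" for x y :: real
  proof (cases "x = 0")
    case False
    then have x: "0 < x" using that by simp
    have "ln (x / y) = - 2 * ln (sqrt (y / x))"
      using x that by (simp add: ln_sqrt ln_div)
    also have "\<dots> \<ge> - 2 * (sqrt (y / x) - 1)"
      using ln_le_minus_one[of "sqrt (y / x)"] x that by simp
    finally have "x * (- 2 * (sqrt (y / x) - 1)) \<le> x * ln (x / y)"
      using x by (intro mult_left_mono) auto
    moreover have "x * sqrt (y / x) = sqrt (x * y)"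
    proof -
      have "x * sqrt (y / x) = sqrt (x\<^sup>2) * sqrt (y / x)" using x by simp
      also have "\<dots> = sqrt (x\<^sup>2 * (y / x))" by (simp only: real_sqrt_mult)
      finally show ?thesis using x by (simp add: power2_eq_square)
    qed
    ultimately show ?thesis by (simp add: algebra_simps)
  qed simp
  define r where "r = sqrt p"
  define s where "s = sqrt q"
  define r' where "r' = sqrt (1 - p)"
  define s' where "s' = sqrt (1 - q)"
  have sq: "p = r\<^sup>2" "q = s\<^sup>2" "1 - p = r'\<^sup>2" "1 - q = s'\<^sup>2" and nn: "0 \<le> r" "0 \<le> s"
    using p q by (auto simp: r_def s_def r'_def s'_def)
  have "2 * p - 2 * (r * s) + (2 * (1 - p) - 2 * (r' * s')) \<le> KL_bernoulli p q"
    unfolding KL_bernoulli_def r_def s_def r'_def s'_def real_sqrt_mult[symmetric]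
    using p q by (intro add_mono half) auto
  moreover have "2 * p - 2 * (r * s) + (2 * (1 - p) - 2 * (r' * s')) = (r - s)\<^sup>2 + (r' - s')\<^sup>2"
  proof -
    have "(r - s)\<^sup>2 + (r' - s')\<^sup>2 = (r\<^sup>2 + r'\<^sup>2) + (s\<^sup>2 + s'\<^sup>2) - 2 * (r * s) - 2 * (r' * s')"
      by (simp add: power2_eq_square algebra_simps)
    also have "r\<^sup>2 + r'\<^sup>2 = 1" using sq by simp
    also have "s\<^sup>2 + s'\<^sup>2 = 1" using sq by simp
    finally show ?thesis by simp
  qed
  ultimately have hell: "(r - s)\<^sup>2 \<le> KL_bernoulli p q" using zero_le_power2[of "r' - s'"] by linarith
  \<comment> \<open>Passing from square roots back to means costs (r + s)^2; the common bound
    \<open>m\<close> on both means enters here.\<close>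
  have "(r + s)\<^sup>2 \<le> 4 * m"
  proof -
    have "(r + s)\<^sup>2 \<le> (r + s)\<^sup>2 + (r - s)\<^sup>2" by simp
    also have "\<dots> = 2 * p + 2 * q" unfolding sq(1,2) by (simp add: power2_eq_square algebra_simps)
    finally show ?thesis using m by simp
  qed
  then have "(r - s)\<^sup>2 * (r + s)\<^sup>2 \<le> (r - s)\<^sup>2 * (4 * m)" by (intro mult_left_mono) auto
  moreover have "(p - q)\<^sup>2 = (r - s)\<^sup>2 * (r + s)\<^sup>2"
    unfolding sq(1,2) by (simp add: power2_eq_square algebra_simps)
  ultimately have "(p - q)\<^sup>2 / (4 * m) \<le> (r - s)\<^sup>2" using q m by (simp add: pos_divide_le_eq)
  then show ?thesis using hell by simp
qed

text \<open>\<open>ln x \<le> x - 1\<close> bounds the divergence by the chi-square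
  distance.\<close>

lemma KL_bernoulli_le:
  assumes p: "0 \<le> p" "p \<le> 1" and q: "0 < q" "q < 1"
  shows "KL_bernoulli p q \<le> (p - q)\<^sup>2 / (q * (1 - q))"
proof -
  have half: "x * ln (x / y) \<le> x * (x / y - 1)" if "0 \<le> x" "0 < y" for x y :: real
    using that ln_le_minus_one[of "x / y"] by (cases "x = 0") (auto intro!: mult_left_mono)
  have "KL_bernoulli p q \<le> p * (p / q - 1) + (1 - p) * ((1 - p) / (1 - q) - 1)"
    unfolding KL_bernoulli_def using p q by (intro add_mono half) auto
  also have "\<dots> = (p - q)\<^sup>2 / (q * (1 - q))"
    using q by (simp add: divide_simps) (simp add: power2_eq_square algebra_simps)
  finally show ?thesis .
qed

text \<open>\<open>\<gamma>\<close> is the gap between the two possible densities,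
  \<open>\<eta>\<close> the relative accuracy, and [b, u] contains all estimators. For equal
  densities every estimator is within \<eta> \<gamma> of \<open>g1\<close>, so each divergence is at
  most 8 (\<eta> \<gamma>)^2 / b, and three weights up to 2 n0 give 48. Otherwise the pooled
  estimator stays away from the off-diagonal one, whose term alone yields the lower bound.\<close>

lemma test_stat_separation:
  fixes S N :: matrix
  assumes N: "n0 / 2 \<le> N i i" "N i i \<le> 2 * n0" "n0 / 2 \<le> N j j" "N j j \<le> 2 * n0"
      "n0 / 2 \<le> N i j" "N i j \<le> 2 * n0" and n0: "0 < n0"
    and Sd: "\<bar>S i i - g1 * N i i\<bar> \<le> \<eta> * \<gamma> * N i i" "\<bar>S j j - g1 * N j j\<bar> \<le> \<eta> * \<gamma> * N j j"
    and So: "\<bar>S i j - g * N i j\<bar> \<le> \<eta> * \<gamma> * N i j"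
    and g: "g = g1 \<or> g = g1 - \<gamma>" and \<gamma>: "0 < \<gamma>" and \<eta>: "0 < \<eta>" "\<eta> \<le> 1 / 8"
    and b: "0 < b" "b \<le> g1 - \<gamma> - \<eta> * \<gamma>" and u: "g1 + \<eta> * \<gamma> \<le> u" "u \<le> 1 / 2"
  shows "g = g1 \<Longrightarrow> test_stat S N i j \<le> 48 * n0 * \<eta>\<^sup>2 * \<gamma>\<^sup>2 / b"
    and "g = g1 - \<gamma> \<Longrightarrow> n0 * \<gamma>\<^sup>2 / (800 * u) \<le> test_stat S N i j"
proof -
  define x where "x = S i i / N i i"
  define y where "y = S i j / N i j"
  define w where "w = S j j / N j j"
  define W where "W = N i i + 2 * N i j + N j j"
  define q where "q = pooled_est S N i j"
  define e where "e = \<eta> * \<gamma>"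
  have pos: "0 < N i i" "0 < N j j" "0 < N i j" using N n0 by linarith+
  then have W: "0 < W" by (simp add: W_def)
  have e: "0 < e" "e \<le> \<gamma> / 8" using \<gamma> \<eta> by (auto simp: e_def)
  have est: "\<bar>a / c - h\<bar> \<le> e" if "\<bar>a - h * c\<bar> \<le> \<eta> * \<gamma> * c" "0 < c" for a c h :: real
  proof -
    have "\<bar>a / c - h\<bar> = \<bar>a - h * c\<bar> / c"
    proof -
      have "a / c - h = (a - h * c) / c" using that(2) by (simp add: diff_divide_distrib)
      then show ?thesis using that(2) by (simp only: abs_divide abs_of_pos)
    qed
    also have "\<dots> \<le> e" using that by (simp add: e_def pos_divide_le_eq)
    finally show ?thesis .
  qed
  have xy: "\<bar>x - g1\<bar> \<le> e" "\<bar>w - g1\<bar> \<le> e" "\<bar>y - g\<bar> \<le> e"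
    unfolding x_def w_def y_def using est Sd So pos by blast+
  have qW: "q * W = N i i * x + 2 * N i j * y + N j j * w"
    using pos W by (simp add: q_def pooled_est_def x_def y_def w_def W_def)
  have avg: "lo \<le> q \<and> q \<le> hi" if "lo \<le> x" "x \<le> hi" "lo \<le> y" "y \<le> hi" "lo \<le> w" "w \<le> hi" for lo hi
  proof -
    have "N i i * lo + 2 * N i j * lo + N j j * lo \<le> q * W"
      unfolding qW using that pos by (intro add_mono mult_left_mono) auto
    moreover have "q * W \<le> N i i * hi + 2 * N i j * hi + N j j * hi"
      unfolding qW using that pos by (intro add_mono mult_left_mono) auto
    ultimately have "lo * W \<le> q * W" "q * W \<le> hi * W" by (simp_all add: W_def algebra_simps)
    then show ?thesis using W by simp
  qed
  have range: "b \<le> x" "x \<le> u" "b \<le> y" "y \<le> u" "b \<le> w" "w \<le> u"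
    using xy g b u \<gamma> e unfolding e_def[symmetric] by auto
  then have q: "b \<le> q" "q \<le> u" using avg by auto
  have "test_defined S N i j"
    using pos W range q b u
    unfolding test_defined_def x_def[symmetric] y_def[symmetric] w_def[symmetric] q_def[symmetric] W_def[symmetric]
    by auto
  then have T: "test_stat S N i j = N i i * KL_bernoulli x q + N j j * KL_bernoulli w q + N i j * KL_bernoulli y q"
    by (simp add: test_stat_def x_def y_def w_def q_def)
  show "test_stat S N i j \<le> 48 * n0 * \<eta>\<^sup>2 * \<gamma>\<^sup>2 / b" if g1: "g = g1"
  proof -
    have q1: "g1 - e \<le> q" "q \<le> g1 + e" using avg[of "g1 - e" "g1 + e"] xy g1 by (auto simp: abs_le_iff)
    have KL: "KL_bernoulli p q \<le> 8 * e\<^sup>2 / b" if p: "\<bar>p - g1\<bar> \<le> e" "b \<le> p" "p \<le> u" for p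
    proof -
      have "KL_bernoulli p q \<le> (p - q)\<^sup>2 / (q * (1 - q))"
        using p q b u by (intro KL_bernoulli_le) auto
      also have "\<dots> \<le> (2 * e)\<^sup>2 / (b * (1 / 2))"
      proof (rule frac_le)
        have "\<bar>p - q\<bar> \<le> \<bar>2 * e\<bar>" using p q1 by auto
        then show "(p - q)\<^sup>2 \<le> (2 * e)\<^sup>2" by (simp only: abs_le_square_iff)
        show "b * (1 / 2) \<le> q * (1 - q)" using q b u by (intro mult_mono) auto
      qed (use b in auto)
      finally show ?thesis by (simp add: power2_eq_square)
    qed
    have "test_stat S N i j \<le> 2 * n0 * (8 * e\<^sup>2 / b) + 2 * n0 * (8 * e\<^sup>2 / b) + 2 * n0 * (8 * e\<^sup>2 / b)"
    proof -
      have "M * KL_bernoulli p q \<le> 2 * n0 * (8 * e\<^sup>2 / b)"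
        if "\<bar>p - g1\<bar> \<le> e" "b \<le> p" "p \<le> u" "0 < M" "M \<le> 2 * n0" for M p
      proof -
        have "M * KL_bernoulli p q \<le> M * (8 * e\<^sup>2 / b)" using that KL by (intro mult_left_mono) auto
        also have "\<dots> \<le> 2 * n0 * (8 * e\<^sup>2 / b)" using that b by (intro mult_right_mono) auto
        finally show ?thesis .
      qed
      then show ?thesis unfolding T using xy g1 range pos N by (intro add_mono) auto
    qed
    also have "\<dots> = 48 * n0 * \<eta>\<^sup>2 * \<gamma>\<^sup>2 / b" by (simp add: e_def power_mult_distrib)
    finally show ?thesis .
  qed
  show "n0 * \<gamma>\<^sup>2 / (800 * u) \<le> test_stat S N i j" if g0: "g = g1 - \<gamma>"
  proof -
    have nonneg: "0 \<le> KL_bernoulli p q" if "b \<le> p" "p \<le> u" for p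
    proof -
      have "0 \<le> (p - q)\<^sup>2 / (4 * u)" using that b by simp
      also have "\<dots> \<le> KL_bernoulli p q" using that q b u by (intro KL_bernoulli_ge) auto
      finally show ?thesis .
    qed
    have gap: "\<gamma> / 10 \<le> q - y"
    proof -
      have d: "3 / 4 * \<gamma> \<le> x - y" "3 / 4 * \<gamma> \<le> w - y" using xy g0 e by (auto simp: abs_le_iff)
      have "(N i i + N j j) * (3 / 4 * \<gamma>) \<le> N i i * (x - y) + N j j * (w - y)"
        unfolding distrib_right using d pos by (intro add_mono mult_left_mono) auto
      also have "\<dots> = (q - y) * W" unfolding left_diff_distrib qW by (simp add: W_def algebra_simps)
      finally have 1: "(N i i + N j j) * (3 / 4 * \<gamma>) \<le> (q - y) * W" .
      \<comment> \<open>The diagonal weights make up at least a fifth of the pooled weight, as 2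
        N_ij \<le> 4 n0 \<le> 4 (N_ii + N_jj). This leaves 3/20 of \<gamma>, more than the claimed
        tenth.\<close>
      have "W \<le> 5 * (N i i + N j j)" using N by (simp add: W_def)
      then have "W * (\<gamma> / 10) \<le> 5 * (N i i + N j j) * (\<gamma> / 10)" using \<gamma> by (intro mult_right_mono) auto
      also have "\<dots> \<le> (N i i + N j j) * (3 / 4 * \<gamma>)" using pos \<gamma> by simp
      finally have "\<gamma> / 10 * W \<le> (q - y) * W" using 1 by (simp add: mult.commute)
      then show ?thesis using W by simp
    qed
    have "(\<gamma> / 10)\<^sup>2 \<le> (q - y)\<^sup>2" using gap \<gamma> by (intro power_mono) auto
    then have "(\<gamma> / 10)\<^sup>2 / (4 * u) \<le> (y - q)\<^sup>2 / (4 * u)"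
      using q b by (intro divide_right_mono) (auto simp: power2_commute)
    also have "\<dots> \<le> KL_bernoulli y q" using range q b u by (intro KL_bernoulli_ge) auto
    finally have "n0 / 2 * ((\<gamma> / 10)\<^sup>2 / (4 * u)) \<le> N i j * KL_bernoulli y q"
      using N n0 q b by (intro mult_mono) auto
    moreover have "0 \<le> N i i * KL_bernoulli x q" "0 \<le> N j j * KL_bernoulli w q"
      using nonneg range pos by auto
    moreover have "n0 / 2 * ((\<gamma> / 10)\<^sup>2 / (4 * u)) = n0 * \<gamma>\<^sup>2 / (800 * u)" by (simp add: power2_eq_square)
    ultimately show ?thesis unfolding T by linarith
  qed
qed

text \<open>Equals N0 gap^2 / (3200 \<theta>), half of the lower bound of
  \<open>test_stat_separation\<close> at u = 2 \<theta>. It is spelled out in the model parameters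
  because the threshold must not see the partition.\<close>

definition tuned_threshold :: "nat \<Rightarrow> nat \<Rightarrow> nat \<Rightarrow> real \<Rightarrow> real \<Rightarrow> real" where
  "tuned_threshold K k n \<theta> \<rho> =
     (real n * (\<theta> + (real K - 1) * \<rho>)) ^ (2 * k) *
     ((\<theta> - \<rho>) * ((\<theta> - \<rho>) / (\<theta> + (real K - 1) * \<rho>)) ^ (2 * k))\<^sup>2 / (3200 * \<theta>)"

section \<open>Correct output on the good event\<close>

context concentrated_graph
begin

definition gap :: real where "gap = (\<theta> - \<rho>) * lam ^ (2 * k)"

lemma deg_pos: "0 < deg" and N0_pos: "0 < N0"
proof -
  show "0 < deg" using deg_bounds D_ge by linarith
  then show "0 < N0" by (simp add: N0_def)
qed

lemma lam_bounds: "0 < lam" "lam \<le> 1"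
  using deg_pos deg_bounds n_pos rho_less by (auto simp: lam_def)

lemma threshold_eq: "tuned_threshold K k n \<theta> \<rho> = N0 * gap\<^sup>2 / (3200 * \<theta>)"
proof -
  have "lam = (\<theta> - \<rho>) / (\<theta> + (real K - 1) * \<rho>)" using n_pos by (simp add: lam_def deg_def)
  then show ?thesis by (simp add: tuned_threshold_def N0_def gap_def deg_def)
qed

lemma recovery:
  assumes N: "\<And>i j. i \<in> V \<Longrightarrow> j \<in> V \<Longrightarrow> \<bar>N i j - N0\<bar> \<le> \<epsilon>"
    and S: "\<And>i j. i \<in> V \<Longrightarrow> j \<in> V \<Longrightarrow> \<bar>S i j - fresh i j k\<bar> \<le> r"
    and \<epsilon>: "\<epsilon> \<le> N0 / 2"
    and err: "r + (fresh_const * (\<theta> * \<delta> * T) + 4 * sqrt (L * (L + Q\<^sup>2 * (\<theta> * T)))) + \<theta> * \<epsilon> \<le> 1 / (600 * C) * gap * (N0 / 2)"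
    and C: "1 < C" "\<theta> \<le> C * \<rho>" and \<theta>4: "\<theta> \<le> 1 / 4"
    and i: "i \<in> V" and j: "j \<in> V"
  shows "test_output S N (tuned_threshold K k n \<theta> \<rho>) i j = true_W z i j"
proof -
  \<comment> \<open>With b = \<theta>/(2 C) the upper bound for equal communities is 96 C \<eta>^2
    N0 gap^2 / \<theta>, and 96/360000 < 1/3200 puts it below the threshold.\<close>
  define \<eta> where "\<eta> = 1 / (600 * C)"
  define g1 where "g1 = \<rho> + (\<theta> - \<rho>) * (1 / real K + (1 - 1 / real K) * lam ^ (2 * k))"
  have \<eta>: "0 < \<eta>" "\<eta> \<le> 1 / 8" using C by (auto simp: \<eta>_def divide_simps)
  have lamk: "0 < lam ^ (2 * k)" "lam ^ (2 * k) \<le> 1" using lam_bounds by (auto intro: power_le_one)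
  have gap: "0 < gap" "gap \<le> \<theta> - \<rho>" using lamk rho_less by (auto simp: gap_def mult_le_cancel_left1)
  have invK: "0 \<le> 1 / real K" "1 / real K \<le> 1" using K_real by auto
  have target_eq: "target a b = (if z a = z b then g1 else g1 - gap)" for a b
    by (auto simp: target_def g1_def gap_def algebra_simps)
  have g1_le: "g1 \<le> \<theta>"
  proof -
    have "(1 - 1 / real K) * lam ^ (2 * k) \<le> (1 - 1 / real K) * 1" using lamk invK by (intro mult_left_mono) auto
    then have "(\<theta> - \<rho>) * (1 / real K + (1 - 1 / real K) * lam ^ (2 * k)) \<le> (\<theta> - \<rho>) * 1"
      using rho_less by (intro mult_left_mono) auto
    then show ?thesis by (simp add: g1_def)
  qed
  have g0_ge: "\<rho> \<le> g1 - gap"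
  proof -
    have "g1 - gap = \<rho> + (\<theta> - \<rho>) * (1 / real K * (1 - lam ^ (2 * k)))" by (simp add: g1_def gap_def algebra_simps)
    moreover have "0 \<le> (\<theta> - \<rho>) * (1 / real K * (1 - lam ^ (2 * k)))"
      using rho_less lamk invK by (intro mult_nonneg_nonneg) auto
    ultimately show ?thesis by simp
  qed
  have target_le: "0 \<le> target a b" "target a b \<le> \<theta>" for a b
    using g0_ge g1_le gap rho_pos by (auto simp: target_eq)
  have Nb: "N0 / 2 \<le> N a b" "N a b \<le> 2 * N0" if "a \<in> V" "b \<in> V" for a b
    using N[OF that] \<epsilon> N0_pos by (auto simp: abs_le_iff)
  have Sb: "\<bar>S a b - target a b * N a b\<bar> \<le> \<eta> * gap * N a b" if ab: "a \<in> V" "b \<in> V" for a b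
  proof -
    have "target a b * \<bar>N a b - N0\<bar> \<le> \<theta> * \<epsilon>" using target_le N[OF ab] theta_pos by (intro mult_mono) auto
    then have "\<bar>target a b * N a b - target a b * N0\<bar> \<le> \<theta> * \<epsilon>"
      using target_le by (simp flip: right_diff_distrib add: abs_mult)
    then have "\<bar>S a b - target a b * N a b\<bar> \<le> \<eta> * gap * (N0 / 2)"
      using S[OF ab] fresh_approx[OF ab] err unfolding \<eta>_def by linarith
    also have "\<dots> \<le> \<eta> * gap * N a b" using Nb[OF ab] \<eta> gap by (intro mult_left_mono) auto
    finally show ?thesis .
  qed
  \<comment> \<open>The gap is at most \<theta> \<le> C \<rho>, so C cancels and the estimators stay
    above \<rho>/2, hence above b.\<close>
  have \<eta>gap: "\<eta> * gap \<le> \<rho> / 600"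
  proof -
    have "\<eta> * gap \<le> \<eta> * (C * \<rho>)" using \<eta> gap C rho_pos by (intro mult_left_mono) auto
    also have "\<dots> = \<rho> / 600" using C by (simp add: \<eta>_def)
    finally show ?thesis .
  qed
  have b: "\<theta> / (2 * C) \<le> \<rho> / 2" using C by (simp add: divide_simps mult.commute)
  note sep = test_stat_separation[where S = S and N = N and ?n0.0 = N0 and ?g1.0 = g1 and \<gamma> = gap and \<eta> = \<eta> and i = i and j = j
      and g = "target i j" and b = "\<theta> / (2 * C)" and u = "2 * \<theta>",
      OF Nb[OF i i] Nb[OF j j] Nb[OF i j] N0_pos]
  have pre: "\<bar>S i i - g1 * N i i\<bar> \<le> \<eta> * gap * N i i" "\<bar>S j j - g1 * N j j\<bar> \<le> \<eta> * gap * N j j"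
    "\<bar>S i j - target i j * N i j\<bar> \<le> \<eta> * gap * N i j" "target i j = g1 \<or> target i j = g1 - gap"
    using Sb[OF i i] Sb[OF j j] Sb[OF i j] by (auto simp: target_eq)
  have pre2: "0 < \<theta> / (2 * C)" "\<theta> / (2 * C) \<le> g1 - gap - \<eta> * gap" "g1 + \<eta> * gap \<le> 2 * \<theta>" "2 * \<theta> \<le> 1 / 2"
    using theta_pos C b g0_ge \<eta>gap g1_le rho_less rho_pos \<theta>4 by auto
  note sep = sep[OF pre gap(1) \<eta> pre2]
  define t where "t = tuned_threshold K k n \<theta> \<rho>"
  have t: "t = N0 * gap\<^sup>2 / (3200 * \<theta>)" unfolding t_def by (rule threshold_eq)
  show ?thesis
  proof (cases "z i = z j")
    case True
    then have "test_stat S N i j \<le> 48 * N0 * \<eta>\<^sup>2 * gap\<^sup>2 / (\<theta> / (2 * C))"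
      by (intro sep(1)) (simp add: target_eq)
    also have "\<dots> = N0 * gap\<^sup>2 / \<theta> * (96 * (C * \<eta>\<^sup>2))" using C theta_pos by simp
    also have "\<dots> \<le> N0 * gap\<^sup>2 / \<theta> * (1 / 3200)"
    proof (rule mult_left_mono)
      have "C * \<eta>\<^sup>2 = 1 / (360000 * C)" using C by (simp add: \<eta>_def power2_eq_square)
      also have "\<dots> \<le> 1 / 360000" using C by (simp add: divide_simps)
      finally show "96 * (C * \<eta>\<^sup>2) \<le> 1 / 3200" by simp
    qed (use N0_pos theta_pos in auto)
    also have "\<dots> = t" by (simp add: t)
    finally show ?thesis using True by (simp add: test_output_def true_W_def t_def)
  next
    case False
    then have "N0 * gap\<^sup>2 / (800 * (2 * \<theta>)) \<le> test_stat S N i j"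
      by (intro sep(2)) (simp add: target_eq)
    moreover have "t < N0 * gap\<^sup>2 / (800 * (2 * \<theta>))"
      unfolding t using N0_pos gap theta_pos by (simp add: divide_simps)
    ultimately have "\<not> test_stat S N i j \<le> t" by linarith
    then show ?thesis using False by (simp add: test_output_def true_W_def t_def)
  qed
qed

text \<open>In units of the \<open>X\<close> of \<open>recovery_rate\<close>: the bias of S, twice
  \<open>fresh_const\<close> since \<open>\<delta>\<close> is at most 2 e \<Lambda>, 4 (12 + 4 Q)
  from the Chernoff term, and the error of N.\<close>

definition error_const :: real where
  "error_const = (2 * circ_const + 4 * corr_const) + 2 * fresh_const + 48 + 16 * Q + 2 * size_const"

lemma consts_nonneg: "0 \<le> fresh_const" "0 \<le> size_const" "0 \<le> circ_const" "0 \<le> corr_const"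
  using Q_ge M_nonneg H_ge_1 overlap_const_nonneg product_const_nonneg
  by (auto simp: fresh_const_def size_const_def circ_const_def corr_const_def adjacent_const_def parents_const_def intro!: mult_nonneg_nonneg add_nonneg_nonneg)

text \<open>Since \<open>deg \<le> K * D\<close>, replacing the eigenvalue ratio by (\<theta> -
  \<rho>)/(K \<theta>) costs K^(2k) and expresses the signal through the quantity that the rates
  control.\<close>

lemma gap_N0_ge: "\<theta> * ((\<theta> - \<rho>) / \<theta>) ^ (2 * k + 1) * T / real K ^ (2 * k) \<le> gap * N0"
proof -
  define l where "l = (\<theta> - \<rho>) / \<theta>"
  have l: "0 \<le> l" "\<theta> * l = \<theta> - \<rho>" using theta_pos rho_less by (auto simp: l_def)
  have "l / real K \<le> lam"
  proof -
    have "l / real K = real n * (\<theta> - \<rho>) / (real K * D)"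
      using n_pos by (simp add: l_def D_def)
    also have "\<dots> \<le> real n * (\<theta> - \<rho>) / deg"
      using deg_bounds deg_pos by (intro divide_left_mono) (auto intro: mult_pos_pos order.strict_trans2)
    finally show ?thesis by (simp add: lam_def)
  qed
  then have "(l / real K) ^ (2 * k) \<le> lam ^ (2 * k)" using l by (intro power_mono) auto
  then have "(\<theta> - \<rho>) * (l / real K) ^ (2 * k) \<le> gap"
    unfolding gap_def using rho_less by (intro mult_left_mono) auto
  moreover have "T \<le> N0" unfolding T_def N0_eq using deg_power_bounds(1)[of k] D_ge deg_pos by (intro mult_mono) auto
  ultimately have "(\<theta> - \<rho>) * (l / real K) ^ (2 * k) * T \<le> gap * N0"
    using T_pos l rho_less lam_bounds by (intro mult_mono) (auto simp: gap_def)
  moreover have "(\<theta> - \<rho>) * (l / real K) ^ (2 * k) * T = \<theta> * l ^ (2 * k + 1) * T / real K ^ (2 * k)"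
    unfolding l(2)[symmetric] by (simp add: power_divide)
  ultimately show ?thesis by (simp add: l_def)
qed

text \<open>All errors are compared with X = e \<Lambda> \<theta> T. The factor 1200 is twice the
  600 of \<open>recovery\<close>, which compares with N0/2.\<close>

lemma recovery_rate:
  fixes e :: real
  defines "\<Lambda> \<equiv> ((\<theta> - \<rho>) / \<theta>) ^ (2 * k + 1)"
  assumes e: "0 < e" "e \<le> 1" "1200 * C * real K ^ (2 * k) * error_const * e \<le> 1"
    and depletion: "D ^ k / real n \<le> e * \<Lambda>" and fluctuation: "sqrt (ln (real n) / D) \<le> e * \<Lambda>"
    and noise: "sqrt (ln (real n) * \<theta>) * D ^ k \<le> 2 * (e * \<Lambda> * (\<theta> * T))"
    and C: "1 < C" "\<theta> \<le> C * \<rho>" and \<theta>4: "\<theta> \<le> 1 / 4"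
    and N: "\<And>i j. i \<in> V \<Longrightarrow> j \<in> V \<Longrightarrow> \<bar>N i j - N0\<bar> \<le> size_const * (\<delta> * T)"
    and S: "\<And>i j. i \<in> V \<Longrightarrow> j \<in> V \<Longrightarrow> \<bar>S i j - fresh i j k\<bar> \<le> (2 * circ_const + 4 * corr_const) * (e * \<Lambda> * (\<theta> * T))"
    and i: "i \<in> V" and j: "j \<in> V"
  shows "test_output S N (tuned_threshold K k n \<theta> \<rho>) i j = true_W z i j"
proof -
  define X where "X = e * \<Lambda> * (\<theta> * T)"
  have \<Lambda>: "0 \<le> \<Lambda>" "\<Lambda> \<le> 1"
  proof -
    have "0 \<le> (\<theta> - \<rho>) / \<theta>" "(\<theta> - \<rho>) / \<theta> \<le> 1" using theta_pos rho_pos rho_less by auto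
    then show "0 \<le> \<Lambda>" "\<Lambda> \<le> 1"
      unfolding \<Lambda>_def by (blast intro: zero_le_power power_le_one)+
  qed
  have e\<Lambda>: "0 \<le> e * \<Lambda>" "e * \<Lambda> \<le> 1" using \<Lambda> e by (auto intro: mult_le_one)
  have \<theta>T: "0 < \<theta> * T" using theta_pos T_pos by simp
  have X: "0 \<le> X" using e\<Lambda> \<theta>T by (simp add: X_def)
  have \<delta>: "\<delta> \<le> 2 * (e * \<Lambda>)" using depletion fluctuation by (simp add: \<delta>_def)
  have \<delta>T: "\<theta> * \<delta> * T \<le> 2 * X"
    using mult_right_mono[OF \<delta>, of "\<theta> * T"] \<theta>T by (simp add: X_def mult_ac)
  define w where "w = sqrt (ln (real n) * (\<theta> * T))"
  have w: "w \<le> 2 * X"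
  proof -
    have "w = sqrt (ln (real n) * \<theta>) * sqrt T" unfolding w_def by (simp add: real_sqrt_mult)
    also have "sqrt T = D ^ k" using D_ge by (simp add: T_def)
    finally show ?thesis using noise by (simp add: X_def)
  qed
  have w0: "0 \<le> w" and w2: "w\<^sup>2 = ln (real n) * (\<theta> * T)" using ln1 \<theta>T by (auto simp: w_def)
  \<comment> \<open>The noise bound also controls the additive logarithm: squared, it bounds
    \<theta> T ln n by 4 X^2, and X \<le> \<theta> T because e \<Lambda> \<le> 1.\<close>
  have ln_le: "ln (real n) \<le> 4 * X"
  proof -
    have "ln (real n) * (\<theta> * T) \<le> (2 * X)\<^sup>2" unfolding w2[symmetric] using w w0 by (intro power_mono) auto
    also have "\<dots> = 4 * X * (e * \<Lambda>) * (\<theta> * T)" by (simp add: X_def power2_eq_square)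
    finally have "ln (real n) \<le> 4 * X * (e * \<Lambda>)" using \<theta>T by (rule mult_right_le_imp_le)
    also have "\<dots> \<le> 4 * X * 1" using e\<Lambda> X by (intro mult_left_mono) auto
    finally show ?thesis by simp
  qed
  have sq: "sqrt (L * (L + Q\<^sup>2 * (\<theta> * T))) \<le> (12 + 4 * Q) * X"
  proof -
    have "L * (L + Q\<^sup>2 * (\<theta> * T)) \<le> (L + 2 * (Q * w))\<^sup>2"
    proof -
      have "L * (L + Q\<^sup>2 * (\<theta> * T)) = L\<^sup>2 + 3 * (Q\<^sup>2 * w\<^sup>2)" unfolding w2 by (simp add: power2_eq_square algebra_simps)
      moreover have "(L + 2 * (Q * w))\<^sup>2 = L\<^sup>2 + 4 * (L * (Q * w)) + 4 * (Q\<^sup>2 * w\<^sup>2)"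
        by (simp add: power2_eq_square algebra_simps)
      moreover have "0 \<le> L * (Q * w)" "0 \<le> Q\<^sup>2 * w\<^sup>2" using ln1 Q_ge w0 by auto
      ultimately show ?thesis by linarith
    qed
    then have "sqrt (L * (L + Q\<^sup>2 * (\<theta> * T))) \<le> L + 2 * (Q * w)"
      using ln1 Q_ge w0 by (intro real_le_lsqrt) auto
    also have "\<dots> \<le> 12 * X + 2 * (Q * (2 * X))"
      using ln_le w Q_ge by (intro add_mono mult_left_mono) auto
    finally show ?thesis by (simp add: algebra_simps)
  qed
  have nn: "0 \<le> fresh_const" "0 \<le> size_const" "0 \<le> error_const" "2 * size_const \<le> error_const"
    using consts_nonneg Q_ge by (auto simp: error_const_def)
  have K2k: "1 \<le> real K ^ (2 * k)" using K_real by (intro one_le_power) auto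
  have "0 < 1200 * C * real K ^ (2 * k)" using C K2k by (intro mult_pos_pos) linarith+
  from pos_le_divide_eq[OF this, of "error_const * e" 1]
  have ee: "error_const * e \<le> 1 / (1200 * C * real K ^ (2 * k))"
    using e(3) by (simp only: mult_ac)
  have err: "(2 * circ_const + 4 * corr_const) * X + (fresh_const * (\<theta> * \<delta> * T) + 4 * sqrt (L * (L + Q\<^sup>2 * (\<theta> * T)))) + \<theta> * (size_const * (\<delta> * T))
      \<le> 1 / (600 * C) * gap * (N0 / 2)"
  proof -
    have eq: "\<theta> * (size_const * (\<delta> * T)) = size_const * (\<theta> * \<delta> * T)" by simp
    have "fresh_const * (\<theta> * \<delta> * T) \<le> fresh_const * (2 * X)" "size_const * (\<theta> * \<delta> * T) \<le> size_const * (2 * X)"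
      using \<delta>T nn by (auto intro: mult_left_mono)
    then have "(2 * circ_const + 4 * corr_const) * X + (fresh_const * (\<theta> * \<delta> * T) + 4 * sqrt (L * (L + Q\<^sup>2 * (\<theta> * T)))) + \<theta> * (size_const * (\<delta> * T))
      \<le> (2 * circ_const + 4 * corr_const) * X + (fresh_const * (2 * X) + 4 * ((12 + 4 * Q) * X)) + size_const * (2 * X)"
      using sq unfolding eq by linarith
    also have "\<dots> = (error_const * e) * (\<Lambda> * (\<theta> * T))" by (simp add: error_const_def X_def algebra_simps)
    also have "\<dots> \<le> 1 / (1200 * C * real K ^ (2 * k)) * (\<Lambda> * (\<theta> * T))"
      using ee \<Lambda> \<theta>T by (intro mult_right_mono) auto
    also have "\<dots> = 1 / (1200 * C) * (\<theta> * \<Lambda> * T / real K ^ (2 * k))" by (simp add: mult_ac)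
    also have "\<dots> \<le> 1 / (1200 * C) * (gap * N0)"
      using gap_N0_ge C unfolding \<Lambda>_def by (intro mult_left_mono) auto
    finally show ?thesis by simp
  qed
  show ?thesis
  proof (rule recovery[OF N S _ _ C \<theta>4 i j])
    have "size_const * (\<delta> * T) \<le> size_const * (2 * e * T)"
    proof -
      have "\<delta> \<le> 2 * e" using \<delta> \<Lambda> e mult_left_le[of \<Lambda> e] by linarith
      then show ?thesis using nn T_pos by (intro mult_left_mono mult_right_mono) auto
    qed
    also have "\<dots> = (2 * size_const) * e * T" by simp
    also have "\<dots> \<le> error_const * e * T" using nn e T_pos by (intro mult_right_mono) auto
    also have "\<dots> \<le> 1 / 2 * T"
    proof (rule mult_right_mono)
      have "2 \<le> 1200 * C * real K ^ (2 * k)" using C K2k mult_mono[of 2 "1200 * C" 1 "real K ^ (2 * k)"] by simp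
      then have "1 / (1200 * C * real K ^ (2 * k)) \<le> 1 / 2" by (intro divide_left_mono) auto
      then show "error_const * e \<le> 1 / 2" using ee by simp
    qed (use T_pos in simp)
    also have "\<dots> \<le> N0 / 2"
      using deg_power_bounds(1)[of k] D_ge mult_mono[of "D ^ k" "deg ^ k" "D ^ k" "deg ^ k"] by (simp add: T_def N0_eq)
    finally show "size_const * (\<delta> * T) \<le> N0 / 2" .
  qed (use err in \<open>simp_all add: X_def\<close>)
qed

lemma corr_error_le:
  fixes e :: real
  defines "\<Lambda> \<equiv> ((\<theta> - \<rho>) / \<theta>) ^ (2 * k + 1)"
  assumes depletion: "D ^ k / real n \<le> e * \<Lambda>" and fluctuation: "sqrt (ln (real n) / D) \<le> e * \<Lambda>"
    and correction: "D ^ k * sqrt (ln (real n) / D) \<le> e * \<Lambda> * (\<theta> * T)"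
  shows "\<delta> * (D ^ k + \<theta> * T) \<le> 4 * (e * \<Lambda> * (\<theta> * T))"
proof -
  have \<theta>T: "0 < \<theta> * T" using theta_pos T_pos by simp
  have "\<delta> \<le> 2 * (e * \<Lambda>)" using depletion fluctuation by (simp add: \<delta>_def)
  then have 1: "\<delta> * (\<theta> * T) \<le> 2 * (e * \<Lambda> * (\<theta> * T))"
    using mult_right_mono[of \<delta> "2 * (e * \<Lambda>)" "\<theta> * T"] \<theta>T by simp
  \<comment> \<open>If \<theta> D^k \<ge> 1, the factor D^k is dominated by \<theta> T and depletion
    suffices. Otherwise D^(k+1) < n, so the depletion is below 1/D and hence below the
    fluctuation.\<close>
  have 2: "D ^ k / real n * D ^ k \<le> e * \<Lambda> * (\<theta> * T)"
  proof (cases "1 \<le> \<theta> * D ^ k")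
    case True
    then have "D ^ k / real n * D ^ k * 1 \<le> D ^ k / real n * D ^ k * (\<theta> * D ^ k)"
      using D_ge n_pos by (intro mult_left_mono) auto
    also have "\<dots> = D ^ k / real n * (\<theta> * T)" by (simp add: T_def)
    also have "\<dots> \<le> e * \<Lambda> * (\<theta> * T)" using depletion \<theta>T by (intro mult_right_mono) auto
    finally show ?thesis by simp
  next
    case False
    then have "D * D ^ k \<le> real n" using n_pos by (simp add: D_def mult.assoc)
    then have "D ^ k / real n \<le> 1 / D" using n_pos D_ge by (simp add: divide_simps mult.commute)
    also have "\<dots> \<le> sqrt (ln (real n) / D)"
    proof (rule real_le_rsqrt)
      have "1 * 1 \<le> ln (real n) * D" using ln1 D_ge by (intro mult_mono) auto
      then show "(1 / D)\<^sup>2 \<le> ln (real n) / D" using D_ge by (simp add: power2_eq_square divide_simps)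
    qed
    finally have "D ^ k / real n * D ^ k \<le> sqrt (ln (real n) / D) * D ^ k" using D_ge by (intro mult_right_mono) auto
    then show ?thesis using correction by (simp add: mult.commute)
  qed
  have "\<delta> * (D ^ k + \<theta> * T) = D ^ k * sqrt (ln (real n) / D) + D ^ k / real n * D ^ k + \<delta> * (\<theta> * T)"
    by (simp add: \<delta>_def algebra_simps)
  then show ?thesis using 1 2 correction by linarith
qed

end

section \<open>From the good event to the success probability\<close>

context sbm_graph
begin

definition failure_const :: "nat \<Rightarrow> real" where
  "failure_const k = 2 * (real K * real k * real K + real K * real k + real K * real K * real (Suc k) + real K * real K * (real k * real k))"

lemma prob_recovery:
  assumes ln1: "1 \<le> ln (real n)"
    and success: "\<And>G i j. good k (3 * ln (real n)) G \<Longrightarrow> i \<in> V \<Longrightarrow> j \<in> V \<Longrightarrow> alg V (adj_matrix G) t i j = true_W z i j"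
  shows "1 - failure_const k / real n \<le>
    measure_pmf.prob (SBM n K \<theta> \<rho> z) {Y. \<forall>i\<in>V. \<forall>j\<in>V. alg V Y t i j = true_W z i j}"
proof -
  have n1: "1 \<le> real n" using ln1 by (cases "n = 0") auto
  have "prob {G. \<not> good k (3 * ln (real n)) G} \<le> failure_const k / real n"
  proof -
    have exp: "exp (- (3 * ln (real n))) = 1 / real n ^ 3"
    proof -
      have "exp (3 * ln (real n)) = real n ^ 3" using n1 exp_of_nat_mult[of 3 "ln (real n)"] by simp
      then show ?thesis by (simp add: exp_minus divide_inverse)
    qed
    have "prob {G. \<not> good k (3 * ln (real n)) G} \<le>
      (real (n * K * (k * K)) + real (n * K * k) + real (n * K * (n * K * Suc k)) + real (n * K * (n * K * (k * k)))) * (2 * exp (- (3 * ln (real n))))"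
      by (rule prob_not_good) (use ln1 in simp)
    also have "\<dots> \<le> ((real n)\<^sup>2 * (failure_const k / 2)) * (2 * exp (- (3 * ln (real n))))"
    proof (rule mult_right_mono)
      have F: "failure_const k / 2 =
          real K * real k * real K + real K * real k + real K * real K * real (Suc k) + real K * real K * (real k * real k)"
        unfolding failure_const_def by simp
      have nn: "real n \<le> (real n)\<^sup>2" using n1 by (simp add: power2_eq_square mult_le_cancel_left1)
      have "real (n * K * (k * K)) \<le> (real n)\<^sup>2 * (real K * real k * real K)"
        "real (n * K * k) \<le> (real n)\<^sup>2 * (real K * real k)"
        using mult_right_mono[OF nn, of "real K * real k * real K"] mult_right_mono[OF nn, of "real K * real k"] by (simp_all add: mult_ac)
      moreover have "real (n * K * (n * K * Suc k)) = (real n)\<^sup>2 * (real K * real K * real (Suc k))"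
        "real (n * K * (n * K * (k * k))) = (real n)\<^sup>2 * (real K * real K * (real k * real k))"
        by (simp_all only: of_nat_mult power2_eq_square mult_ac)
      ultimately show "real (n * K * (k * K)) + real (n * K * k) + real (n * K * (n * K * Suc k)) + real (n * K * (n * K * (k * k)))
         \<le> (real n)\<^sup>2 * (failure_const k / 2)"
        unfolding F distrib_left by linarith
    qed simp
    also have "\<dots> = failure_const k / real n" unfolding exp using n1 by (simp add: power2_eq_square power3_eq_cube)
    finally show ?thesis .
  qed
  moreover have "prob {G. \<not> good k (3 * ln (real n)) G} = 1 - prob {G. good k (3 * ln (real n)) G}"
    by (subst measure_pmf.prob_compl[symmetric]) (auto intro!: arg_cong[where f = prob])
  ultimately have "1 - failure_const k / real n \<le> prob {G. good k (3 * ln (real n)) G}" by simp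
  also have "\<dots> \<le> prob {G. \<forall>i\<in>V. \<forall>j\<in>V. alg V (adj_matrix G) t i j = true_W z i j}"
    by (intro measure_pmf.finite_measure_mono Collect_mono impI ballI success) auto
  also have "\<dots> = measure_pmf.prob (SBM n K \<theta> \<rho> z) {Y. \<forall>i\<in>V. \<forall>j\<in>V. alg V Y t i j = true_W z i j}"
    unfolding SBM_eq measure_map_pmf by (simp add: vimage_def)
  finally show ?thesis .
qed

end

section \<open>Reduction to monomial rates\<close>

text \<open>Monomials in \<theta>, n and ln n are represented by their exponents, so that comparing
  rates becomes arithmetic on three numbers.\<close>

definition monom3 :: "real \<Rightarrow> real \<Rightarrow> real \<Rightarrow> real \<Rightarrow> real \<Rightarrow> real \<Rightarrow> real" where
  "monom3 t n l u v w = t powr u * n powr v * l powr w"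

lemma monom3_mult:
  "monom3 t n l u v w * monom3 t n l u' v' w' = monom3 t n l (u + u') (v + v') (w + w')"
  by (simp add: monom3_def powr_add mult_ac)

lemma monom3_powr:
  "0 < t \<Longrightarrow> 0 < n \<Longrightarrow> 0 < l \<Longrightarrow> monom3 t n l u v w powr p = monom3 t n l (u * p) (v * p) (w * p)"
  by (simp add: monom3_def powr_mult powr_powr)

lemma monom3_power:
  "0 < t \<Longrightarrow> 0 < n \<Longrightarrow> 0 < l \<Longrightarrow> monom3 t n l u v w ^ m = monom3 t n l (u * real m) (v * real m) (w * real m)"
  by (simp add: monom3_def power_mult_distrib powr_power mult.commute)

lemma monom3_pos: "0 < t \<Longrightarrow> 0 < n \<Longrightarrow> 0 < l \<Longrightarrow> 0 < monom3 t n l u v w"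
  by (simp add: monom3_def)

text \<open>The bound is divided by \<open>t\<close> and raised to the power m. For m = 2k + 1 a
  lower bound on \<theta> - \<rho> becomes one on \<Lambda>.\<close>

lemma monom3_lower:
  assumes pos: "0 < t" "0 < n" "0 < l" and x: "monom3 t n l u v w \<le> c * x" and a: "a = real m"
  shows "monom3 t n l (u * a - a) (v * a) (w * a) \<le> c ^ m * (x / t) ^ m"
proof -
  have "monom3 t n l u v w ^ m \<le> (c * x) ^ m"
    using x monom3_pos[OF pos] by (intro power_mono) (auto intro: less_imp_le)
  then have *: "monom3 t n l (u * a) (v * a) (w * a) * monom3 t n l (- a) 0 0 \<le> (c * x) ^ m * monom3 t n l (- a) 0 0"
    unfolding monom3_power[OF pos] a using monom3_pos[OF pos] by (intro mult_right_mono) (auto intro: less_imp_le)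
  have "monom3 t n l (- a) 0 0 = 1 / t ^ m"
    using pos by (simp add: monom3_def a powr_minus_divide powr_realpow)
  then have "(c * x) ^ m * monom3 t n l (- a) 0 0 = c ^ m * (x / t) ^ m"
    by (simp add: power_mult_distrib power_divide)
  with * show ?thesis by (simp add: monom3_mult)
qed

text \<open>The absolute values keep this positive, since the signs of the two constants are known only
  inside the locale.\<close>

definition rate_const :: "nat \<Rightarrow> nat \<Rightarrow> real \<Rightarrow> real" where
  "rate_const K k C = 1 / (1 + \<bar>2 * good_graph.M K k k\<bar> + \<bar>1200 * C * real K ^ (2 * k) * concentrated_graph.error_const K k\<bar>)"

lemma rate_const_bounds:
  "0 < rate_const K k C" "rate_const K k C \<le> 1"
  "2 * good_graph.M K k k * rate_const K k C \<le> 1"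
  "1200 * C * real K ^ (2 * k) * concentrated_graph.error_const K k * rate_const K k C \<le> 1"
proof -
  have *: "0 < 1 + \<bar>a\<bar> + \<bar>b\<bar>" "1 / (1 + \<bar>a\<bar> + \<bar>b\<bar>) \<le> 1" "a * (1 / (1 + \<bar>a\<bar> + \<bar>b\<bar>)) \<le> 1" "b * (1 / (1 + \<bar>a\<bar> + \<bar>b\<bar>)) \<le> 1"
    for a b :: real
  proof -
    show p: "0 < 1 + \<bar>a\<bar> + \<bar>b\<bar>" by simp
    show "1 / (1 + \<bar>a\<bar> + \<bar>b\<bar>) \<le> 1" "a * (1 / (1 + \<bar>a\<bar> + \<bar>b\<bar>)) \<le> 1" "b * (1 / (1 + \<bar>a\<bar> + \<bar>b\<bar>)) \<le> 1"
      using p by (auto simp: pos_divide_le_eq)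
  qed
  show "0 < rate_const K k C" "rate_const K k C \<le> 1"
    "2 * good_graph.M K k k * rate_const K k C \<le> 1"
    "1200 * C * real K ^ (2 * k) * concentrated_graph.error_const K k * rate_const K k C \<le> 1"
    unfolding rate_const_def using * by auto
qed

lemma ln_ge_1: "1 \<le> ln (real n)" if "16 \<le> n" for n :: nat
proof -
  have "exp 1 \<le> real n" using exp_le that by linarith
  then show ?thesis using that by (subst ln_ge_iff) auto
qed

text \<open>The bound 16 on n gives ln n \<ge> 1 and, together with n \<theta>^2 \<le> 1, the
  \<theta> \<le> 1/4 that \<open>recovery\<close> demands.\<close>

locale regime = sbm_graph +
  fixes k :: nat and C :: real
  assumes k2: "2 \<le> k" and K2: "2 \<le> K" and C: "1 < C" "\<theta> \<le> C * \<rho>" and n16: "16 \<le> n"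
    and rate1: "rate1 k \<theta> n < rate_const K k C * (\<theta> - \<rho>)"
begin

text \<open>What the constant of the rates becomes when they are raised to the power 2k + 1.\<close>

definition e :: real where "e = rate_const K k C ^ (2 * k + 1)"
definition \<Lambda> :: real where "\<Lambda> = ((\<theta> - \<rho>) / \<theta>) ^ (2 * k + 1)"

abbreviation DD :: real where "DD \<equiv> real n * \<theta>"
abbreviation mon :: "real \<Rightarrow> real \<Rightarrow> real \<Rightarrow> real" where "mon \<equiv> monom3 \<theta> (real n) (ln (real n))"

lemma n_real: "16 \<le> real n"
  using n16 by simp

lemma ln1: "1 \<le> ln (real n)"
  using n16 by (rule ln_ge_1)

lemma pos: "0 < \<theta>" "0 < real n" "0 < ln (real n)"
  using theta_pos n_real ln1 by auto

lemma e_bounds: "0 < e" "e \<le> 1" "e \<le> rate_const K k C"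
proof -
  show "0 < e" using rate_const_bounds(1) by (simp add: e_def)
  show "e \<le> 1" unfolding e_def using rate_const_bounds(1,2)[of K k C] by (intro power_le_one) auto
  have "rate_const K k C ^ (2 * k + 1) \<le> rate_const K k C ^ 1"
    using rate_const_bounds(1,2)[of K k C] by (intro power_decreasing) auto
  then show "e \<le> rate_const K k C" by (simp add: e_def)
qed

lemma \<Lambda>_bounds: "0 \<le> \<Lambda>" "\<Lambda> \<le> 1"
proof -
  have "0 \<le> (\<theta> - \<rho>) / \<theta>" "(\<theta> - \<rho>) / \<theta> \<le> 1" using theta_pos rho_pos rho_less by auto
  then show "0 \<le> \<Lambda>" "\<Lambda> \<le> 1"
    unfolding \<Lambda>_def by (blast intro: zero_le_power power_le_one)+
qed

lemma mon_le_rate: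
  assumes "mon u v w \<le> rate_const K k C * (\<theta> - \<rho>)"
  shows "mon ((u - 1) * (2 * real k + 1)) (v * (2 * real k + 1)) (w * (2 * real k + 1)) \<le> e * \<Lambda>"
  using monom3_lower[OF pos assms, of "2 * real k + 1" "2 * k + 1"]
  by (simp add: e_def \<Lambda>_def left_diff_distrib)

lemma D_power_mon: "DD ^ m = mon (real m) (real m) 0"
  using pos by (simp add: monom3_def power_mult_distrib powr_realpow)

lemma sqrt_ln_D_mon: "sqrt (ln (real n) / DD) = mon (- (1 / 2)) (- (1 / 2)) (1 / 2)"
proof -
  have "mon (- (1 / 2)) (- (1 / 2)) (1 / 2) = ln (real n) powr (1 / 2) / (\<theta> powr (1 / 2) * real n powr (1 / 2))"
    by (simp add: monom3_def powr_minus_divide)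
  then show ?thesis using pos by (simp add: powr_half_sqrt real_sqrt_divide real_sqrt_mult mult.commute)
qed

lemma \<theta>T_mon: "\<theta> * (DD ^ k * DD ^ k) = mon (2 * real k + 1) (2 * real k) 0"
proof -
  have "\<theta> = mon 1 0 0" using pos by (simp add: monom3_def)
  then have "\<theta> * (DD ^ k * DD ^ k) = mon 1 0 0 * (mon (real k) (real k) 0 * mon (real k) (real k) 0)"
    unfolding D_power_mon by simp
  then show ?thesis by (simp add: monom3_mult ac_simps)
qed

text \<open>Divided by \<theta> and raised to the power 2k + 1, these two summands become
  \<open>depletion\<close> and \<open>fluctuation\<close>.\<close>

lemma rate1_parts:
  "mon ((3 * real k + 1) / (2 * real k + 1)) ((real k - 1) / (2 * real k + 1)) 0 \<le> rate_const K k C * (\<theta> - \<rho>)"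
  "mon ((4 * real k + 1) / (4 * real k + 2)) (- (1 / (4 * real k + 2))) (1 / (4 * real k + 2)) \<le> rate_const K k C * (\<theta> - \<rho>)"
proof -
  let ?A = "mon ((3 * real k + 1) / (2 * real k + 1)) ((real k - 1) / (2 * real k + 1)) 0"
  let ?B = "mon ((4 * real k + 1) / (4 * real k + 2)) (- (1 / (4 * real k + 2))) (1 / (4 * real k + 2))"
  have "rate1 k \<theta> n = ?A + ?B" using pos by (simp add: rate1_def monom3_def)
  then show "?A \<le> rate_const K k C * (\<theta> - \<rho>)" "?B \<le> rate_const K k C * (\<theta> - \<rho>)"
    using rate1 monom3_pos[OF pos] by (smt (verit))+
qed

lemma depletion: "DD ^ k / real n \<le> e * \<Lambda>"
proof -
  have "DD ^ k / real n = mon (real k) (real k) 0 * mon 0 (- 1) 0"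
    unfolding D_power_mon using pos by (simp add: monom3_def powr_minus_divide)
  also have "\<dots> = mon (((3 * real k + 1) / (2 * real k + 1) - 1) * (2 * real k + 1)) ((real k - 1) / (2 * real k + 1) * (2 * real k + 1)) (0 * (2 * real k + 1))"
    unfolding monom3_mult by (rule arg_cong3[where f = mon]) (auto simp: divide_simps)
  also have "\<dots> \<le> e * \<Lambda>" by (rule mon_le_rate[OF rate1_parts(1)])
  finally show ?thesis .
qed

lemma fluctuation: "sqrt (ln (real n) / DD) \<le> e * \<Lambda>"
proof -
  have "sqrt (ln (real n) / DD) = mon (((4 * real k + 1) / (4 * real k + 2) - 1) * (2 * real k + 1)) (- (1 / (4 * real k + 2)) * (2 * real k + 1)) (1 / (4 * real k + 2) * (2 * real k + 1))"
    unfolding sqrt_ln_D_mon by (rule arg_cong3[where f = mon]) (auto simp: divide_simps)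
  also have "\<dots> \<le> e * \<Lambda>" by (rule mon_le_rate[OF rate1_parts(2)])
  finally show ?thesis .
qed

lemma e\<Lambda>_le: "e * \<Lambda> \<le> 1"
  using e_bounds \<Lambda>_bounds by (intro mult_le_one) auto

text \<open>\<open>e * \<Lambda> \<le> 1\<close> makes both relative errors at most 1. With k \<ge>
  2 this gives D^2 \<le> n, from which the bounds on \<theta> follow.\<close>

lemma D_facts: "ln (real n) \<le> DD" "1 \<le> DD" "DD ^ k \<le> real n" "DD * DD \<le> real n" "\<theta> \<le> 1 / 4"
  "ln (real n) * \<theta> \<le> 2"
proof -
  have D0: "0 < DD" using pos by simp
  have "sqrt (ln (real n) / DD) \<le> 1" using fluctuation e\<Lambda>_le by linarith
  then show 1: "ln (real n) \<le> DD" using D0 by (simp add: pos_divide_le_eq)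
  then show 2: "1 \<le> DD" using ln1 by linarith
  have "DD ^ k / real n \<le> 1" using depletion e\<Lambda>_le by linarith
  then show 3: "DD ^ k \<le> real n" using pos by (simp add: pos_divide_le_eq)
  have "DD ^ 2 \<le> DD ^ k" using 2 k2 by (intro power_increasing) auto
  then show 4: "DD * DD \<le> real n" using 3 by (simp add: power2_eq_square)
  then have 5: "real n * (\<theta> * \<theta>) \<le> 1" using pos by (simp add: mult_ac)
  then have "16 * (\<theta> * \<theta>) \<le> 1" using mult_right_mono[OF n_real, of "\<theta> * \<theta>"] by simp
  then have "(4 * \<theta>)\<^sup>2 \<le> 1\<^sup>2" by (simp add: power2_eq_square)
  then have "4 * \<theta> \<le> 1" by (rule power2_le_imp_le) simp
  then show "\<theta> \<le> 1 / 4" by simp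
  have "(sqrt (real n) * \<theta>)\<^sup>2 = real n * (\<theta> * \<theta>)"
    unfolding power_mult_distrib using pos by (simp add: power2_eq_square[of \<theta>])
  then have "(sqrt (real n) * \<theta>)\<^sup>2 \<le> 1\<^sup>2" using 5 by simp
  then have sq: "sqrt (real n) * \<theta> \<le> 1" by (rule power2_le_imp_le) simp
  have "ln (real n) = 2 * ln (sqrt (real n))" using pos by (simp add: ln_sqrt)
  also have "\<dots> \<le> 2 * sqrt (real n)" using ln_le_minus_one[of "sqrt (real n)"] pos by simp
  finally have "ln (real n) * \<theta> \<le> 2 * sqrt (real n) * \<theta>" using pos by (intro mult_right_mono) auto
  then show "ln (real n) * \<theta> \<le> 2" using sq by simp
qed

lemma concentrated:
  assumes "good k (3 * ln (real n)) G"
  shows "concentrated_graph n K \<theta> \<rho> z k G"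
proof -
  interpret good_graph n K \<theta> \<rho> z k G
    by unfold_locales (use assms k2 K2 ln1 D_facts in auto)
  have "\<delta> \<le> 2 * (e * \<Lambda>)" using depletion fluctuation by (simp add: \<delta>_def D_def)
  moreover have "e * \<Lambda> \<le> e * 1" using e_bounds \<Lambda>_bounds by (intro mult_left_mono) auto
  ultimately have "\<delta> \<le> 2 * rate_const K k C" using e_bounds by linarith
  then have "M k * \<delta> \<le> M k * (2 * rate_const K k C)" by (rule mult_left_mono[OF _ M_nonneg])
  then show ?thesis using rate_const_bounds(3)[of K k C] by unfold_locales (simp add: mult_ac)
qed

lemma e_const: "1200 * C * real K ^ (2 * k) * concentrated_graph.error_const K k * e \<le> 1"
proof (cases "0 \<le> concentrated_graph.error_const K k")
  case True
  then have "1200 * C * real K ^ (2 * k) * concentrated_graph.error_const K k * e \<le>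
      1200 * C * real K ^ (2 * k) * concentrated_graph.error_const K k * rate_const K k C"
    using e_bounds C by (intro mult_left_mono) auto
  then show ?thesis using rate_const_bounds(4)[of C K k] by simp
next
  case False
  then have "1200 * C * real K ^ (2 * k) * concentrated_graph.error_const K k * e \<le> 0"
    using e_bounds C by (intro mult_nonpos_nonneg mult_nonneg_nonpos) auto
  then show ?thesis by linarith
qed

lemma output_correct:
  assumes good: "good k (3 * ln (real n)) G"
    and noise: "sqrt (ln (real n) * \<theta>) * DD ^ k \<le> 2 * (e * \<Lambda> * (\<theta> * (DD ^ k * DD ^ k)))"
    and N: "\<And>i j. i \<in> V \<Longrightarrow> j \<in> V \<Longrightarrow> \<bar>N i j - concentrated_graph.N0 n K \<theta> \<rho> k\<bar> \<le>
       concentrated_graph.size_const K k * (good_graph.\<delta> n \<theta> k * (DD ^ k * DD ^ k))"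
    and S: "\<And>i j. i \<in> V \<Longrightarrow> j \<in> V \<Longrightarrow> \<bar>S i j - concentrated_graph.fresh n K G i j k\<bar> \<le>
       (2 * concentrated_graph.circ_const K k + 4 * concentrated_graph.corr_const K k) * (e * \<Lambda> * (\<theta> * (DD ^ k * DD ^ k)))"
    and i: "i \<in> V" and j: "j \<in> V"
  shows "test_output S N (tuned_threshold K k n \<theta> \<rho>) i j = true_W z i j"
proof -
  interpret cg: concentrated_graph n K \<theta> \<rho> z k G by (rule concentrated[OF good])
  have T: "cg.T = DD ^ k * DD ^ k" by (simp add: cg.T_def cg.D_def)
  show ?thesis
    by (rule cg.recovery_rate[of e C N S, OF e_bounds(1,2) e_const, folded \<Lambda>_def, unfolded T cg.D_def])
      (use depletion fluctuation noise C D_facts N S i j in auto)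
qed

text \<open>The form in which the second rates are used: the bound is by the absolute error budget e
  \<Lambda> \<theta> T instead of the relative one.\<close>

lemma mon_times_T:
  assumes "mon u v w \<le> rate_const K k C * (\<theta> - \<rho>)"
    and "u' = u * (2 * real k + 1)" "v' = v * (2 * real k + 1) + 2 * real k" "w' = w * (2 * real k + 1)"
  shows "mon u' v' w' \<le> e * \<Lambda> * (\<theta> * (DD ^ k * DD ^ k))"
proof -
  have "mon u' v' w' = mon ((u - 1) * (2 * real k + 1)) (v * (2 * real k + 1)) (w * (2 * real k + 1))
      * mon (2 * real k + 1) (2 * real k) 0"
    unfolding monom3_mult by (rule arg_cong3[where f = mon]) (simp_all add: assms(2-4) left_diff_distrib)
  also have "\<dots> \<le> e * \<Lambda> * mon (2 * real k + 1) (2 * real k) 0"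
    by (intro mult_right_mono mon_le_rate assms(1)) (use monom3_pos[OF pos] in \<open>auto intro: less_imp_le\<close>)
  finally show ?thesis unfolding \<theta>T_mon .
qed

lemma DD_sqrt_mon: "DD ^ k * sqrt (ln (real n) / DD) = mon (real k - 1 / 2) (real k - 1 / 2) (1 / 2)"
  unfolding D_power_mon sqrt_ln_D_mon monom3_mult by simp

lemma noise_mon: "sqrt (ln (real n) * \<theta>) * DD ^ k = mon (real k + 1 / 2) (real k) (1 / 2)"
proof -
  have "sqrt (ln (real n) * \<theta>) = mon (1 / 2) 0 (1 / 2)"
    using pos by (simp add: monom3_def powr_half_sqrt real_sqrt_mult)
  then show ?thesis unfolding D_power_mon by (simp add: monom3_mult add.commute)
qed

text \<open>\<open>rate2_circ\<close> fits the bias D^k into the error budget. The noise is at most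
  of the same order because \<theta> ln n \<le> 2, which is why this rate has no logarithm.\<close>

lemma circ_correct:
  assumes rate2: "rate2_circ k \<theta> n \<le> rate_const K k C * (\<theta> - \<rho>)"
    and good: "good k (3 * ln (real n)) G" and i: "i \<in> V" and j: "j \<in> V"
  shows "AWCD_circ k V (adj_matrix G) (tuned_threshold K k n \<theta> \<rho>) i j = true_W z i j"
proof -
  interpret cg: concentrated_graph n K \<theta> \<rho> z k G by (rule concentrated[OF good])
  let ?X = "e * \<Lambda> * (\<theta> * (DD ^ k * DD ^ k))"
  have "rate2_circ k \<theta> n = mon (real k / (2 * real k + 1)) (- (real k / (2 * real k + 1))) 0"
    using pos by (simp add: rate2_circ_def monom3_def)
  then have revealed: "DD ^ k \<le> ?X"
    unfolding D_power_mon[of k] using rate2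
    by (intro mon_times_T[of "real k / (2 * real k + 1)" "- (real k / (2 * real k + 1))" 0, unfolded D_power_mon[of k]])
      (auto simp: divide_simps)
  have noise: "sqrt (ln (real n) * \<theta>) * DD ^ k \<le> 2 * ?X"
  proof -
    have "sqrt (ln (real n) * \<theta>) \<le> sqrt (2\<^sup>2)" using D_facts(6) by (intro real_sqrt_le_mono) simp
    then have "sqrt (ln (real n) * \<theta>) * DD ^ k \<le> 2 * DD ^ k" using D_facts(2) by (intro mult_right_mono) auto
    then show ?thesis using revealed by linarith
  qed
  show ?thesis
    unfolding AWCD_circ_def
  proof (rule output_correct[OF good noise _ _ i j])
    fix a b assume ab: "a \<in> V" "b \<in> V"
    show "\<bar>N_circ k V (adj_matrix G) a b - cg.N0\<bar> \<le> cg.size_const * (cg.\<delta> * (DD ^ k * DD ^ k))"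
      using cg.N_circ_dev[OF ab] by (simp add: cg.T_def cg.D_def)
    have "\<bar>S_circ k V (adj_matrix G) a b - cg.fresh a b k\<bar> \<le> 2 * cg.circ_const * DD ^ k"
      using cg.S_circ_dev[OF ab] by (simp add: cg.D_def)
    also have "\<dots> \<le> (2 * cg.circ_const + 4 * cg.corr_const) * ?X"
      using revealed cg.consts_nonneg D_facts(2) by (intro mult_mono) auto
    finally show "\<bar>S_circ k V (adj_matrix G) a b - cg.fresh a b k\<bar> \<le> (2 * cg.circ_const + 4 * cg.corr_const) * ?X" .
  qed
qed

text \<open>\<open>rate2\<close> controls the bias D^k sqrt(ln n / D) left by the correction. The
  noise is no larger, as D^2 \<le> n means \<theta> \<le> 1/D.\<close>

lemma corr_correct:
  assumes rate2: "rate2 k \<theta> n \<le> rate_const K k C * (\<theta> - \<rho>)"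
    and good: "good k (3 * ln (real n)) G" and i: "i \<in> V" and j: "j \<in> V"
  shows "AWCD k V (adj_matrix G) (tuned_threshold K k n \<theta> \<rho>) i j = true_W z i j"
proof -
  interpret cg: concentrated_graph n K \<theta> \<rho> z k G by (rule concentrated[OF good])
  let ?X = "e * \<Lambda> * (\<theta> * (DD ^ k * DD ^ k))"
  have "rate2 k \<theta> n = mon ((2 * real k - 1) / (4 * real k + 2)) (- (1 / 2)) (1 / (4 * real k + 2))"
    by (simp add: rate2_def monom3_def)
  then have correction: "DD ^ k * sqrt (ln (real n) / DD) \<le> ?X"
    unfolding DD_sqrt_mon using rate2
    by (intro mon_times_T[of "(2 * real k - 1) / (4 * real k + 2)" "- (1 / 2)" "1 / (4 * real k + 2)"])
      (auto simp: field_simps)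
  have X: "0 \<le> ?X" using e_bounds \<Lambda>_bounds pos by (intro mult_nonneg_nonneg) auto
  have noise: "sqrt (ln (real n) * \<theta>) * DD ^ k \<le> 2 * ?X"
  proof -
    have "\<theta> \<le> 1 / DD" using D_facts(4) pos by (simp add: pos_le_divide_eq mult_ac)
    then have "ln (real n) * \<theta> \<le> ln (real n) * (1 / DD)" using pos by (intro mult_left_mono) auto
    then have "sqrt (ln (real n) * \<theta>) \<le> sqrt (ln (real n) / DD)" by (intro real_sqrt_le_mono) simp
    then have "sqrt (ln (real n) * \<theta>) * DD ^ k \<le> sqrt (ln (real n) / DD) * DD ^ k"
      using D_facts(2) by (intro mult_right_mono) auto
    also have "\<dots> \<le> ?X" using correction by (simp add: mult.commute)
    finally show ?thesis using X by linarith
  qed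
  show ?thesis
    unfolding AWCD_def
  proof (rule output_correct[OF good noise _ _ i j])
    fix a b assume ab: "a \<in> V" "b \<in> V"
    show "\<bar>N_circ k V (adj_matrix G) a b - cg.N0\<bar> \<le> cg.size_const * (cg.\<delta> * (DD ^ k * DD ^ k))"
      using cg.N_circ_dev[OF ab] by (simp add: cg.T_def cg.D_def)
    have "cg.\<delta> * (DD ^ k + \<theta> * (DD ^ k * DD ^ k)) \<le> 4 * ?X"
      using cg.corr_error_le[of e] depletion fluctuation correction by (simp add: cg.T_def cg.D_def \<Lambda>_def)
    then have "cg.corr_const * (cg.\<delta> * (DD ^ k + \<theta> * (DD ^ k * DD ^ k))) \<le> cg.corr_const * (4 * ?X)"
      using cg.consts_nonneg by (intro mult_left_mono)
    moreover have "\<bar>S_corr k V (adj_matrix G) a b - cg.fresh a b k\<bar> \<le> cg.corr_const * (cg.\<delta> * (DD ^ k + \<theta> * (DD ^ k * DD ^ k)))"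
      using cg.S_corr_dev[OF ab] by (simp add: cg.T_def cg.D_def)
    moreover have "0 \<le> 2 * cg.circ_const * ?X" by (rule mult_nonneg_nonneg[OF _ X]) (use cg.consts_nonneg in auto)
    ultimately show "\<bar>S_corr k V (adj_matrix G) a b - cg.fresh a b k\<bar> \<le> (2 * cg.circ_const + 4 * cg.corr_const) * ?X"
      unfolding distrib_right[of "2 * cg.circ_const"] by linarith
  qed
qed

text \<open>\<open>S_plus\<close> counts fresh edges only, so the bias is zero and
  \<open>rate2_plus\<close> just has to control the noise.\<close>

lemma plus_correct:
  assumes rate2: "rate2_plus k \<theta> n \<le> rate_const K k C * (\<theta> - \<rho>)"
    and good: "good k (3 * ln (real n)) G" and i: "i \<in> V" and j: "j \<in> V"
  shows "AWCD_plus k V (adj_matrix G) (tuned_threshold K k n \<theta> \<rho>) i j = true_W z i j"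
proof -
  interpret cg: concentrated_graph n K \<theta> \<rho> z k G by (rule concentrated[OF good])
  let ?X = "e * \<Lambda> * (\<theta> * (DD ^ k * DD ^ k))"
  have "rate2_plus k \<theta> n = mon (1 / 2) (- (real k / (2 * real k + 1))) (1 / (4 * real k + 2))"
    by (simp add: rate2_plus_def monom3_def)
  then have "sqrt (ln (real n) * \<theta>) * DD ^ k \<le> ?X"
    unfolding noise_mon using rate2
    by (intro mon_times_T[of "1 / 2" "- (real k / (2 * real k + 1))" "1 / (4 * real k + 2)"])
      (auto simp: field_simps)
  moreover have X: "0 \<le> ?X" using e_bounds \<Lambda>_bounds pos by (intro mult_nonneg_nonneg) auto
  ultimately have noise: "sqrt (ln (real n) * \<theta>) * DD ^ k \<le> 2 * ?X" by linarith
  show ?thesis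
    unfolding AWCD_plus_def
  proof (rule output_correct[OF good noise _ _ i j])
    fix a b assume ab: "a \<in> V" "b \<in> V"
    show "\<bar>N_plus k V (adj_matrix G) a b - cg.N0\<bar> \<le> cg.size_const * (cg.\<delta> * (DD ^ k * DD ^ k))"
      using cg.N_plus_dev[OF ab] by (simp add: cg.T_def cg.D_def)
    have "0 \<le> (2 * cg.circ_const + 4 * cg.corr_const) * ?X" by (rule mult_nonneg_nonneg[OF _ X]) (use cg.consts_nonneg in auto)
    then show "\<bar>S_plus k V (adj_matrix G) a b - cg.fresh a b k\<bar> \<le> (2 * cg.circ_const + 4 * cg.corr_const) * ?X"
      by (simp add: cg.S_plus_eq[OF ab])
  qed
qed

end

text \<open>The bound must be uniform in the labelling, since the thresholds are fixed before the
  labellings are chosen.\<close>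

lemma consistent_exact_recoveryI:
  assumes ev: "\<forall>\<^sub>F n in sequentially. \<forall>z. community_labelling n K z \<longrightarrow>
    1 - F / real n \<le> measure_pmf.prob (SBM n K (\<theta> n) (\<rho> n) z)
      {Y. \<forall>i\<in>vertices n K. \<forall>j\<in>vertices n K. alg (vertices n K) Y (t n) i j = true_W z i j}"
  shows "consistent_exact_recovery alg K \<theta> \<rho>"
  unfolding consistent_exact_recovery_def
proof (intro exI[of _ t] allI impI)
  fix z assume z: "\<forall>n. community_labelling n K (z n)"
  have "(\<lambda>n. 1 - F / real n) \<longlonglongrightarrow> 1 - 0"
    by (intro tendsto_diff tendsto_const lim_const_over_n)
  then have lim: "(\<lambda>n. 1 - F / real n) \<longlonglongrightarrow> 1" by simp
  show "(\<lambda>n. measure_pmf.prob (SBM n K (\<theta> n) (\<rho> n) (z n))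
      {Y. \<forall>i\<in>vertices n K. \<forall>j\<in>vertices n K. alg (vertices n K) Y (t n) i j = true_W (z n) i j}) \<longlonglongrightarrow> 1"
    by (rule tendsto_sandwich[OF _ _ lim tendsto_const])
      (use ev z in \<open>auto elim!: eventually_mono\<close>)
qed

text \<open>The bounded-ratio claim with the constant \<open>rate_const\<close>; the constant-ratio
  claim is reduced to it below.\<close>

lemma gap_regime_recovery:
  fixes K k :: nat and C :: real and \<theta> \<rho> :: "nat \<Rightarrow> real"
  assumes K: "K \<ge> 2" and k: "k \<ge> 2" and C: "C > 1"
    and par: "\<forall>n\<ge>1. 0 < \<rho> n \<and> \<rho> n < \<theta> n \<and> \<theta> n \<le> 1" and ratio: "\<forall>n\<ge>1. \<theta> n / \<rho> n \<le> C"
    and r1: "\<forall>\<^sub>F n in sequentially. rate1 k (\<theta> n) n < rate_const K k C * (\<theta> n - \<rho> n)"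
  shows "\<forall>\<^sub>F n in sequentially. rate2_circ k (\<theta> n) n < rate_const K k C * (\<theta> n - \<rho> n) \<Longrightarrow>
      consistent_exact_recovery (AWCD_circ k) K \<theta> \<rho>" (is "?r1 \<Longrightarrow> ?t1")
    and "\<forall>\<^sub>F n in sequentially. rate2 k (\<theta> n) n < rate_const K k C * (\<theta> n - \<rho> n) \<Longrightarrow>
      consistent_exact_recovery (AWCD k) K \<theta> \<rho>" (is "?r2 \<Longrightarrow> ?t2")
    and "\<forall>\<^sub>F n in sequentially. rate2_plus k (\<theta> n) n < rate_const K k C * (\<theta> n - \<rho> n) \<Longrightarrow>
      consistent_exact_recovery (AWCD_plus k) K \<theta> \<rho>" (is "?r3 \<Longrightarrow> ?t3")
proof -
  have regime: "regime n K (\<theta> n) (\<rho> n) z k C"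
    if "16 \<le> n" "rate1 k (\<theta> n) n < rate_const K k C * (\<theta> n - \<rho> n)" "community_labelling n K z" for n z
  proof -
    have "0 < \<rho> n \<and> \<rho> n < \<theta> n \<and> \<theta> n \<le> 1" "\<theta> n / \<rho> n \<le> C" using par ratio that(1) by auto
    then show ?thesis using that K k C by unfold_locales (auto simp: pos_divide_le_eq)
  qed
  have ev: "\<forall>\<^sub>F n in sequentially. 16 \<le> n \<and> rate1 k (\<theta> n) n < rate_const K k C * (\<theta> n - \<rho> n)"
    using r1 eventually_ge_at_top[of 16] by eventually_elim simp
  have gen: "consistent_exact_recovery alg K \<theta> \<rho>"
    if r: "\<forall>\<^sub>F n in sequentially. R n < rate_const K k C * (\<theta> n - \<rho> n)"
      and correct: "\<And>n z G i j. regime n K (\<theta> n) (\<rho> n) z k C \<Longrightarrow> R n \<le> rate_const K k C * (\<theta> n - \<rho> n) \<Longrightarrow>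
        sbm_graph.good n K (\<theta> n) (\<rho> n) z k (3 * ln (real n)) G \<Longrightarrow> i \<in> vertices n K \<Longrightarrow> j \<in> vertices n K \<Longrightarrow>
        alg (vertices n K) (adj_matrix G) (tuned_threshold K k n (\<theta> n) (\<rho> n)) i j = true_W z i j"
    for alg R
  proof (rule consistent_exact_recoveryI[where F = "sbm_graph.failure_const K k"])
    show "\<forall>\<^sub>F n in sequentially. \<forall>z. community_labelling n K z \<longrightarrow>
      1 - sbm_graph.failure_const K k / real n \<le> measure_pmf.prob (SBM n K (\<theta> n) (\<rho> n) z)
      {Y. \<forall>i\<in>vertices n K. \<forall>j\<in>vertices n K. alg (vertices n K) Y (tuned_threshold K k n (\<theta> n) (\<rho> n)) i j = true_W z i j}"
      using ev r
    proof eventually_elim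
      case (elim n)
      show ?case
      proof (intro allI impI)
        fix z assume "community_labelling n K z"
        then interpret regime n K "\<theta> n" "\<rho> n" z k C using elim by (intro regime) auto
        show "1 - failure_const k / real n \<le> measure_pmf.prob (SBM n K (\<theta> n) (\<rho> n) z)
          {Y. \<forall>i\<in>V. \<forall>j\<in>V. alg V Y (tuned_threshold K k n (\<theta> n) (\<rho> n)) i j = true_W z i j}"
        proof (rule prob_recovery[where alg = alg and t = "tuned_threshold K k n (\<theta> n) (\<rho> n)", OF ln1])
          fix G i j
          assume "good k (3 * ln (real n)) G" "i \<in> V" "j \<in> V"
          then show "alg V (adj_matrix G) (tuned_threshold K k n (\<theta> n) (\<rho> n)) i j = true_W z i j"
            using elim by (intro correct[OF regime_axioms]) auto
        qed
      qed
    qed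
  qed
  show "?r1 \<Longrightarrow> ?t1" by (rule gen) (auto intro: regime.circ_correct)
  show "?r2 \<Longrightarrow> ?t2" by (rule gen) (auto intro: regime.corr_correct)
  show "?r3 \<Longrightarrow> ?t3" by (rule gen) (auto intro: regime.plus_correct)
qed

text \<open>A target rate divided by \<open>t\<close> is a power p of the monomial bounded in the
  hypothesis, so a constant c there turns into c^p.\<close>

lemma monom3_scale:
  assumes pos: "0 < t" "0 < n" "0 < l" and le: "monom3 t n l u v w \<le> c" and p: "0 \<le> p" "c powr p \<le> b"
    and u': "u' = u * p + 1" "v' = v * p" "w' = w * p"
  shows "monom3 t n l u' v' w' \<le> b * t"
proof -
  have "monom3 t n l (u * p) (v * p) (w * p) = monom3 t n l u v w powr p"
    by (rule monom3_powr[OF pos, symmetric])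
  also have "\<dots> \<le> c powr p"
    using le p monom3_pos[OF pos, of u v w] by (intro powr_mono2) auto
  also have "\<dots> \<le> b" by (rule p)
  finally have "monom3 t n l (u * p) (v * p) (w * p) * t \<le> b * t" using pos by (intro mult_right_mono) auto
  moreover have "t = monom3 t n l 1 0 0" using pos by (simp add: monom3_def)
  then have "monom3 t n l (u * p) (v * p) (w * p) * t = monom3 t n l u' v' w'"
    using monom3_mult[of t n l "u * p" "v * p" "w * p" 1 0 0] u' by simp
  ultimately show ?thesis by simp
qed

section \<open>The regime of constant ratio\<close>

context
  fixes K k :: nat and C c \<kappa> :: real and \<theta> \<rho> :: "nat \<Rightarrow> real"
  assumes k: "2 \<le> k" and C: "1 < C"
    and \<kappa>: "\<kappa> = rate_const K k C * (1 - 1 / C)"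
    and c: "0 < c" "c \<le> 1" "c powr (real k / (2 * real k + 1)) \<le> \<kappa> / 2"
    and par: "\<forall>n\<ge>1. 0 < \<rho> n \<and> \<rho> n < \<theta> n \<and> \<theta> n \<le> 1" and ratio: "\<forall>n\<ge>1. \<theta> n / \<rho> n = C"
begin

lemma kappa_pos: "0 < \<kappa>"
  unfolding \<kappa> using rate_const_bounds(1) C by simp

lemma scaled_gap: "1 \<le> n \<Longrightarrow> rate_const K k C * (\<theta> n - \<rho> n) = \<kappa> * \<theta> n"
proof -
  assume "1 \<le> n"
  then have "0 < \<rho> n" "\<theta> n / \<rho> n = C" using par ratio by auto
  then have "\<rho> n = \<theta> n / C" using C by (auto simp: field_simps)
  then show ?thesis by (simp add: \<kappa> algebra_simps)
qed

text \<open>k/(2k+1) is the smallest exponent to which a bound by c is raised below; as c \<le> 1,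
  one smallness condition on c serves all.\<close>

lemma c_powr_le: "real k / (2 * real k + 1) \<le> p \<Longrightarrow> c powr p \<le> \<kappa> / 2"
  using powr_mono'[of "real k / (2 * real k + 1)" p c] c by linarith

lemma rate2_lt:
  assumes n: "16 \<le> n" and le: "monom3 (\<theta> n) (real n) (ln (real n)) u v w \<le> c"
    and p: "real k / (2 * real k + 1) \<le> p"
    and R: "R = monom3 (\<theta> n) (real n) (ln (real n)) u' v' w'" "u' = u * p + 1" "v' = v * p" "w' = w * p"
  shows "R < rate_const K k C * (\<theta> n - \<rho> n)"
proof -
  have \<theta>: "0 < \<theta> n" using par n by (metis less_trans one_le_numeral order.trans)
  have l: "0 < ln (real n)" using ln_ge_1[OF n] by linarith
  have "0 \<le> real k / (2 * real k + 1)" by simp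
  then have p0: "0 \<le> p" using p by (rule order.trans)
  have "R \<le> \<kappa> / 2 * \<theta> n"
    unfolding R(1) using \<theta> n l p0
    by (intro monom3_scale[OF _ _ _ le _ c_powr_le[OF p] R(2-4)]) auto
  also have "\<dots> < \<kappa> * \<theta> n" using kappa_pos \<theta> by simp
  finally show ?thesis using scaled_gap n by simp
qed

text \<open>The first summand is small by the upper bound on \<theta>, raised to the power k/(2k+1).
  The second is negligible for any constant: the lower bound gives n \<theta> \<ge> n^(1/(2k+1)), so
  ln n / (n \<theta>) tends to 0.\<close>

lemma rate1_lt:
  assumes up: "\<forall>\<^sub>F n in sequentially. \<theta> n < c * real n powr (- ((real k - 1) / real k))"
    and low: "\<forall>\<^sub>F n in sequentially. real n powr (- (2 * real k / (2 * real k + 1))) \<le> \<theta> n"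
  shows "\<forall>\<^sub>F n in sequentially. rate1 k (\<theta> n) n < rate_const K k C * (\<theta> n - \<rho> n)"
proof -
  \<comment> \<open>Inverts the exponent 1/(4k+2), so the second summand is at most \<kappa>
    \<theta> / 4; with \<kappa> \<theta> / 2 for the first, the sum stays below \<kappa>
    \<theta>.\<close>
  define \<beta> where "\<beta> = (\<kappa> / 4) powr (4 * real k + 2)"
  have \<beta>: "0 < \<beta>" using kappa_pos by (simp add: \<beta>_def)
  have "(\<lambda>n. ln (real n) / real n powr (1 / (2 * real k + 1))) \<longlonglongrightarrow> 0"
    by (rule lim_ln_over_power) simp
  then have small: "\<forall>\<^sub>F n in sequentially. ln (real n) / real n powr (1 / (2 * real k + 1)) < \<beta>"
    using \<beta> by (rule order_tendstoD)
  show ?thesis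
    using up low small eventually_ge_at_top[of 16]
  proof eventually_elim
    case (elim n)
    let ?m = "monom3 (\<theta> n) (real n) (ln (real n))"
    have pos: "0 < \<theta> n" "0 < real n" "0 < ln (real n)"
      using par elim(4) ln_ge_1[OF elim(4)] by (auto dest: spec[of _ n])
    have "?m 1 ((real k - 1) / real k) 0 \<le> c"
      using elim(1) pos by (simp add: monom3_def powr_minus_divide pos_less_divide_eq)
    then have A: "?m ((3 * real k + 1) / (2 * real k + 1)) ((real k - 1) / (2 * real k + 1)) 0 \<le> \<kappa> / 2 * \<theta> n"
      using k c by (intro monom3_scale[OF pos, where p = "real k / (2 * real k + 1)"]) (auto simp: field_simps)
    have "?m (- 1) (- 1) 1 \<le> \<beta>"
    proof -
      have "real n powr (1 / (2 * real k + 1)) = real n * real n powr (- (2 * real k / (2 * real k + 1)))"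
      proof -
        have "1 / (2 * real k + 1) = 1 + (- (2 * real k / (2 * real k + 1)))" by (simp add: field_simps)
        then show ?thesis using pos by (simp only: powr_add powr_one)
      qed
      also have "\<dots> \<le> real n * \<theta> n" using elim(2) by (intro mult_left_mono) auto
      finally have "ln (real n) / (real n * \<theta> n) \<le> ln (real n) / real n powr (1 / (2 * real k + 1))"
        using pos by (intro divide_left_mono) auto
      then show ?thesis using elim(3) pos by (simp add: monom3_def powr_minus_divide mult.commute)
    qed
    then have B: "?m ((4 * real k + 1) / (4 * real k + 2)) (- (1 / (4 * real k + 2))) (1 / (4 * real k + 2)) \<le> \<kappa> / 4 * \<theta> n"
      using kappa_pos
      by (intro monom3_scale[OF pos, where p = "1 / (4 * real k + 2)"]) (auto simp: \<beta>_def powr_powr field_simps)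
    have "rate1 k (\<theta> n) n \<le> \<kappa> / 2 * \<theta> n + \<kappa> / 4 * \<theta> n"
      using A B pos unfolding rate1_def monom3_def by simp
    also have "\<dots> < \<kappa> * \<theta> n" using kappa_pos pos by simp
    finally show ?case using scaled_gap elim(4) by simp
  qed
qed

text \<open>All three lower bounds on \<theta> imply this weakest power of n, since c \<le> 1 and
  the logarithm is at least 1.\<close>

lemma low_from_rate:
  assumes ev: "\<forall>\<^sub>F n in sequentially. c * \<theta> n > real n powr (- s) * ln (real n) powr w"
    and s: "s \<le> 2 * real k / (2 * real k + 1)" "0 \<le> w"
  shows "\<forall>\<^sub>F n in sequentially. real n powr (- (2 * real k / (2 * real k + 1))) \<le> \<theta> n"
  using ev eventually_ge_at_top[of 16]
proof eventually_elim
  case (elim n)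
  have "real n powr (- (2 * real k / (2 * real k + 1))) \<le> real n powr (- s) * 1"
    using elim(2) s by (simp add: powr_mono)
  also have "\<dots> \<le> real n powr (- s) * ln (real n) powr w"
    using ln_ge_1[OF elim(2)] s by (intro mult_left_mono ge_one_powr_ge_zero) auto
  also have "\<dots> \<le> c * \<theta> n" using elim(1) by simp
  also have "\<dots> \<le> \<theta> n"
    using c par elim(2) by (intro mult_left_le_one_le) (auto dest: spec[of _ n])
  finally show ?case .
qed

lemma rate_monom_le:
  assumes "16 \<le> n" "real n powr (- s) * ln (real n) powr w < c * \<theta> n"
  shows "monom3 (\<theta> n) (real n) (ln (real n)) (- 1) (- s) w \<le> c"
proof -
  have "0 < \<theta> n" using par assms(1) by (auto dest: spec[of _ n])
  have "monom3 (\<theta> n) (real n) (ln (real n)) (- 1) (- s) w = real n powr (- s) * ln (real n) powr w / \<theta> n"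
    using \<open>0 < \<theta> n\<close> by (simp add: monom3_def powr_minus_divide)
  then show ?thesis using less_imp_le[OF assms(2)] by (simp only: pos_divide_le_eq[OF \<open>0 < \<theta> n\<close>])
qed

end

theorem theorem2:
  fixes K k :: nat and C :: real
  assumes "K \<ge> 2" and "k \<ge> 2" and "C > 1"
  shows "\<exists>c::real. c > 0 \<and>
    (\<forall>\<theta> \<rho> :: nat \<Rightarrow> real. (\<forall>n\<ge>1. 0 < \<rho> n \<and> \<rho> n < \<theta> n \<and> \<theta> n \<le> 1) \<longrightarrow>
      ((\<forall>n\<ge>1. \<theta> n / \<rho> n = C) \<and>
       (\<forall>\<^sub>F n in sequentially. \<theta> n < c * real n powr (- ((real k - 1) / real k))) \<longrightarrow>
         ((\<forall>\<^sub>F n in sequentially.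
              c * \<theta> n > real n powr (- (real k / (real k + 1)))) \<longrightarrow>
            consistent_exact_recovery (AWCD_circ k) K \<theta> \<rho>) \<and>
         ((\<forall>\<^sub>F n in sequentially.
              c * \<theta> n > real n powr (- ((2 * real k + 1) / (2 * real k + 3)))
                        * ln (real n) powr (1 / (2 * real k + 3))) \<longrightarrow>
            consistent_exact_recovery (AWCD k) K \<theta> \<rho>) \<and>
         ((\<forall>\<^sub>F n in sequentially.
              c * \<theta> n > real n powr (- (2 * real k / (2 * real k + 1)))
                        * ln (real n) powr (1 / (2 * real k + 1))) \<longrightarrow>
            consistent_exact_recovery (AWCD_plus k) K \<theta> \<rho>)) \<and>
      ((\<forall>n\<ge>1. \<theta> n / \<rho> n \<le> C) \<longrightarrow>
         ((\<forall>\<^sub>F n in sequentially.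
              c * (\<theta> n - \<rho> n) > max (rate1 k (\<theta> n) n) (rate2_circ k (\<theta> n) n)) \<longrightarrow>
            consistent_exact_recovery (AWCD_circ k) K \<theta> \<rho>) \<and>
         ((\<forall>\<^sub>F n in sequentially.
              c * (\<theta> n - \<rho> n) > max (rate1 k (\<theta> n) n) (rate2 k (\<theta> n) n)) \<longrightarrow>
            consistent_exact_recovery (AWCD k) K \<theta> \<rho>) \<and>
         ((\<forall>\<^sub>F n in sequentially.
              c * (\<theta> n - \<rho> n) > max (rate1 k (\<theta> n) n) (rate2_plus k (\<theta> n) n)) \<longrightarrow>
            consistent_exact_recovery (AWCD_plus k) K \<theta> \<rho>)))"
proof -
  define c' where "c' = rate_const K k C"
  define \<kappa> where "\<kappa> = rate_const K k C * (1 - 1 / C)"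
  \<comment> \<open>The exponent (2k+1)/k inverts the k/(2k+1) of \<open>c_powr_le\<close>;
    \<open>c'\<close> is what the bounded-ratio claim requires.\<close>
  define c where "c = min c' (min 1 ((\<kappa> / 2) powr ((2 * real k + 1) / real k)))"
  have \<kappa>: "0 < \<kappa>" unfolding \<kappa>_def using rate_const_bounds(1) assms(3) by simp
  have c: "0 < c" "c \<le> 1" "c \<le> c'"
    using \<kappa> rate_const_bounds(1)[of K k C] by (auto simp: c_def c'_def)
  have "c powr (real k / (2 * real k + 1)) \<le> ((\<kappa> / 2) powr ((2 * real k + 1) / real k)) powr (real k / (2 * real k + 1))"
    using c by (intro powr_mono2) (auto simp: c_def)
  also have "\<dots> = \<kappa> / 2" using \<kappa> assms(2) by (simp add: powr_powr)
  finally have c\<kappa>: "c powr (real k / (2 * real k + 1)) \<le> \<kappa> / 2" .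
  show ?thesis
  proof (intro exI[of _ c] conjI allI impI)
    show "0 < c" by (rule c)
  next
    fix \<theta> \<rho> :: "nat \<Rightarrow> real"
    assume par: "\<forall>n\<ge>1. 0 < \<rho> n \<and> \<rho> n < \<theta> n \<and> \<theta> n \<le> 1"
      and sparse: "(\<forall>n\<ge>1. \<theta> n / \<rho> n = C) \<and>
        (\<forall>\<^sub>F n in sequentially. \<theta> n < c * real n powr (- ((real k - 1) / real k)))"
    have ratio: "\<forall>n\<ge>1. \<theta> n / \<rho> n = C" and ratio': "\<forall>n\<ge>1. \<theta> n / \<rho> n \<le> C" using sparse by auto
    note up = conjunct2[OF sparse]
    note ctx = assms(2,3) \<kappa>_def c(1,2) c\<kappa> par ratio
    note rec = gap_regime_recovery[OF assms par ratio' rate1_lt[OF ctx up low_from_rate[OF ctx]]]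
    {
      assume low: "\<forall>\<^sub>F n in sequentially. c * \<theta> n > real n powr (- (real k / (real k + 1)))"
      \<comment> \<open>The logarithm to the power 0 brings this hypothesis into the common form of
        the three.\<close>
      then have low': "\<forall>\<^sub>F n in sequentially. c * \<theta> n > real n powr (- (real k / (real k + 1))) * ln (real n) powr 0"
        using eventually_ge_at_top[of 16]
        by eventually_elim (use ln_ge_1 in \<open>force simp: powr_def\<close>)
      show "consistent_exact_recovery (AWCD_circ k) K \<theta> \<rho>"
      proof (rule rec(1)[OF low'])
        show "\<forall>\<^sub>F n in sequentially. rate2_circ k (\<theta> n) n < rate_const K k C * (\<theta> n - \<rho> n)"
          using low' eventually_ge_at_top[of 16]
        proof eventually_elim
          case (elim n)
          \<comment> \<open>Here and in the two cases below, p is determined by 1 - p being the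
            exponent of \<theta> in the second rate.\<close>
          show ?case
          proof (rule rate2_lt[OF ctx elim(2) rate_monom_le[OF ctx elim(2,1)], where p = "(real k + 1) / (2 * real k + 1)"
                and u' = "real k / (2 * real k + 1)" and v' = "- (real k / (2 * real k + 1))" and w' = 0])
            have "x / a * (a / b) = x / b" if "a \<noteq> 0" for x a b :: real using that by simp
            then have "real k / (real k + 1) * ((real k + 1) / (2 * real k + 1)) = real k / (2 * real k + 1)" by simp
            then show "- (real k / (2 * real k + 1)) = - (real k / (real k + 1)) * ((real k + 1) / (2 * real k + 1))"
              by (simp only: mult_minus_left)
          qed (use elim(2) ln_ge_1[OF elim(2)] in \<open>auto simp: rate2_circ_def monom3_def field_simps\<close>)
        qed
      qed (auto simp: divide_simps algebra_simps)
    next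
      assume low': "\<forall>\<^sub>F n in sequentially. c * \<theta> n > real n powr (- ((2 * real k + 1) / (2 * real k + 3))) * ln (real n) powr (1 / (2 * real k + 3))"
      show "consistent_exact_recovery (AWCD k) K \<theta> \<rho>"
      proof (rule rec(2)[OF low'])
        have nz: "6 + (real k * 16 + real k * (real k * 8)) \<noteq> 0"
          using add_pos_nonneg[of 6 "real k * 16 + real k * (real k * 8)"] by simp
        show "(2 * real k + 1) / (2 * real k + 3) \<le> 2 * real k / (2 * real k + 1)"
          using assms(2) by (simp add: divide_simps algebra_simps)
        show "\<forall>\<^sub>F n in sequentially. rate2 k (\<theta> n) n < rate_const K k C * (\<theta> n - \<rho> n)"
          using low' eventually_ge_at_top[of 16]
        proof eventually_elim
          case (elim n)
          show ?case
            by (rule rate2_lt[OF ctx elim(2) rate_monom_le[OF ctx elim(2,1)], where p = "(2 * real k + 3) / (4 * real k + 2)"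
                and u' = "(2 * real k - 1) / (4 * real k + 2)" and v' = "- (1 / 2)" and w' = "1 / (4 * real k + 2)"])
              (use nz in \<open>auto simp: rate2_def monom3_def field_simps\<close>)
        qed
      qed auto
    next
      assume low': "\<forall>\<^sub>F n in sequentially. c * \<theta> n > real n powr (- (2 * real k / (2 * real k + 1))) * ln (real n) powr (1 / (2 * real k + 1))"
      show "consistent_exact_recovery (AWCD_plus k) K \<theta> \<rho>"
      proof (rule rec(3)[OF low'])
        show "\<forall>\<^sub>F n in sequentially. rate2_plus k (\<theta> n) n < rate_const K k C * (\<theta> n - \<rho> n)"
          using low' eventually_ge_at_top[of 16]
        proof eventually_elim
          case (elim n)
          show ?case
            by (rule rate2_lt[OF ctx elim(2) rate_monom_le[OF ctx elim(2,1)], where p = "1 / 2"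
                and u' = "1 / 2" and v' = "- (real k / (2 * real k + 1))" and w' = "1 / (4 * real k + 2)"])
              (auto simp: rate2_plus_def monom3_def field_simps)
        qed
      qed auto
    }
  next
    fix \<theta> \<rho> :: "nat \<Rightarrow> real"
    assume par: "\<forall>n\<ge>1. 0 < \<rho> n \<and> \<rho> n < \<theta> n \<and> \<theta> n \<le> 1" and ratio: "\<forall>n\<ge>1. \<theta> n / \<rho> n \<le> C"
    have mono: "\<forall>\<^sub>F n in sequentially. rate1 k (\<theta> n) n < rate_const K k C * (\<theta> n - \<rho> n)"
        "\<forall>\<^sub>F n in sequentially. R n < rate_const K k C * (\<theta> n - \<rho> n)"
      if "\<forall>\<^sub>F n in sequentially. c * (\<theta> n - \<rho> n) > max (rate1 k (\<theta> n) n) (R n)" for R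
    proof -
      have "\<forall>\<^sub>F n in sequentially. max (rate1 k (\<theta> n) n) (R n) < rate_const K k C * (\<theta> n - \<rho> n)"
        using that eventually_ge_at_top[of 1]
      proof eventually_elim
        case (elim n)
        have "c * (\<theta> n - \<rho> n) \<le> rate_const K k C * (\<theta> n - \<rho> n)"
          using c(3) par elim(2) by (intro mult_right_mono) (auto simp: c'_def dest: spec[of _ n])
        then show ?case using elim(1) by linarith
      qed
      then show "\<forall>\<^sub>F n in sequentially. rate1 k (\<theta> n) n < rate_const K k C * (\<theta> n - \<rho> n)"
        "\<forall>\<^sub>F n in sequentially. R n < rate_const K k C * (\<theta> n - \<rho> n)"
        by (auto elim: eventually_mono)
    qed
    note rec = gap_regime_recovery[OF assms par ratio]
    {
      assume "\<forall>\<^sub>F n in sequentially. c * (\<theta> n - \<rho> n) > max (rate1 k (\<theta> n) n) (rate2_circ k (\<theta> n) n)"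
      from mono[OF this] show "consistent_exact_recovery (AWCD_circ k) K \<theta> \<rho>" by (rule rec(1))
    next
      assume "\<forall>\<^sub>F n in sequentially. c * (\<theta> n - \<rho> n) > max (rate1 k (\<theta> n) n) (rate2 k (\<theta> n) n)"
      from mono[OF this] show "consistent_exact_recovery (AWCD k) K \<theta> \<rho>" by (rule rec(2))
    next
      assume "\<forall>\<^sub>F n in sequentially. c * (\<theta> n - \<rho> n) > max (rate1 k (\<theta> n) n) (rate2_plus k (\<theta> n) n)"
      from mono[OF this] show "consistent_exact_recovery (AWCD_plus k) K \<theta> \<rho>" by (rule rec(3))
    }
  qed
qed

end
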